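(* Let $(M,F)$ be a Finsler manifold (no completeness is assumed) and let $N \subset M$ be a closed (not necessarily compact) submanifold. Then $N \cap \mathrm{Cu}(N) = \emptyset$, where $\mathrm{Cu}(N)$ is the cut locus of $N$.
   Context: All manifolds are smooth, connected and without boundary. A closed submanifold is a topologically closed, not necessarily compact, embedded submanifold. A Finsler metric on $M$ is a continuous function $F : TM \to \mathbb{R}$, smooth on $TM$ minus the zero section, such that for each $p \in M$ the restriction $F_p = F|_{T_pM}$ satisfies $F_p(\lambda \mathbf{v}) = \lambda F_p(\mathbf{v})$ for all $\lambda > 0$ and $\mathbf{v} \ne 0$, and for each $\mathbf{v} \in T_pM \setminus \{0\}$ the fundamental tensor $g_{\mathbf{v}}(\mathbf{v}_1, \mathbf{v}_2) = \frac12 \frac{\partial^2}{\partial s_1 \partial s_2}\big|_{s_1=s_2=0} F_p(\mathbf{v} + s_1\mathbf{v}_1 + s_2\mathbf{v}_2)^2$ is positive definite. $F$ need not be reversible. The length of a piecewise smooth curve $\gamma:[a,b]\to M$ is $L(\gamma) = \int_a^b F(\dot\gamma)\,dt$, its energy is $E(\gamma) = \frac12 \int_a^b F(\dot\gamma)^2 dt$; $d(p,q)$ is the infimum of lengths of piecewise smooth curves from $p$ to $q$ (possibly asymmetric), and $d(N,q)$ is the infimum of lengths of piecewise smooth curves starting at a point of $N$ and ending at $q$. Geodesics are critical points of $E$ (with fixed end points). $\exp : \mathcal{O} \subset TM \to M$, $\exp(\mathbf{v}) = \gamma_{\mathbf{v}}(1)$, where $\gamma_{\mathbf{v}}$ is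 the geodesic with initial velocity $\mathbf{v}$ and $\mathcal{O}$ is the maximal open neighborhood of the zero section where this is defined. Geodesics are considered only where they are defined. For $p \in N$ the normal cone is $\nu_p = \{\mathbf{v} \in T_pM \setminus \{0\} : g_{\mathbf{v}}(\mathbf{v},\mathbf{w}) = 0 \ \forall \mathbf{w} \in T_pN\} \cup \{0\}$; $\nu = \nu(N) = \bigcup_{p \in N} \nu_p$, and $S(\nu) = \{\mathbf{v} \in \nu : F(\mathbf{v}) = 1\}$. The normal exponential map $\exp^\nu$ is the restriction of $\exp$ to $\nu$ (where defined). An $N$-geodesic is a critical point of $E$ restricted to curves starting on $N$ (with fixed end point); the unit-speed $N$-geodesics are the curves $\gamma_{\mathbf{v}}(t) = \exp^\nu(t\mathbf{v})$ with $\mathbf{v} \in S(\nu)$. An $N$-segment is a unit-speed $N$-geodesic $\gamma : [a,b] \to M$ with $d(N,\gamma(b)) = b-a = L(\gamma)$; it is said to join $N$ to $\gamma(b)$. The cut locus $\mathrm{Cu}(N)$ is the set of points $q \in M$ such that there is an $N$-segment joining $N$ to $q$, any extension of which fails to be an $N$-segment. For $\mathbf{v} \in S(\nu)$ the cut time is $\rho(\mathbf{v}) = \sup\{t : d(N,\gamma_{\mathbf{v}}(t)) = t\} \in [0,\infty]$. Every $x \in \mathrm{Cu}(N)$ is of the form $x = \exp^\nu(\rho(\mathbf{v})\mathbf{v})$ for some $\mathbf{v} \in S(\nu)$ with $\rho(\mathbf{v}) < \infty$; here $\rho(\mathbf{v}) = 0$ (a degenerate $N$-segment of length $0$) is not excluded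 a priori. *)

theory Defs
  imports "HOL-Analysis.Analysis"
begin

section \<open>Smooth maps between Euclidean spaces\<close>

text \<open>Both notions are only used on open sets; there, having continuous directional derivatives
  up to order \<open>k\<close> is the usual \<open>C\<^sup>k\<close> condition.\<close>

primrec Ck_on :: "nat \<Rightarrow> 'a::euclidean_space set \<Rightarrow> ('a \<Rightarrow> 'b::real_normed_vector) \<Rightarrow> bool" where
  "Ck_on 0 S f \<longleftrightarrow> continuous_on S f"
| "Ck_on (Suc k) S f \<longleftrightarrow>
     (\<forall>x\<in>S. f differentiable (at x)) \<and> (\<forall>v. Ck_on k S (\<lambda>x. frechet_derivative f (at x) v))"

definition smooth_on :: "'a::euclidean_space set \<Rightarrow> ('a \<Rightarrow> 'b::real_normed_vector) \<Rightarrow> bool" where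
  "smooth_on S f \<longleftrightarrow> (\<forall>k. Ck_on k S f)"


section \<open>Smooth manifolds\<close>

text \<open>The underlying space of the manifold is a Hausdorff, second countable type \<open>'m\<close>. A chart
  \<open>(U, \<phi>)\<close> is a homeomorphism from an open set \<open>U\<close> onto an open subset of \<open>'e\<close>; the values of
  \<open>\<phi>\<close> outside \<open>U\<close> are irrelevant.\<close>

type_synonym ('m, 'e) chart = "'m set \<times> ('m \<Rightarrow> 'e)"

abbreviation chart_dom :: "('m, 'e) chart \<Rightarrow> 'm set" where
  "chart_dom \<equiv> fst"

abbreviation chart_map :: "('m, 'e) chart \<Rightarrow> 'm \<Rightarrow> 'e" where
  "chart_map \<equiv> snd"

definition chart_inv :: "('m, 'e) chart \<Rightarrow> 'e \<Rightarrow> 'm" where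
  "chart_inv c = inv_into (chart_dom c) (chart_map c)"

definition chart_cod :: "('m, 'e) chart \<Rightarrow> 'e set" where
  "chart_cod c = chart_map c ` chart_dom c"

definition is_chart :: "('m::topological_space, 'e::euclidean_space) chart \<Rightarrow> bool" where
  "is_chart c \<longleftrightarrow> open (chart_dom c) \<and> open (chart_cod c) \<and>
     homeomorphism (chart_dom c) (chart_cod c) (chart_map c) (chart_inv c)"

definition transition :: "('m, 'e) chart \<Rightarrow> ('m, 'e) chart \<Rightarrow> 'e \<Rightarrow> 'e" where
  "transition c c' = chart_map c' \<circ> chart_inv c"

definition compatible ::
    "('m::topological_space, 'e::euclidean_space) chart \<Rightarrow> ('m, 'e) chart \<Rightarrow> bool" where
  "compatible c c' \<longleftrightarrow>
     smooth_on (chart_map c ` (chart_dom c \<inter> chart_dom c')) (transition c c') \<and>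
     smooth_on (chart_map c' ` (chart_dom c \<inter> chart_dom c')) (transition c' c)"

text \<open>A smooth structure is given by a maximal atlas.\<close>

definition smooth_structure ::
    "('m::{t2_space,second_countable_topology}, 'e::euclidean_space) chart set \<Rightarrow> bool" where
  "smooth_structure A \<longleftrightarrow>
     (\<forall>c\<in>A. is_chart c) \<and> (\<Union>c\<in>A. chart_dom c) = UNIV \<and>
     (\<forall>c\<in>A. \<forall>c'\<in>A. compatible c c') \<and>
     (\<forall>c. is_chart c \<longrightarrow> (\<forall>c'\<in>A. compatible c c') \<longrightarrow> c \<in> A)"

definition smooth_manifold ::
    "('m::{t2_space,second_countable_topology}, 'e::euclidean_space) chart set \<Rightarrow> bool" where
  "smooth_manifold A \<longleftrightarrow> smooth_structure A \<and> connected (UNIV :: 'm set)"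

text \<open>Embedded submanifolds are described by slice charts.\<close>

definition closed_submanifold ::
    "('m::{t2_space,second_countable_topology}, 'e::euclidean_space) chart set \<Rightarrow> 'm set \<Rightarrow> bool" where
  "closed_submanifold A N \<longleftrightarrow> closed N \<and> connected N \<and>
     (\<exists>k. \<forall>p\<in>N. \<exists>c\<in>A. \<exists>V. p \<in> chart_dom c \<and> subspace V \<and> dim V = k \<and>
        chart_map c ` (chart_dom c \<inter> N) = chart_cod c \<inter> V)"

text \<open>Smoothness of a map into \<open>'m\<close> on an arbitrary subset of a Euclidean space: in charts it is
  locally the restriction of a smooth map on an open set. It is used for curves on compact
  intervals and for variations on strips.\<close>

definition smooth_map_on ::
    "('m::topological_space, 'e::euclidean_space) chart set \<Rightarrow>
     'a::euclidean_space set \<Rightarrow> ('a \<Rightarrow> 'm) \<Rightarrow> bool" where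
  "smooth_map_on A S f \<longleftrightarrow>
     (\<forall>x\<in>S. \<exists>c\<in>A. \<exists>W g. open W \<and> x \<in> W \<and> f ` (S \<inter> W) \<subseteq> chart_dom c \<and> smooth_on W g \<and>
        (\<forall>y\<in>S \<inter> W. chart_map c (f y) = g y))"


section \<open>Tangent vectors\<close>

text \<open>A tangent vector at \<open>p\<close> is the family of its coordinate vectors in all charts around \<open>p\<close>,
  related by the derivatives of the transition maps; at all other charts it is set to \<open>0\<close>.
  Vector space operations are pointwise, and the zero vector is \<open>\<lambda>_. 0\<close>.\<close>

type_synonym ('m, 'e) tvec = "('m, 'e) chart \<Rightarrow> 'e"

definition tangent_space ::
    "('m::topological_space, 'e::euclidean_space) chart set \<Rightarrow> 'm \<Rightarrow> ('m, 'e) tvec set" where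
  "tangent_space A p = {v.
     (\<forall>c\<in>A. \<forall>c'\<in>A. p \<in> chart_dom c \<inter> chart_dom c' \<longrightarrow>
        v c' = frechet_derivative (transition c c') (at (chart_map c p)) (v c)) \<and>
     (\<forall>c. c \<notin> A \<or> p \<notin> chart_dom c \<longrightarrow> v c = 0)}"

text \<open>The tangent vector at \<open>p\<close> whose coordinate vector in the chart \<open>c\<close> around \<open>p\<close> is \<open>u\<close>.\<close>

definition tangent_vec ::
    "('m::topological_space, 'e::euclidean_space) chart set \<Rightarrow>
     ('m, 'e) chart \<Rightarrow> 'm \<Rightarrow> 'e \<Rightarrow> ('m, 'e) tvec" where
  "tangent_vec A c p u = (\<lambda>c'. if c' \<in> A \<and> p \<in> chart_dom c'
     then frechet_derivative (transition c c') (at (chart_map c p)) u else 0)"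

text \<open>The velocity at time \<open>t\<close> of a curve defined on \<open>T\<close> (one-sided at the end points of an
  interval).\<close>

definition velocity ::
    "('m::topological_space, 'e::euclidean_space) chart set \<Rightarrow>
     real set \<Rightarrow> (real \<Rightarrow> 'm) \<Rightarrow> real \<Rightarrow> ('m, 'e) tvec" where
  "velocity A T \<gamma> t = (\<lambda>c. if c \<in> A \<and> \<gamma> t \<in> chart_dom c
     then vector_derivative (\<lambda>s. chart_map c (\<gamma> s)) (at t within T) else 0)"


section \<open>Finsler metrics\<close>

text \<open>A function on the tangent bundle is written \<open>F p v\<close> with \<open>v \<in> tangent_space A p\<close>; its values
  elsewhere are irrelevant. Its expression in the bundle chart induced by \<open>c\<close> is
  \<open>local_expr A F c\<close>.\<close>

definition local_expr ::
    "('m::topological_space, 'e::euclidean_space) chart set \<Rightarrow>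
     ('m \<Rightarrow> ('m, 'e) tvec \<Rightarrow> real) \<Rightarrow> ('m, 'e) chart \<Rightarrow> 'e \<times> 'e \<Rightarrow> real" where
  "local_expr A F c =
     (\<lambda>(x, u). F (chart_inv c x) (tangent_vec A c (chart_inv c x) u))"

definition fundamental_tensor ::
    "('m \<Rightarrow> ('m, 'e::euclidean_space) tvec \<Rightarrow> real) \<Rightarrow> 'm \<Rightarrow>
     ('m, 'e) tvec \<Rightarrow> ('m, 'e) tvec \<Rightarrow> ('m, 'e) tvec \<Rightarrow> real" where
  "fundamental_tensor F p v v1 v2 = 1 / 2 *
     deriv (\<lambda>s1. deriv (\<lambda>s2. (F p (\<lambda>c. v c + s1 *\<^sub>R v1 c + s2 *\<^sub>R v2 c))\<^sup>2) 0) 0"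

text \<open>Neither reversibility nor any form of completeness is required.\<close>

definition finsler_metric ::
    "('m::topological_space, 'e::euclidean_space) chart set \<Rightarrow>
     ('m \<Rightarrow> ('m, 'e) tvec \<Rightarrow> real) \<Rightarrow> bool" where
  "finsler_metric A F \<longleftrightarrow>
     (\<forall>c\<in>A. continuous_on (chart_cod c \<times> UNIV) (local_expr A F c)) \<and>
     (\<forall>c\<in>A. smooth_on (chart_cod c \<times> (UNIV - {0})) (local_expr A F c)) \<and>
     (\<forall>p. \<forall>v \<in> tangent_space A p - {\<lambda>_. 0}. \<forall>r>0. F p (\<lambda>c. r *\<^sub>R v c) = r * F p v) \<and>
     (\<forall>p. \<forall>v \<in> tangent_space A p - {\<lambda>_. 0}. \<forall>w \<in> tangent_space A p - {\<lambda>_. 0}.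
        fundamental_tensor F p v w w > 0)"

definition finsler_manifold ::
    "('m::{t2_space,second_countable_topology}, 'e::euclidean_space) chart set \<Rightarrow>
     ('m \<Rightarrow> ('m, 'e) tvec \<Rightarrow> real) \<Rightarrow> bool" where
  "finsler_manifold A F \<longleftrightarrow> smooth_manifold A \<and> finsler_metric A F"


section \<open>Length, energy and distance\<close>

definition pw_smooth_curve ::
    "('m::topological_space, 'e::euclidean_space) chart set \<Rightarrow>
     (real \<Rightarrow> 'm) \<Rightarrow> real \<Rightarrow> real \<Rightarrow> bool" where
  "pw_smooth_curve A \<gamma> a b \<longleftrightarrow> a < b \<and>
     (\<exists>n. \<exists>t :: nat \<Rightarrow> real. t 0 = a \<and> t n = b \<and>
        (\<forall>i<n. t i < t (Suc i) \<and> smooth_map_on A {t i..t (Suc i)} \<gamma>))"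

text \<open>At the finitely many break points of a piecewise smooth curve the velocity is unspecified,
  which does not affect the integrals below.\<close>

definition curve_length ::
    "('m::topological_space, 'e::euclidean_space) chart set \<Rightarrow>
     ('m \<Rightarrow> ('m, 'e) tvec \<Rightarrow> real) \<Rightarrow> (real \<Rightarrow> 'm) \<Rightarrow> real \<Rightarrow> real \<Rightarrow> real" where
  "curve_length A F \<gamma> a b = integral {a..b} (\<lambda>t. F (\<gamma> t) (velocity A {a..b} \<gamma> t))"

definition curve_energy ::
    "('m::topological_space, 'e::euclidean_space) chart set \<Rightarrow>
     ('m \<Rightarrow> ('m, 'e) tvec \<Rightarrow> real) \<Rightarrow> (real \<Rightarrow> 'm) \<Rightarrow> real \<Rightarrow> real \<Rightarrow> real" where
  "curve_energy A F \<gamma> a b =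
     1 / 2 * integral {a..b} (\<lambda>t. (F (\<gamma> t) (velocity A {a..b} \<gamma> t))\<^sup>2)"

text \<open>Infima are taken in the extended reals, so that they are meaningful also for an empty \<open>N\<close>
  and without any assumption on the sign of \<open>F\<close>.\<close>

definition dist_from ::
    "('m::topological_space, 'e::euclidean_space) chart set \<Rightarrow>
     ('m \<Rightarrow> ('m, 'e) tvec \<Rightarrow> real) \<Rightarrow> 'm set \<Rightarrow> 'm \<Rightarrow> ereal" where
  "dist_from A F N q = Inf {ereal (curve_length A F \<gamma> a b) | \<gamma> a b.
     pw_smooth_curve A \<gamma> a b \<and> \<gamma> a \<in> N \<and> \<gamma> b = q}"


section \<open>Geodesics issuing from a submanifold\<close>

text \<open>A variation of a curve is a family of curves \<open>H s\<close> with \<open>\<bar>s\<bar> < \<epsilon>\<close> and \<open>H 0 = \<gamma>\<close> that is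
  smooth in \<open>(s, t)\<close> on each strip of a partition of \<open>{a..b}\<close>.\<close>

definition variation ::
    "('m::topological_space, 'e::euclidean_space) chart set \<Rightarrow>
     (real \<Rightarrow> 'm) \<Rightarrow> real \<Rightarrow> real \<Rightarrow> real \<Rightarrow> (real \<Rightarrow> real \<Rightarrow> 'm) \<Rightarrow> bool" where
  "variation A \<gamma> a b \<epsilon> H \<longleftrightarrow> 0 < \<epsilon> \<and> (\<forall>t\<in>{a..b}. H 0 t = \<gamma> t) \<and>
     (\<exists>n. \<exists>t :: nat \<Rightarrow> real. t 0 = a \<and> t n = b \<and>
        (\<forall>i<n. t i < t (Suc i) \<and>
           smooth_map_on A ({-\<epsilon><..<\<epsilon>} \<times> {t i..t (Suc i)}) (\<lambda>(s, t). H s t)))"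

text \<open>Critical points of the energy among the curves that start on \<open>N\<close> and have the same end
  point as \<open>\<gamma>\<close>.\<close>

definition N_geodesic ::
    "('m::topological_space, 'e::euclidean_space) chart set \<Rightarrow>
     ('m \<Rightarrow> ('m, 'e) tvec \<Rightarrow> real) \<Rightarrow> 'm set \<Rightarrow> (real \<Rightarrow> 'm) \<Rightarrow> real \<Rightarrow> real \<Rightarrow> bool" where
  "N_geodesic A F N \<gamma> a b \<longleftrightarrow> pw_smooth_curve A \<gamma> a b \<and> \<gamma> a \<in> N \<and>
     (\<forall>\<epsilon> H. variation A \<gamma> a b \<epsilon> H \<longrightarrow> (\<forall>s\<in>{-\<epsilon><..<\<epsilon>}. H s a \<in> N \<and> H s b = \<gamma> b) \<longrightarrow>
        ((\<lambda>s. curve_energy A F (H s) a b) has_real_derivative 0) (at 0))"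

definition unit_speed ::
    "('m::topological_space, 'e::euclidean_space) chart set \<Rightarrow>
     ('m \<Rightarrow> ('m, 'e) tvec \<Rightarrow> real) \<Rightarrow> (real \<Rightarrow> 'm) \<Rightarrow> real \<Rightarrow> real \<Rightarrow> bool" where
  "unit_speed A F \<gamma> a b \<longleftrightarrow> (\<forall>t\<in>{a..b}. F (\<gamma> t) (velocity A {a..b} \<gamma> t) = 1)"

text \<open>A unit-speed \<open>N\<close>-geodesic on \<open>{a..b}\<close> with initial velocity \<open>v\<close>, where \<open>a = b\<close> is allowed.
  For \<open>a < b\<close> one may take \<open>c = b\<close> and \<open>\<gamma>' = \<gamma>\<close>, because restrictions of \<open>N\<close>-geodesics to initial
  subintervals are again \<open>N\<close>-geodesics. For \<open>a = b\<close> the curve is a point of \<open>N\<close> together with a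
  unit vector \<open>v\<close> in the normal cone there; the initial velocity has to be recorded because it is
  not determined by the point.\<close>

definition unit_N_geodesic ::
    "('m::topological_space, 'e::euclidean_space) chart set \<Rightarrow>
     ('m \<Rightarrow> ('m, 'e) tvec \<Rightarrow> real) \<Rightarrow> 'm set \<Rightarrow>
     ('m, 'e) tvec \<Rightarrow> (real \<Rightarrow> 'm) \<Rightarrow> real \<Rightarrow> real \<Rightarrow> bool" where
  "unit_N_geodesic A F N v \<gamma> a b \<longleftrightarrow> a \<le> b \<and>
     (\<exists>c \<gamma>'. a < c \<and> b \<le> c \<and> N_geodesic A F N \<gamma>' a c \<and> unit_speed A F \<gamma>' a c \<and>
        velocity A {a..c} \<gamma>' a = v \<and> (\<forall>t\<in>{a..b}. \<gamma> t = \<gamma>' t))"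

definition N_segment ::
    "('m::topological_space, 'e::euclidean_space) chart set \<Rightarrow>
     ('m \<Rightarrow> ('m, 'e) tvec \<Rightarrow> real) \<Rightarrow> 'm set \<Rightarrow>
     ('m, 'e) tvec \<Rightarrow> (real \<Rightarrow> 'm) \<Rightarrow> real \<Rightarrow> real \<Rightarrow> bool" where
  "N_segment A F N v \<gamma> a b \<longleftrightarrow> unit_N_geodesic A F N v \<gamma> a b \<and>
     dist_from A F N (\<gamma> b) = ereal (b - a) \<and> curve_length A F \<gamma> a b = b - a"

text \<open>For \<open>a < b\<close> the extensions automatically have the same initial velocity. For \<open>a = b\<close> only
  extensions in the direction of \<open>v\<close> count, in accordance with the cut time of \<open>v\<close> being \<open>0\<close>.\<close>

definition cut_locus ::
    "('m::topological_space, 'e::euclidean_space) chart set \<Rightarrow>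
     ('m \<Rightarrow> ('m, 'e) tvec \<Rightarrow> real) \<Rightarrow> 'm set \<Rightarrow> 'm set" where
  "cut_locus A F N = {q. \<exists>v \<gamma> a b. N_segment A F N v \<gamma> a b \<and> \<gamma> b = q \<and>
     (\<forall>\<gamma>' b'. b < b' \<and> (\<forall>t\<in>{a..b}. \<gamma>' t = \<gamma> t) \<longrightarrow> \<not> N_segment A F N v \<gamma>' a b')}"

end

theory Submission
  imports Defs
begin

text \<open>A point \<open>q\<close> of \<open>N\<close> has distance at most \<open>0\<close> from \<open>N\<close>, so an \<open>N\<close>-segment ending at \<open>q\<close> has
  length \<open>0\<close>, and it suffices that a unit-speed \<open>N\<close>-geodesic \<open>\<gamma>\<close> minimizes for a short time. In a
  slice chart let \<open>L = G\<^sup>2 / 2\<close> be the energy density. Criticality of \<open>\<gamma>\<close> says that the momentum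
  \<open>\<xi> = L\<^sub>v(\<gamma>, \<gamma>')\<close> satisfies \<open>\<xi>' = L\<^sub>x(\<gamma>, \<gamma>')\<close> and is orthogonal to \<open>N\<close> at the start. For large \<open>k\<close> and
  a short time the function \<open>\<theta> / 2 + \<xi>(\<theta>) \<bullet> (x - \<gamma>(\<theta>)) - k \<theta> / 2 |x - \<gamma>(\<theta>)|\<^sup>2\<close> of time \<open>\<theta>\<close> and
  position \<open>x\<close> grows along every curve at most as fast as its energy, because \<open>L\<close> is strictly convex
  in the velocity; so neither the exponential map nor minimizers are needed. A curve from \<open>N\<close> to
  \<open>\<gamma>(\<delta>)\<close> in the chart, parametrized with almost constant speed, thus has length at least \<open>\<delta>\<close>.

  If \<open>F > 0\<close>, then a curve that leaves the chart is too long. The definition of a Finsler metric also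
  admits \<open>F < 0\<close>, which excludes unit-speed curves, and in dimension one metrics whose sign changes
  with the direction. In the last case \<open>N\<close> is a point, and the argument is that curves from \<open>N\<close> of
  too small length would produce loops of negative length, hence distance \<open>-\<infinity>\<close>.\<close>

section \<open>Calculus of \<open>C\<^sup>k\<close> maps\<close>

text \<open>The calibrating function is a subsolution of the Hamilton-Jacobi equation that is exact
  along \<gamma>. Its linear part alone would not do, because \<open>L\<close> need not be convex in
  the position: the time derivative of the quadratic term provides \<open>k / 2\<close> times the
  squared distance from \<gamma>, which absorbs negative second derivatives of \<open>L\<close> in
  the position. The factor \<theta> makes the quadratic term vanish at the start and keeps the mixed
  term of position and velocity small for a short time. In a slice chart \<open>N\<close> is a piece
  of a linear subspace, so orthogonality of the initial momentum makes the function vanish at all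
  nearby points of \<open>N\<close>, and no curvature of \<open>N\<close> enters. The outcome is the
  lower bound \<open>d / 2\<close> for the energy of a curve run through in time \<open>d\<close>.
  It becomes a bound for the length \<open>l\<close>, since at constant speed this energy is
  \<open>l\<^sup>2 / (2 * d)\<close>.\<close>

lemma Ck_on_subset: "Ck_on k S f \<Longrightarrow> T \<subseteq> S \<Longrightarrow> Ck_on k T f"
  by (induction k arbitrary: f) (auto intro: continuous_on_subset)

lemma Ck_on_cong:
  assumes "open S" "Ck_on k S f" "\<And>x. x \<in> S \<Longrightarrow> f x = g x"
  shows "Ck_on k S g"
  using assms(2,3)
proof (induction k arbitrary: f g)
  case 0
  then show ?case by (auto cong: continuous_on_cong)
next
  case (Suc k)
  have d: "(g has_derivative frechet_derivative f (at x)) (at x)" if "x \<in> S" for x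
    using Suc.prems that assms(1)
    by (auto intro: has_derivative_transform_within_open simp: frechet_derivative_works)
  have e: "frechet_derivative g (at x) = frechet_derivative f (at x)" if "x \<in> S" for x
    using d[OF that] frechet_derivative_at by metis
  show ?case
    using Suc.prems(1) d e Suc.IH[of "\<lambda>x. frechet_derivative f (at x) v"
        "\<lambda>x. frechet_derivative g (at x) v" for v]
    by (auto simp: differentiable_def)
qed

text \<open>\<open>Ck_on\<close> refers to \<open>frechet_derivative\<close>, a choice term. This
  rule admits any explicit candidate for the derivative; on an open set the two agree near every
  point, so that \<open>Ck_on_cong\<close> applies.\<close>

lemma Ck_on_SucI:
  assumes "open S" "\<And>x. x \<in> S \<Longrightarrow> (f has_derivative f' x) (at x)"
    "\<And>v. Ck_on k S (\<lambda>x. f' x v)"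
  shows "Ck_on (Suc k) S f"
proof -
  have "frechet_derivative f (at x) = f' x" if "x \<in> S" for x
    using frechet_derivative_at[OF assms(2)[OF that]] by simp
  then have "Ck_on k S (\<lambda>x. frechet_derivative f (at x) v)" for v
    using Ck_on_cong[OF assms(1) assms(3)[of v]] by simp
  then show ?thesis
    using assms(2) by (auto simp: differentiable_def)
qed

lemma Ck_on_SucD: "Ck_on (Suc k) S f \<Longrightarrow> Ck_on k S f"
proof (induction k arbitrary: f)
  case 0
  then show ?case
    using differentiable_imp_continuous_within
    by (auto intro!: continuous_at_imp_continuous_on)
next
  case (Suc k)
  have "Ck_on k S (\<lambda>x. frechet_derivative f (at x) v)" for v
    using Suc.prems Ck_on.simps(2)[of "Suc k" S f] by (intro Suc.IH) blast
  then show ?case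
    using Suc.prems Ck_on.simps(2)[of "Suc k" S f] Ck_on.simps(2)[of k S f] by blast
qed

lemma Ck_on_has_derivative:
  "Ck_on (Suc k) S f \<Longrightarrow> x \<in> S \<Longrightarrow> (f has_derivative frechet_derivative f (at x)) (at x)"
  by (simp add: frechet_derivative_works)

lemma Ck_on_const: "open S \<Longrightarrow> Ck_on k S (\<lambda>x. c)"
  by (induction k arbitrary: c) (auto simp del: Ck_on.simps(2) intro!: Ck_on_SucI derivative_eq_intros)

lemma Ck_on_bounded_linear:
  assumes "open S" "bounded_linear h"
  shows "Ck_on k S h"
proof (cases k)
  case 0
  then show ?thesis by (simp add: assms linear_continuous_on)
next
  case (Suc j)
  show ?thesis unfolding Suc
    by (rule Ck_on_SucI[where f' = "\<lambda>x. h"])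
      (auto intro: assms Ck_on_const bounded_linear_imp_has_derivative)
qed

lemma Ck_on_add:
  assumes "open S"
  shows "Ck_on k S f \<Longrightarrow> Ck_on k S g \<Longrightarrow> Ck_on k S (\<lambda>x. f x + g x)"
proof (induction k arbitrary: f g)
  case 0
  then show ?case by (auto intro: continuous_intros)
next
  case (Suc k)
  show ?case
    using Suc by (intro Ck_on_SucI[where f' = "\<lambda>x v. frechet_derivative f (at x) v + frechet_derivative g (at x) v"])
      (auto intro!: assms has_derivative_add simp: frechet_derivative_works)
qed

lemma Ck_on_sum:
  assumes "open S"
  shows "(\<And>i. i \<in> I \<Longrightarrow> Ck_on k S (f i)) \<Longrightarrow> Ck_on k S (\<lambda>x. \<Sum>i\<in>I. f i x)"
  by (induction I rule: infinite_finite_induct) (auto intro: Ck_on_const Ck_on_add assms)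

lemma Ck_on_bilinear:
  assumes "open S" "bounded_bilinear h"
  shows "Ck_on k S f \<Longrightarrow> Ck_on k S g \<Longrightarrow> Ck_on k S (\<lambda>x. h (f x) (g x))"
proof (induction k arbitrary: f g)
  case 0
  then show ?case by (auto intro: bounded_bilinear.continuous_on[OF assms(2)])
next
  case (Suc k)
  have "Ck_on k S f" "Ck_on k S g"
    using Suc.prems Ck_on_SucD by blast+
  then show ?case
    using Suc.prems
    by (intro Ck_on_SucI[where f' = "\<lambda>x v. h (f x) (frechet_derivative g (at x) v) +
              h (frechet_derivative f (at x) v) (g x)"])
      (auto intro!: assms Ck_on_add Suc.IH bounded_bilinear.FDERIV[OF assms(2)]
        simp: frechet_derivative_works)
qed

text \<open>The chain rule gives \<open>g' (f x) (f' x v)\<close>, where the direction depends on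
  \<open>x\<close>, while the induction hypothesis covers fixed directions only. Expanding
  \<open>f' x v\<close> in the basis separates the two dependences, and the product rule
  \<open>Ck_on_bilinear\<close> finishes the step.\<close>

lemma Ck_on_compose:
  fixes f :: "'a::euclidean_space \<Rightarrow> 'b::euclidean_space" and g :: "'b \<Rightarrow> 'c::real_normed_vector"
  assumes "open S" "open T" "f ` S \<subseteq> T"
  shows "Ck_on k T g \<Longrightarrow> Ck_on k S f \<Longrightarrow> Ck_on k S (\<lambda>x. g (f x))"
proof (induction k arbitrary: g)
  case 0
  then show ?case
    using assms(3) continuous_on_compose2 by (auto simp del: image_subset_iff)
next
  case (Suc k)
  define f' where "f' x = frechet_derivative f (at x)" for x
  define g' where "g' x = frechet_derivative g (at x)" for x
  have f': "(f has_derivative f' x) (at x)" if "x \<in> S" for x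
    using Ck_on_has_derivative[OF Suc.prems(2) that] by (simp add: f'_def)
  have g': "(g has_derivative g' y) (at y)" if "y \<in> T" for y
    using Ck_on_has_derivative[OF Suc.prems(1) that] by (simp add: g'_def)
  have lin: "linear (g' y)" if "y \<in> T" for y
    using g'[OF that] has_derivative_linear by blast
  have Ckf: "Ck_on k S f"
    using Suc.prems Ck_on_SucD by blast
  have "Ck_on k S (\<lambda>x. (f' x v \<bullet> i) *\<^sub>R g' (f x) i)" if "i \<in> Basis" for v i
    using Suc.prems Suc.IH[of "\<lambda>y. g' y i"] Ckf
    by (intro Ck_on_bilinear[OF assms(1) bounded_bilinear_scaleR]
        Ck_on_bilinear[OF assms(1) bounded_bilinear_inner] Ck_on_const assms)
      (auto simp: f'_def g'_def)
  then have C: "Ck_on k S (\<lambda>x. \<Sum>i\<in>Basis. (f' x v \<bullet> i) *\<^sub>R g' (f x) i)" for v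
    by (intro Ck_on_sum assms)
  show ?case
  proof (rule Ck_on_SucI[where f' = "\<lambda>x v. \<Sum>i\<in>Basis. (f' x v \<bullet> i) *\<^sub>R g' (f x) i", OF assms(1) _ C])
    fix x assume x: "x \<in> S"
    have "((\<lambda>x. g (f x)) has_derivative (\<lambda>v. g' (f x) (f' x v))) (at x)"
      by (rule has_derivative_compose[OF f'[OF x] g']) (use x assms(3) in auto)
    moreover have "g' (f x) (f' x v) = (\<Sum>i\<in>Basis. (f' x v \<bullet> i) *\<^sub>R g' (f x) i)" for v
    proof -
      have "f x \<in> T" using x assms(3) by auto
      then have "linear (g' (f x))" by (rule lin)
      then have "g' (f x) (\<Sum>i\<in>Basis. (f' x v \<bullet> i) *\<^sub>R i) = (\<Sum>i\<in>Basis. (f' x v \<bullet> i) *\<^sub>R g' (f x) i)"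
        by (simp add: linear_sum linear_scale)
      then show ?thesis
        by (simp only: euclidean_representation)
    qed
    ultimately show "((\<lambda>x. g (f x)) has_derivative
        (\<lambda>v. \<Sum>i\<in>Basis. (f' x v \<bullet> i) *\<^sub>R g' (f x) i)) (at x)" by simp
  qed
qed

lemma smooth_on_Ck: "smooth_on S f \<Longrightarrow> Ck_on k S f"
  by (simp add: smooth_on_def)

lemma smooth_on_subset: "smooth_on S f \<Longrightarrow> T \<subseteq> S \<Longrightarrow> smooth_on T f"
  by (auto simp: smooth_on_def intro: Ck_on_subset)

lemma smooth_on_const: "open S \<Longrightarrow> smooth_on S (\<lambda>x. c)"
  by (auto simp: smooth_on_def intro: Ck_on_const)

lemma smooth_on_bounded_linear: "open S \<Longrightarrow> bounded_linear h \<Longrightarrow> smooth_on S h"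
  by (auto simp: smooth_on_def intro: Ck_on_bounded_linear)

lemma smooth_on_add: "open S \<Longrightarrow> smooth_on S f \<Longrightarrow> smooth_on S g \<Longrightarrow> smooth_on S (\<lambda>x. f x + g x)"
  by (auto simp: smooth_on_def intro: Ck_on_add)

lemma smooth_on_bilinear:
  "open S \<Longrightarrow> bounded_bilinear h \<Longrightarrow> smooth_on S f \<Longrightarrow> smooth_on S g \<Longrightarrow> smooth_on S (\<lambda>x. h (f x) (g x))"
  by (auto simp: smooth_on_def intro: Ck_on_bilinear)

lemma smooth_on_compose:
  fixes f :: "'a::euclidean_space \<Rightarrow> 'b::euclidean_space" and g :: "'b \<Rightarrow> 'c::real_normed_vector"
  shows "open S \<Longrightarrow> open T \<Longrightarrow> f ` S \<subseteq> T \<Longrightarrow> smooth_on T g \<Longrightarrow> smooth_on S f \<Longrightarrow>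
    smooth_on S (\<lambda>x. g (f x))"
  unfolding smooth_on_def using Ck_on_compose by blast

lemma smooth_on_has_derivative:
  "smooth_on S f \<Longrightarrow> x \<in> S \<Longrightarrow> (f has_derivative frechet_derivative f (at x)) (at x)"
  using Ck_on_has_derivative[of 0 S f x] by (auto simp: smooth_on_def)

lemma smooth_on_continuous: "smooth_on S f \<Longrightarrow> continuous_on S f"
  using smooth_on_Ck[of S f 0] by simp

text \<open>Directional second derivatives, expanded in a basis so that they are jointly continuous in
  the base point and the direction.\<close>

definition dirder2 :: "('a::euclidean_space \<Rightarrow> real) \<Rightarrow> 'a \<Rightarrow> 'a \<Rightarrow> real" where
  "dirder2 f z v = (\<Sum>i\<in>Basis. \<Sum>j\<in>Basis. (v \<bullet> i) * (v \<bullet> j) *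
     frechet_derivative (\<lambda>y. frechet_derivative f (at y) i) (at z) j)"

lemma frechet_derivative_expand:
  fixes f :: "'a::euclidean_space \<Rightarrow> real"
  assumes "f differentiable (at z)"
  shows "frechet_derivative f (at z) v = (\<Sum>i\<in>Basis. (v \<bullet> i) * frechet_derivative f (at z) i)"
proof -
  have "linear (frechet_derivative f (at z))"
    using assms linear_frechet_derivative by blast
  then have "frechet_derivative f (at z) (\<Sum>i\<in>Basis. (v \<bullet> i) *\<^sub>R i) =
      (\<Sum>i\<in>Basis. (v \<bullet> i) * frechet_derivative f (at z) i)"
    by (simp add: linear_sum linear_scale)
  then show ?thesis
    by (simp only: euclidean_representation)
qed

lemma frechet_derivative_continuous:
  fixes f :: "'a::euclidean_space \<Rightarrow> real"
  assumes "Ck_on 1 S f"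
  shows "continuous_on (S \<times> UNIV) (\<lambda>p. frechet_derivative f (at (fst p)) (snd p))"
proof -
  have c: "continuous_on S (\<lambda>z. frechet_derivative f (at z) i)" for i
    using assms by simp
  have "continuous_on (S \<times> UNIV) (\<lambda>p. \<Sum>i\<in>Basis. (snd p \<bullet> i) * frechet_derivative f (at (fst p)) i)"
    by (intro continuous_intros continuous_on_compose2[OF c]) auto
  moreover have "frechet_derivative f (at (fst p)) (snd p) =
      (\<Sum>i\<in>Basis. (snd p \<bullet> i) * frechet_derivative f (at (fst p)) i)" if "p \<in> S \<times> UNIV" for p
    using assms that by (intro frechet_derivative_expand) auto
  ultimately show ?thesis
    by (simp cong: continuous_on_cong)
qed

lemma dirder2_continuous:
  assumes "Ck_on 2 S f"
  shows "continuous_on (S \<times> UNIV) (\<lambda>p. dirder2 f (fst p) (snd p))"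
proof -
  have c: "continuous_on S (\<lambda>z. frechet_derivative (\<lambda>y. frechet_derivative f (at y) i) (at z) j)" for i j
    using assms by (simp add: numeral_2_eq_2)
  show ?thesis
    unfolding dirder2_def
    by (intro continuous_intros continuous_on_compose2[OF c]) auto
qed

lemma dirder2_scale: "dirder2 f z (r *\<^sub>R v) = r\<^sup>2 * dirder2 f z v"
  by (simp add: dirder2_def sum_distrib_left power2_eq_square mult_ac)

lemma has_derivative_along_line:
  fixes f :: "'a::euclidean_space \<Rightarrow> real"
  assumes "(f has_derivative f') (at (z + s *\<^sub>R v))"
  shows "((\<lambda>s. f (z + s *\<^sub>R v)) has_real_derivative f' v) (at s)"
proof -
  have "((\<lambda>s. f (z + s *\<^sub>R v)) has_derivative (\<lambda>h. f' (h *\<^sub>R v))) (at s)"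
    by (rule has_derivative_compose[where g = f and f = "\<lambda>s. z + s *\<^sub>R v"])
      (use assms in \<open>auto intro!: derivative_eq_intros\<close>)
  moreover have "f' (h *\<^sub>R v) = f' v * h" for h
    using assms has_derivative_linear linear_scale by (metis mult.commute real_scaleR_def)
  ultimately show ?thesis
    by (simp add: has_field_derivative_def)
qed

text \<open>The first derivative is expanded in the basis beforehand, so that each coefficient is an
  ordinary function of the base point, to which \<open>has_derivative_along_line\<close>
  applies.\<close>

lemma frechet_derivative_along_line:
  assumes "Ck_on 2 S f" "open S" "z + s *\<^sub>R v \<in> S"
  shows "((\<lambda>s. frechet_derivative f (at (z + s *\<^sub>R v)) v) has_real_derivative
      dirder2 f (z + s *\<^sub>R v) v) (at s)"
proof -
  define D where "D i = (\<lambda>y. frechet_derivative f (at y) i)" for i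
  have dd: "(D i has_derivative frechet_derivative (D i) (at y)) (at y)" if "y \<in> S" for i y
    using assms(1) that by (simp add: D_def numeral_2_eq_2 frechet_derivative_works[symmetric])
  have "((\<lambda>s. \<Sum>i\<in>Basis. (v \<bullet> i) * D i (z + s *\<^sub>R v)) has_real_derivative
      (\<Sum>i\<in>Basis. (v \<bullet> i) * frechet_derivative (D i) (at (z + s *\<^sub>R v)) v)) (at s)"
    by (intro DERIV_sum DERIV_cmult has_derivative_along_line dd assms)
  moreover have "(\<Sum>i\<in>Basis. (v \<bullet> i) * frechet_derivative (D i) (at (z + s *\<^sub>R v)) v) =
      dirder2 f (z + s *\<^sub>R v) v"
    unfolding dirder2_def D_def[symmetric]
    by (subst frechet_derivative_expand)
      (use dd[OF assms(3)] in \<open>auto simp: differentiable_def D_def sum_distrib_left mult_ac\<close>)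
  ultimately have 1: "((\<lambda>s. \<Sum>i\<in>Basis. (v \<bullet> i) * D i (z + s *\<^sub>R v)) has_real_derivative
      dirder2 f (z + s *\<^sub>R v) v) (at s)" by simp
  have "open ((\<lambda>s. z + s *\<^sub>R v) -` S)"
    by (intro open_vimage assms continuous_intros)
  moreover have "(\<Sum>i\<in>Basis. (v \<bullet> i) * D i (z + t *\<^sub>R v)) = frechet_derivative f (at (z + t *\<^sub>R v)) v"
    if "t \<in> (\<lambda>s. z + s *\<^sub>R v) -` S" for t
    unfolding D_def
    by (rule frechet_derivative_expand[symmetric]) (use assms(1) that in \<open>auto simp: numeral_2_eq_2\<close>)
  ultimately show ?thesis
    using assms(3) by (intro has_field_derivative_transform_within_open[OF 1]) auto
qed

text \<open>The minimum of \<open>f (x, k)\<close> over the compact \<open>K\<close> is positive,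
  and half of it is a margin that survives for \<open>y\<close> near \<open>x\<close>. The
  neighbourhood is relative to \<open>U\<close>, so \<open>x\<close> may be a boundary point; in
  \<open>lagrangian_lower_bound\<close> it contains the initial time of an interval.\<close>

lemma tube_nhds:
  fixes f :: "'a::metric_space \<times> 'b::metric_space \<Rightarrow> real"
  assumes "compact K" "continuous_on (U \<times> K) f" "x \<in> U" "\<And>k. k \<in> K \<Longrightarrow> f (x, k) > 0"
  shows "\<exists>e>0. \<forall>y\<in>U. dist y x < e \<longrightarrow> (\<forall>k\<in>K. f (y, k) > 0)"
proof (cases "K = {}")
  case False
  have "continuous_on K (\<lambda>k. f (x, k))"
    by (intro continuous_on_compose2[OF assms(2)] continuous_intros) (use assms(3) in auto)
  then obtain l where l: "l \<in> K" "\<And>k. k \<in> K \<Longrightarrow> f (x, l) \<le> f (x, k)"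
    using continuous_attains_inf[OF assms(1) False] by blast
  have pos: "0 < f (x, l) / 2" using assms(4)[OF l(1)] by simp
  obtain X where X: "x \<in> X" "open X" "\<forall>y\<in>X \<inter> U. \<forall>k\<in>K. dist (f (y, k)) (f (x, k)) \<le> f (x, l) / 2"
    using continuous_on_prod_compactE[OF assms(2,1,3) pos] by blast
  obtain e where e: "e > 0" "\<And>y. dist y x < e \<Longrightarrow> y \<in> X"
    using X(1,2) unfolding open_dist by blast
  have "f (y, k) > 0" if "y \<in> U" "dist y x < e" "k \<in> K" for y k
  proof -
    have "dist (f (y, k)) (f (x, k)) \<le> f (x, l) / 2"
      using X(3) e(2) that by blast
    then show ?thesis using l(2)[OF that(3)] pos by (simp add: dist_real_def abs_if split: if_splits)
  qed
  then show ?thesis using e(1) by blast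
qed (auto intro: exI[of _ 1])

section \<open>A local minimization theorem\<close>

text \<open>Two applications of the mean value theorem. The strict form serves convexity in the
  velocity, the weak form the Taylor estimate with a penalty term.\<close>

lemma above_tangent:
  fixes g g' g'' :: "real \<Rightarrow> real"
  assumes g: "\<And>s. s \<in> {0..1} \<Longrightarrow> (g has_real_derivative g' s) (at s)"
    and g': "\<And>s. s \<in> {0..1} \<Longrightarrow> (g' has_real_derivative g'' s) (at s)"
  shows "(\<And>s. s \<in> {0..1} \<Longrightarrow> g'' s \<ge> 0) \<Longrightarrow> g 1 \<ge> g 0 + g' 0"
    and "(\<And>s. s \<in> {0..1} \<Longrightarrow> g'' s > 0) \<Longrightarrow> g 1 > g 0 + g' 0"
proof -
  obtain s where s: "0 < s" "s < 1" "g 1 - g 0 = g' s"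
    using MVT2[of 0 1 g g'] g by auto
  obtain r where r: "0 < r" "r < s" "g' s - g' 0 = s * g'' r"
    using MVT2[of 0 s g' g''] g' s by auto
  show "g 1 \<ge> g 0 + g' 0" if "\<And>s. s \<in> {0..1} \<Longrightarrow> g'' s \<ge> 0"
  proof -
    have "0 \<le> s * g'' r" using that[of r] s r by simp
    then show ?thesis using s r by linarith
  qed
  show "g 1 > g 0 + g' 0" if "\<And>s. s \<in> {0..1} \<Longrightarrow> g'' s > 0"
  proof -
    have "0 < s * g'' r" using that[of r] s r by simp
    then show ?thesis using s r by linarith
  qed
qed

lemma dist_Pair_le: "dist (a, b) (c, d) \<le> dist a c + dist b d"
  by (simp add: dist_Pair_Pair sqrt_sum_squares_le_sum)

text \<open>The coordinate expression of a Finsler metric: \<open>G (x, u)\<close> for \<open>x\<close> in the chart domain \<open>C\<close>.\<close>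

locale local_finsler =
  fixes C :: "'a::euclidean_space set" and G :: "'a \<times> 'a \<Rightarrow> real"
  assumes open_C: "open C"
    and G_cont: "continuous_on (C \<times> UNIV) G"
    and G_Ck: "Ck_on 2 (C \<times> (UNIV - {0})) G"
    and G_hom: "x \<in> C \<Longrightarrow> u \<noteq> 0 \<Longrightarrow> r > 0 \<Longrightarrow> G (x, r *\<^sub>R u) = r * G (x, u)"
    and G_hess: "x \<in> C \<Longrightarrow> u \<noteq> 0 \<Longrightarrow> w \<noteq> 0 \<Longrightarrow>
      deriv (\<lambda>s1. deriv (\<lambda>s2. (G (x, u + s1 *\<^sub>R w + s2 *\<^sub>R w))\<^sup>2) 0) 0 > 0"
begin

section \<open>Homogeneity and convexity of the energy density\<close>

definition L :: "'a \<times> 'a \<Rightarrow> real" where "L z = (G z)\<^sup>2 / 2"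

definition slit :: "('a \<times> 'a) set" where "slit = C \<times> (UNIV - {0})"

abbreviation DL :: "'a \<times> 'a \<Rightarrow> 'a \<times> 'a \<Rightarrow> real" where
  "DL z \<equiv> frechet_derivative L (at z)"

lemma mem_slit: "(x, u) \<in> slit \<longleftrightarrow> x \<in> C \<and> u \<noteq> 0"
  by (simp add: slit_def)

lemma open_slit: "open slit"
  unfolding slit_def by (intro open_Times open_C open_Diff) auto

lemma L_Ck: "Ck_on 2 slit L"
proof -
  have "Ck_on 2 slit (\<lambda>z. (G z * G z) * (1 / 2))"
    using G_Ck
    by (intro Ck_on_bilinear[OF open_slit bounded_bilinear_mult] Ck_on_const open_slit)
      (simp_all add: slit_def)
  then show ?thesis
    by (rule Ck_on_cong[OF open_slit]) (simp add: L_def power2_eq_square)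
qed

lemma L_Ck1: "Ck_on 1 slit L"
  using L_Ck Ck_on_SucD by (metis Suc_1)

lemma L_has_derivative: "z \<in> slit \<Longrightarrow> (L has_derivative DL z) (at z)"
  using Ck_on_has_derivative[of 0 slit L z] L_Ck1 by simp

lemma L_line: "z + s *\<^sub>R v \<in> slit \<Longrightarrow>
    ((\<lambda>s. L (z + s *\<^sub>R v)) has_real_derivative DL (z + s *\<^sub>R v) v) (at s)"
  by (intro has_derivative_along_line L_has_derivative)

lemma DL_line: "z + s *\<^sub>R v \<in> slit \<Longrightarrow>
    ((\<lambda>s. DL (z + s *\<^sub>R v) v) has_real_derivative dirder2 L (z + s *\<^sub>R v) v) (at s)"
  by (intro frechet_derivative_along_line[OF L_Ck] open_slit)

lemma L_cont: "continuous_on (C \<times> UNIV) L"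
  unfolding L_def by (intro continuous_intros G_cont) auto

text \<open>Homogeneity is assumed for nonzero vectors only. The value at zero is obtained by
  continuity, as the limit of \<open>G\<close> on shrinking multiples of a basis vector.\<close>

lemma G_zero: assumes "x \<in> C" shows "G (x, 0) = 0"
proof -
  obtain e :: 'a where e: "e \<in> Basis" using nonempty_Basis by blast
  have "isCont G (x, 0)"
    using G_cont open_C assms by (simp add: continuous_on_eq_continuous_at open_Times)
  moreover have "(\<lambda>n. (x, inverse (real (Suc n)) *\<^sub>R e)) \<longlonglongrightarrow> (x, 0 *\<^sub>R e)"
    by (intro tendsto_intros LIMSEQ_inverse_real_of_nat)
  ultimately have "(\<lambda>n. G (x, inverse (real (Suc n)) *\<^sub>R e)) \<longlonglongrightarrow> G (x, 0)"
    using isCont_tendsto_compose by fastforce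
  moreover have "G (x, inverse (real (Suc n)) *\<^sub>R e) = inverse (real (Suc n)) * G (x, e)" for n
    using e assms by (intro G_hom) auto
  moreover have "(\<lambda>n. inverse (real (Suc n)) * G (x, e)) \<longlonglongrightarrow> 0 * G (x, e)"
    by (intro tendsto_intros LIMSEQ_inverse_real_of_nat)
  ultimately show ?thesis
    using LIMSEQ_unique by fastforce
qed

lemma L_hom: assumes "x \<in> C" "r > 0" shows "L (x, r *\<^sub>R u) = r\<^sup>2 * L (x, u)"
  using assms by (cases "u = 0") (auto simp: L_def G_hom power_mult_distrib G_zero)

lemma L_nonneg: "L z \<ge> 0"
  by (simp add: L_def)

text \<open>The bridge from the iterated \<open>deriv\<close> of the fundamental tensor to
  \<open>dirder2\<close>. The inner derivative is \<open>2 * DL\<close> for those \<open>s1\<close>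
  that keep the vector off zero; these form a neighbourhood of 0, which is enough for the outer
  derivative.\<close>

lemma hess_pos:
  assumes "x \<in> C" "u \<noteq> 0" "w \<noteq> 0"
  shows "dirder2 L (x, u) (0, w) > 0"
proof -
  define T where "T = (\<lambda>s. (x, u) + s *\<^sub>R (0, w)) -` slit"
  have T: "open T" unfolding T_def
    by (intro open_vimage open_slit continuous_intros)
  have T0: "0 \<in> T" using assms by (simp add: T_def mem_slit)
  have inner: "deriv (\<lambda>s2. (G (x, u + s1 *\<^sub>R w + s2 *\<^sub>R w))\<^sup>2) 0 = 2 * DL ((x, u) + s1 *\<^sub>R (0, w)) (0, w)"
    if "s1 \<in> T" for s1
  proof (rule DERIV_imp_deriv)
    have "((\<lambda>s. 2 * L (((x, u) + s1 *\<^sub>R (0, w)) + s *\<^sub>R (0, w))) has_real_derivative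
        2 * DL (((x, u) + s1 *\<^sub>R (0, w)) + 0 *\<^sub>R (0, w)) (0, w)) (at 0)"
      using that by (intro DERIV_cmult L_line) (simp add: T_def)
    then show "((\<lambda>s2. (G (x, u + s1 *\<^sub>R w + s2 *\<^sub>R w))\<^sup>2) has_real_derivative
        2 * DL ((x, u) + s1 *\<^sub>R (0, w)) (0, w)) (at 0)"
      by (simp add: L_def)
  qed
  have "((\<lambda>s. 2 * DL ((x, u) + s *\<^sub>R (0, w)) (0, w)) has_real_derivative
      2 * dirder2 L ((x, u) + 0 *\<^sub>R (0, w)) (0, w)) (at 0)"
    using T0 by (intro DERIV_cmult DL_line) (simp add: T_def)
  then have "((\<lambda>s1. deriv (\<lambda>s2. (G (x, u + s1 *\<^sub>R w + s2 *\<^sub>R w))\<^sup>2) 0) has_real_derivative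
      2 * dirder2 L ((x, u) + 0 *\<^sub>R (0, w)) (0, w)) (at 0)"
    by (rule has_field_derivative_transform_within_open[OF _ T T0]) (simp add: inner)
  from DERIV_imp_deriv[OF this] G_hess[OF assms] show ?thesis
    by simp
qed

text \<open>On the ray through \<open>u\<close> the function \<open>L\<close> is
  \<open>(1 + s)\<^sup>2 * L (x, u)\<close> by homogeneity; differentiating once and twice at 0
  gives Euler's relations. The restriction \<open>s > -1\<close> keeps the ray off zero.\<close>

lemma euler:
  assumes "x \<in> C" "u \<noteq> 0"
  shows "DL (x, u) (0, u) = 2 * L (x, u)" and "dirder2 L (x, u) (0, u) = 2 * L (x, u)"
proof -
  have d1: "DL ((x, u) + s *\<^sub>R (0, u)) (0, u) = 2 * (1 + s) * L (x, u)" if "s \<in> {-1<..}" for s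
  proof (rule DERIV_unique)
    have "u + s *\<^sub>R u = (1 + s) *\<^sub>R u" by (simp add: scaleR_add_left)
    then show "((\<lambda>s. L ((x, u) + s *\<^sub>R (0, u))) has_real_derivative
        DL ((x, u) + s *\<^sub>R (0, u)) (0, u)) (at s)"
      using that assms by (intro L_line) (auto simp: mem_slit)
    have "((\<lambda>s. (1 + s)\<^sup>2 * L (x, u)) has_real_derivative 2 * (1 + s) * L (x, u)) (at s)"
      by (auto intro!: derivative_eq_intros)
    then show "((\<lambda>s. L ((x, u) + s *\<^sub>R (0, u))) has_real_derivative 2 * (1 + s) * L (x, u)) (at s)"
    proof (rule has_field_derivative_transform_within_open[of _ _ _ "{-1<..}"])
      fix t :: real assume "t \<in> {-1<..}"
      moreover have "u + t *\<^sub>R u = (1 + t) *\<^sub>R u" by (simp add: scaleR_add_left)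
      ultimately show "(1 + t)\<^sup>2 * L (x, u) = L ((x, u) + t *\<^sub>R (0, u))"
        using L_hom[OF assms(1), of "1 + t" u] by simp
    qed (use that in auto)
  qed
  from d1[of 0] show "DL (x, u) (0, u) = 2 * L (x, u)" by simp
  have "((\<lambda>s. DL ((x, u) + s *\<^sub>R (0, u)) (0, u)) has_real_derivative
      dirder2 L ((x, u) + 0 *\<^sub>R (0, u)) (0, u)) (at 0)"
    using assms by (intro DL_line) (auto simp: mem_slit)
  moreover have "((\<lambda>s. 2 * (1 + s) * L (x, u)) has_real_derivative 2 * L (x, u)) (at 0)"
    by (auto intro!: derivative_eq_intros)
  then have "((\<lambda>s. DL ((x, u) + s *\<^sub>R (0, u)) (0, u)) has_real_derivative 2 * L (x, u)) (at 0)"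
    by (rule has_field_derivative_transform_within_open[of _ _ _ "{-1<..}"]) (simp_all only: d1, simp_all)
  ultimately show "dirder2 L (x, u) (0, u) = 2 * L (x, u)"
    using DERIV_unique by fastforce
qed

text \<open>By Euler's second relation \<open>2 * L (x, u)\<close> is the Hessian at
  \<open>u\<close> in the direction \<open>u\<close> itself. This excludes zeros of \<open>G\<close>
  but leaves its sign open, which is the source of the case distinction on signs below.\<close>

lemma L_pos: "x \<in> C \<Longrightarrow> u \<noteq> 0 \<Longrightarrow> L (x, u) > 0"
  using hess_pos[of x u u] euler(2)[of x u] by simp

lemma G_nonzero: "x \<in> C \<Longrightarrow> u \<noteq> 0 \<Longrightarrow> G (x, u) \<noteq> 0"
  using L_pos[of x u] by (auto simp: L_def)

text \<open>The segment from \<open>v\<close> to \<open>w\<close> may pass through zero, where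
  \<open>L\<close> need not be twice differentiable. Then \<open>w\<close> is a nonpositive multiple
  of \<open>v\<close>, and Euler's relation puts the tangent at \<open>w\<close> at
  \<open>1 / 2 - 1 / s\<close>, which is negative, while \<open>L\<close> is nonnegative. Otherwise
  the Hessian is positive along the whole segment.\<close>

lemma strictly_convex:
  assumes "x \<in> C" "v \<noteq> 0" "w \<noteq> v" "G (x, v) = 1"
  shows "L (x, w) > 1 / 2 + DL (x, v) (0, w - v)"
proof (cases "\<exists>s\<in>{0..1}. v + s *\<^sub>R (w - v) = 0")
  case True
  then obtain s where s: "s \<in> {0..1}" "v + s *\<^sub>R (w - v) = 0" by blast
  have s0: "s \<noteq> 0" using s assms by auto
  then have w: "w - v = (- (1 / s)) *\<^sub>R v"
    using s(2) by (metis add_eq_0_iff scaleR_minus_left scaleR_minus_right divide_inverse_commute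
        mult.right_neutral scaleR_left_imp_eq scaleR_one scaleR_scaleR right_inverse minus_minus
        inverse_eq_divide)
  have "linear (DL (x, v))"
    using L_has_derivative[of "(x, v)"] assms has_derivative_linear by (auto simp: mem_slit)
  then have "DL (x, v) ((- (1 / s)) *\<^sub>R (0, v)) = - (1 / s) * DL (x, v) (0, v)"
    by (simp only: linear_scale real_scaleR_def)
  also have "\<dots> = - (1 / s)"
    using euler(1)[OF assms(1,2)] assms(4) by (simp add: L_def)
  finally have "DL (x, v) (0, w - v) = - (1 / s)"
    by (simp add: w)
  moreover have "1 / s \<ge> 1" using s s0 by auto
  ultimately show ?thesis using L_nonneg[of "(x, w)"] by linarith
next
  case False
  have *: "(x, v) + s *\<^sub>R (0, w - v) \<in> slit" if "s \<in> {0..1}" for s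
    using that False assms by (auto simp: mem_slit)
  have "L ((x, v) + 1 *\<^sub>R (0, w - v)) > L ((x, v) + 0 *\<^sub>R (0, w - v)) + DL ((x, v) + 0 *\<^sub>R (0, w - v)) (0, w - v)"
  proof (rule above_tangent(2))
    show "dirder2 L ((x, v) + s *\<^sub>R (0, w - v)) (0, w - v) > 0" if "s \<in> {0..1}" for s
      using *[OF that] hess_pos[of x "v + s *\<^sub>R (w - v)" "w - v"] assms by (simp add: mem_slit)
  qed (rule L_line[OF *] DL_line[OF *], assumption)+
  then show ?thesis using assms by (simp add: L_def)
qed

section \<open>Position and velocity gradients, and the calibration estimate\<close>

definition Lx :: "'a \<times> 'a \<Rightarrow> 'a" where "Lx z = (\<Sum>i\<in>Basis. DL z (i, 0) *\<^sub>R i)"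

definition Lv :: "'a \<times> 'a \<Rightarrow> 'a" where "Lv z = (\<Sum>i\<in>Basis. DL z (0, i) *\<^sub>R i)"

lemma DL_eq: assumes "z \<in> slit" shows "DL z (h, u) = Lx z \<bullet> h + Lv z \<bullet> u"
proof -
  have lin: "linear (DL z)"
    using L_has_derivative[OF assms] has_derivative_linear by blast
  have 1: "linear (\<lambda>h. DL z (h, 0))"
    using linear_compose[OF _ lin, of "\<lambda>h. (h, 0)"] by (auto simp: o_def linear_iff)
  have 2: "linear (\<lambda>u. DL z (0, u))"
    using linear_compose[OF _ lin, of "\<lambda>u. (0, u)"] by (auto simp: o_def linear_iff)
  have "DL z (h, u) = DL z (h, 0) + DL z (0, u)"
    using linear_add[OF lin, of "(h, 0)" "(0, u)"] by simp
  also have "DL z (h, 0) = DL z (\<Sum>i\<in>Basis. (h \<bullet> i) *\<^sub>R i, 0)"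
    by (simp add: euclidean_representation)
  also have "\<dots> = Lx z \<bullet> h"
    using linear_sum[OF 1, of "\<lambda>i. (h \<bullet> i) *\<^sub>R i" Basis] linear_scale[OF 1]
    by (simp add: Lx_def inner_sum_left inner_sum_right inner_commute mult.commute)
  also have "DL z (0, u) = DL z (0, \<Sum>i\<in>Basis. (u \<bullet> i) *\<^sub>R i)"
    by (simp add: euclidean_representation)
  also have "\<dots> = Lv z \<bullet> u"
    using linear_sum[OF 2, of "\<lambda>i. (u \<bullet> i) *\<^sub>R i" Basis] linear_scale[OF 2]
    by (simp add: Lv_def inner_sum_left inner_sum_right inner_commute mult.commute)
  finally show ?thesis .
qed

lemma Lx_cont: "continuous_on slit Lx" and Lv_cont: "continuous_on slit Lv"
  using L_Ck1 unfolding Lx_def Lv_def by (auto intro!: continuous_intros)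

lemma Lv_self: "x \<in> C \<Longrightarrow> G (x, v) = 1 \<Longrightarrow> Lv (x, v) \<bullet> v = 1"
  using euler(1)[of x v] DL_eq[of "(x, v)" 0 v] G_zero[of x]
  by (cases "v = 0") (auto simp: mem_slit L_def)

text \<open>The Hessian of \<open>L\<close> is positive definite in the velocity, so it becomes positive definite after
  a large multiple of the square of the position variation is added.\<close>

lemma penalized_hessian:
  assumes "x0 \<in> C" "v0 \<noteq> 0"
  obtains k e c where "k > 0" "e > 0" "c > 0" "ball (x0, v0) e \<subseteq> slit"
    "\<And>z \<kappa> h u. z \<in> ball (x0, v0) e \<Longrightarrow> \<bar>\<kappa>\<bar> < c \<Longrightarrow>
       dirder2 L z (h, u) + k * (norm h)\<^sup>2 + 2 * \<kappa> * (h \<bullet> u) \<ge> 0"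
proof -
  define z0 where "z0 = (x0, v0)"
  define Sph where "Sph = sphere (0 :: 'a \<times> 'a) 1"
  have z0: "z0 \<in> slit" using assms by (simp add: z0_def mem_slit)
  have Sph: "compact Sph" "Sph \<noteq> {}" by (auto simp: Sph_def)
  have contd: "continuous_on (slit \<times> UNIV) (\<lambda>p. dirder2 L (fst p) (snd p))"
    by (rule dirder2_continuous[OF L_Ck])
  have Q0: "continuous_on Sph (dirder2 L z0)"
    using continuous_on_compose2[OF contd, of Sph "\<lambda>v. (z0, v)"] z0
    by (auto simp: continuous_on_Pair)
  obtain B where B: "B \<ge> 0" "\<And>v. v \<in> Sph \<Longrightarrow> dirder2 L z0 v \<ge> - B"
  proof -
    obtain v where "v \<in> Sph" "\<And>w. w \<in> Sph \<Longrightarrow> dirder2 L z0 v \<le> dirder2 L z0 w"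
      using continuous_attains_inf[OF Sph Q0] by blast
    then show ?thesis by (intro that[of "\<bar>dirder2 L z0 v\<bar>"]) force+
  qed
  \<comment> \<open>The unit directions in which the Hessian is not positive. By
    \<open>hess_pos\<close> none of them is a pure change of velocity, so by compactness the squared
    norm of the position part has a positive lower bound \<open>m\<close> there.\<close>
  define K0 where "K0 = {v \<in> Sph. dirder2 L z0 v \<le> 0}"
  have "compact K0"
  proof -
    have "closed (Sph \<inter> dirder2 L z0 -` {..0})"
      by (intro continuous_closed_preimage Q0 compact_imp_closed Sph closed_atMost)
    from compact_Int_closed[OF Sph(1) this] show ?thesis
      by (rule back_subst[of compact]) (auto simp: K0_def)
  qed
  have K0fst: "fst v \<noteq> 0" if "v \<in> K0" for v
  proof
    assume 0: "fst v = 0"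
    then have "snd v \<noteq> 0" using that by (cases v) (auto simp: K0_def Sph_def)
    then have "dirder2 L z0 (0, snd v) > 0"
      using assms unfolding z0_def by (intro hess_pos)
    then show False using that 0 by (cases v) (auto simp: K0_def)
  qed
  obtain m where m: "m > 0" "\<And>v. v \<in> K0 \<Longrightarrow> (norm (fst v))\<^sup>2 \<ge> m"
  proof (cases "K0 = {}")
    case True
    then show ?thesis by (intro that[of 1]) auto
  next
    case False
    have "continuous_on K0 (\<lambda>v. (norm (fst v))\<^sup>2)" by (intro continuous_intros)
    then obtain v where "v \<in> K0" "\<And>w. w \<in> K0 \<Longrightarrow> (norm (fst v))\<^sup>2 \<le> (norm (fst w))\<^sup>2"
      using continuous_attains_inf[OF \<open>compact K0\<close> False, of "\<lambda>v. (norm (fst v))\<^sup>2"] by blast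
    then show ?thesis using K0fst by (intro that[of "(norm (fst v))\<^sup>2"]) auto
  qed
  \<comment> \<open>On \<open>K0\<close> the penalty is then at least \<open>B + 1\<close>, more
    than the possible deficit \<open>B\<close> of the Hessian; off \<open>K0\<close> the Hessian is
    positive by itself.\<close>
  define k where "k = (B + 1) / m"
  have k: "k > 0" using B m by (simp add: k_def)
  have pos: "dirder2 L z0 v + k * (norm (fst v))\<^sup>2 > 0" if "v \<in> Sph" for v
  proof (cases "v \<in> K0")
    case True
    have "k * (norm (fst v))\<^sup>2 \<ge> k * m" using m(2)[OF True] k by (intro mult_left_mono) auto
    also have "k * m = B + 1" using m by (simp add: k_def)
    finally show ?thesis using B(2)[OF that] by linarith
  next
    case False
    moreover have "k * (norm (fst v))\<^sup>2 \<ge> 0" using k by simp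
    ultimately show ?thesis using that by (simp add: K0_def)
  qed
  \<comment> \<open>The coefficient \<kappa> of the mixed term is made part of the base point, with
    value 0 at the centre, so that one compactness argument bounds both \<open>z\<close> and
    \<kappa>.\<close>
  define f where "f = (\<lambda>p. dirder2 L (fst (fst p)) (snd p) + k * (norm (fst (snd p)))\<^sup>2 +
     2 * snd (fst p) * (fst (snd p) \<bullet> snd (snd p)) :: real)"
  have "continuous_on ((slit \<times> (UNIV :: real set)) \<times> Sph) f"
    unfolding f_def
    by (intro continuous_intros continuous_on_compose2[OF contd, of _ "\<lambda>p. (fst (fst p), snd p)", simplified])
      auto
  moreover have "f ((z0, 0), v) > 0" if "v \<in> Sph" for v
    using pos[OF that] by (simp add: f_def)
  ultimately obtain e where e: "e > 0"
      "\<And>y v. y \<in> slit \<times> UNIV \<Longrightarrow> dist y (z0, 0) < e \<Longrightarrow> v \<in> Sph \<Longrightarrow> f (y, v) > 0"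
    using tube_nhds[OF Sph(1), of "slit \<times> UNIV" f "(z0, 0)"] z0 by auto
  obtain e' where e': "e' > 0" "ball z0 e' \<subseteq> slit"
    using open_slit z0 open_contains_ball by blast
  show ?thesis
  proof (rule that[of k "min (e / 2) e'" "e / 2"])
    show "ball (x0, v0) (min (e / 2) e') \<subseteq> slit" using e' by (auto simp: z0_def)
    fix z \<kappa> h u assume z: "z \<in> ball (x0, v0) (min (e / 2) e')" and \<kappa>: "\<bar>\<kappa>\<bar> < e / 2"
    have zs: "z \<in> slit" using z e' by (auto simp: z0_def)
    have "dist (z, \<kappa>) (z0, 0) < e"
      using dist_Pair_le[of z \<kappa> z0 0] z \<kappa> by (auto simp: z0_def dist_commute)
    then have f: "f ((z, \<kappa>), v) > 0" if "v \<in> Sph" for v using e(2) zs that by auto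
    show "dirder2 L z (h, u) + k * (norm h)\<^sup>2 + 2 * \<kappa> * (h \<bullet> u) \<ge> 0"
    proof (cases "(h, u) = 0")
      case True
      then show ?thesis using dirder2_scale[of L z 0 "(h, u)"] by (auto simp: zero_prod_def)
    next
      case False
      define n where "n = norm (h, u)"
      have n: "n > 0" using False by (simp only: n_def zero_less_norm_iff not_False_eq_True)
      have "(1 / n) *\<^sub>R (h, u) \<in> Sph" using n by (simp add: Sph_def n_def del: scaleR_Pair)
      from f[OF this] have "0 < (1 / n)\<^sup>2 * dirder2 L z (h, u) + k * (norm ((1 / n) *\<^sub>R h))\<^sup>2 +
          2 * \<kappa> * (((1 / n) *\<^sub>R h) \<bullet> ((1 / n) *\<^sub>R u))"
        unfolding f_def by (simp only: dirder2_scale fst_conv snd_conv scaleR_Pair[symmetric]) (simp only: scaleR_Pair fst_conv snd_conv)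
      also have "\<dots> = (1 / n)\<^sup>2 * (dirder2 L z (h, u) + k * (norm h)\<^sup>2 + 2 * \<kappa> * (h \<bullet> u))"
        using n by (simp add: field_simps power2_eq_square)
      finally show ?thesis using n by (simp add: zero_less_mult_iff)
    qed
  qed (use k e e' in auto)
qed

text \<open>The right-hand side is the derivative of the calibrating function of \<open>core_length\<close> along a curve
  with velocity \<open>w\<close>. For \<open>w\<close> close to \<open>v t\<close> the inequality is a second order Taylor estimate. For the
  other \<open>w\<close> it follows from strict convexity by compactness, after \<open>w\<close> is complemented by a
  homogeneous coordinate \<open>s\<close>.\<close>

lemma lagrangian_lower_bound:
  fixes x v :: "real \<Rightarrow> 'a"
  assumes ab: "a < b" and x: "continuous_on {a..b} x" and v: "continuous_on {a..b} v"
    and xC: "\<And>t. t \<in> {a..b} \<Longrightarrow> x t \<in> C" and G1: "\<And>t. t \<in> {a..b} \<Longrightarrow> G (x t, v t) = 1"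
  obtains k \<delta> r where "k > 0" "\<delta> > 0" "r > 0" "a + \<delta> \<le> b"
    "\<And>t h w. t \<in> {a..a + \<delta>} \<Longrightarrow> norm h \<le> r \<Longrightarrow> x t + h \<in> C \<and>
       L (x t + h, w) \<ge> 1 / 2 + Lx (x t, v t) \<bullet> h + Lv (x t, v t) \<bullet> (w - v t)
         - k / 2 * (norm h)\<^sup>2 - k * (t - a) * (h \<bullet> (w - v t))"
proof -
  define x0 v0 where "x0 = x a" and "v0 = v a"
  define z where "z t = (x t, v t)" for t
  have v_nz: "v t \<noteq> 0" if "t \<in> {a..b}" for t
    using G1[OF that] G_zero[OF xC[OF that]] by auto
  have z_slit: "z t \<in> slit" if "t \<in> {a..b}" for t
    using that by (simp add: z_def mem_slit v_nz xC)
  have zc: "continuous_on {a..b} z" unfolding z_def by (intro continuous_intros x v)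
  have L1: "L (z t) = 1 / 2" if "t \<in> {a..b}" for t
    using G1[OF that] by (simp add: L_def z_def)
  have x0: "x0 \<in> C" "v0 \<noteq> 0" "G (x0, v0) = 1"
    using xC[of a] v_nz[of a] G1[of a] ab by (auto simp: x0_def v0_def)
  obtain k \<rho> c where k: "k > 0" "\<rho> > 0" "c > 0" "ball (x0, v0) \<rho> \<subseteq> slit"
    "\<And>z \<kappa> h u. z \<in> ball (x0, v0) \<rho> \<Longrightarrow> \<bar>\<kappa>\<bar> < c \<Longrightarrow>
       dirder2 L z (h, u) + k * (norm h)\<^sup>2 + 2 * \<kappa> * (h \<bullet> u) \<ge> 0"
    using penalized_hessian[OF x0(1,2)] by blast
  \<comment> \<open>For \<open>s > 0\<close> the pair \<open>(w, s)\<close> stands for the velocity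
    \<open>(1 / s) *\<^sub>R w\<close>, here at distance at least \<open>\<rho> / 4\<close> from
    \<open>v0\<close>; \<open>s = 0\<close> stands for velocities at infinity. The value
    \<open>\<rho> / 4\<close> leaves room for \<open>v t\<close> to differ from \<open>v0\<close> by
    \<open>\<rho> / 8\<close> when \<open>w\<close> is at distance at least
    \<open>\<rho> / 2\<close> from \<open>v t\<close>.\<close>
  define K where "K = sphere 0 1 \<inter> {p :: 'a \<times> real. 0 \<le> snd p \<and> \<rho> / 4 * snd p \<le> norm (fst p - snd p *\<^sub>R v0)}"
  have "closed {p :: 'a \<times> real. 0 \<le> snd p \<and> \<rho> / 4 * snd p \<le> norm (fst p - snd p *\<^sub>R v0)}"
    by (intro closed_Collect_conj closed_Collect_le continuous_intros)
  then have K: "compact K" unfolding K_def by (intro compact_Int_closed) auto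
  define U where "U = {p. fst p \<in> {a..b} \<and> x (fst p) + snd p \<in> C}"
  \<comment> \<open>This is \<open>s\<^sup>2\<close> times the difference of the two sides of the
    claim at the velocity \<open>(1 / s) *\<^sub>R w\<close>, with
    \<open>Lv (z t) \<bullet> v t = 1\<close> inserted. In this form it makes sense at
    \<open>s = 0\<close>, where only \<open>L (x t + h, w)\<close> remains.\<close>
  define J :: "(real \<times> 'a) \<times> ('a \<times> real) \<Rightarrow> real" where
    "J p = (let t = fst (fst p); h = snd (fst p); w = fst (snd p); s = snd (snd p) in
       L (x t + h, w) + s\<^sup>2 / 2 - s * (Lv (z t) \<bullet> w) - s\<^sup>2 * (Lx (z t) \<bullet> h) + k / 2 * s\<^sup>2 * (norm h)\<^sup>2
         + k * (t - a) * s * (h \<bullet> (w - s *\<^sub>R v t)))" for p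
  have J_cont: "continuous_on (U \<times> K) J"
  proof -
    have c0: "continuous_on (U \<times> K) (\<lambda>p. fst (fst p))" "(\<lambda>p. fst (fst p)) ` (U \<times> K) \<subseteq> {a..b}"
      by (auto intro!: continuous_intros simp: U_def)
    have c1: "continuous_on (U \<times> K) (\<lambda>p. x (fst (fst p)))" "continuous_on (U \<times> K) (\<lambda>p. v (fst (fst p)))"
      using continuous_on_compose2[OF x c0] continuous_on_compose2[OF v c0] by auto
    have zU: "(\<lambda>p. z (fst (fst p))) ` (U \<times> K) \<subseteq> slit" by (auto simp: U_def intro!: z_slit)
    have c2: "continuous_on (U \<times> K) (\<lambda>p. z (fst (fst p)))"
      unfolding z_def by (intro continuous_intros c1)
    have c3: "continuous_on (U \<times> K) (\<lambda>p. Lx (z (fst (fst p))))" "continuous_on (U \<times> K) (\<lambda>p. Lv (z (fst (fst p))))"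
      using continuous_on_compose2[OF Lx_cont c2 zU] continuous_on_compose2[OF Lv_cont c2 zU] by auto
    have c4: "continuous_on (U \<times> K) (\<lambda>p. L (x (fst (fst p)) + snd (fst p), fst (snd p)))"
      by (rule continuous_on_compose2[OF L_cont], intro continuous_intros c1) (auto simp: U_def)
    show ?thesis unfolding J_def Let_def by (intro continuous_intros c1 c3 c4) auto
  qed
  \<comment> \<open>At the initial time and \<open>h = 0\<close> the position terms drop out. What
    is left is strict convexity for \<open>s > 0\<close> and positivity of \<open>L\<close> for
    \<open>s = 0\<close>.\<close>
  have J_pos: "J ((a, 0), p) > 0" if "p \<in> K" for p
  proof -
    obtain w s where p: "p = (w, s)" by (cases p)
    have s: "s \<ge> 0" "\<rho> / 4 * s \<le> norm (w - s *\<^sub>R v0)" and n: "norm (w, s) = 1"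
      using that by (auto simp: K_def p)
    have J: "J ((a, 0), p) = L (x0, w) + s\<^sup>2 / 2 - s * (Lv (x0, v0) \<bullet> w)"
      by (simp add: J_def p z_def x0_def v0_def)
    show ?thesis
    proof (cases "s = 0")
      case True
      then have "w \<noteq> 0" using n by auto
      then show ?thesis using L_pos[OF x0(1)] True by (simp add: J)
    next
      case False
      then have sp: "s > 0" using s by simp
      have "(1 / s) *\<^sub>R w \<noteq> v0"
      proof
        assume "(1 / s) *\<^sub>R w = v0"
        then have "s *\<^sub>R v0 = w" using sp by auto
        then show False using s(2) sp k(2) by (simp add: mult_le_0_iff)
      qed
      then have "L (x0, (1 / s) *\<^sub>R w) > 1 / 2 + Lv (x0, v0) \<bullet> ((1 / s) *\<^sub>R w - v0)"
        using strictly_convex[OF x0(1,2) _ x0(3)] DL_eq[of "(x0, v0)"] x0 by (simp add: mem_slit)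
      then have "L (x0, (1 / s) *\<^sub>R w) > (Lv (x0, v0) \<bullet> w) / s - 1 / 2"
        using Lv_self[OF x0(1,3)] by (simp add: inner_diff_right)
      then have "s\<^sup>2 * L (x0, (1 / s) *\<^sub>R w) > s\<^sup>2 * ((Lv (x0, v0) \<bullet> w) / s - 1 / 2)"
        using sp by (intro mult_strict_left_mono) auto
      moreover have "s\<^sup>2 * L (x0, (1 / s) *\<^sub>R w) = L (x0, w)"
        using L_hom[OF x0(1) sp, of "(1 / s) *\<^sub>R w"] sp by simp
      ultimately show ?thesis using sp by (simp add: J power2_eq_square algebra_simps)
    qed
  qed
  have aU: "(a, 0) \<in> U" using xC[of a] ab by (simp add: U_def)
  obtain e where e: "e > 0" "\<And>y p. y \<in> U \<Longrightarrow> dist y (a, 0) < e \<Longrightarrow> p \<in> K \<Longrightarrow> J (y, p) > 0"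
    using tube_nhds[OF K J_cont aU J_pos] by blast
  obtain d1 where d1: "d1 > 0" "\<And>t. t \<in> {a..b} \<Longrightarrow> dist t a < d1 \<Longrightarrow> dist (x t) x0 < \<rho> / 8"
    using x ab k(2) unfolding continuous_on_iff x0_def by (metis atLeastAtMost_iff less_eq_real_def
        divide_pos_pos zero_less_numeral)
  obtain d2 where d2: "d2 > 0" "\<And>t. t \<in> {a..b} \<Longrightarrow> dist t a < d2 \<Longrightarrow> dist (v t) v0 < \<rho> / 8"
    using v ab k(2) unfolding continuous_on_iff v0_def by (metis atLeastAtMost_iff less_eq_real_def
        divide_pos_pos zero_less_numeral)
  \<comment> \<open>The bounds by \<open>d1\<close> and \<open>d2\<close> keep \<open>x t\<close>
    and \<open>v t\<close> within \<open>\<rho> / 8\<close> of their initial values,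
    \<open>e / 3\<close> keeps \<open>(t, h)\<close> in the tube where \<open>J\<close> is positive,
    and \<open>c / (2 * k)\<close> keeps the coefficient \<open>k * (t - a)\<close> below
    \<open>c\<close>.\<close>
  define \<delta> where "\<delta> = Min {d1 / 2, d2 / 2, e / 3, c / (2 * k), b - a}"
  have \<delta>: "\<delta> > 0" "\<delta> < d1" "\<delta> < d2" "\<delta> \<le> e / 3" "\<delta> \<le> c / (2 * k)" "a + \<delta> \<le> b"
    using d1(1) d2(1) e(1) k ab by (auto simp: \<delta>_def min_def)
  define r where "r = min (e / 3) (\<rho> / 16)"
  have r: "r > 0" "r \<le> e / 3" "r < \<rho> / 8" using e(1) k(2) by (auto simp: r_def)
  show ?thesis
  proof (rule that[OF k(1) \<delta>(1) r(1) \<delta>(6)])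
    fix t :: real and h w :: 'a
    assume t: "t \<in> {a..a + \<delta>}" and h: "norm h \<le> r"
    have tab: "t \<in> {a..b}" using t \<delta>(6) by auto
    have xt: "dist (x t) x0 < \<rho> / 8" "dist (v t) v0 < \<rho> / 8"
      using d1(2)[OF tab] d2(2)[OF tab] t \<delta> by (auto simp: dist_real_def)
    define u where "u = w - v t"
    define \<kappa> where "\<kappa> = k * (t - a)"
    have "k * (t - a) \<le> k * (c / (2 * k))" using t \<delta>(5) k(1) by (intro mult_left_mono) auto
    then have \<kappa>: "\<bar>\<kappa>\<bar> < c" using t k by (simp add: \<kappa>_def abs_mult)
    have near: "z t + s *\<^sub>R (h, u') \<in> ball (x0, v0) \<rho>" if "s \<in> {0..1}" "norm u' < \<rho> / 2" for s u'
    proof -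
      have "norm (s *\<^sub>R h) \<le> norm h" "norm (s *\<^sub>R u') \<le> norm u'"
        using that(1) by (auto intro: mult_left_le_one_le)
      moreover have "dist (x t + s *\<^sub>R h) x0 \<le> dist (x t) x0 + norm (s *\<^sub>R h)"
        "dist (v t + s *\<^sub>R u') v0 \<le> dist (v t) v0 + norm (s *\<^sub>R u')"
        by (metis add.commute add_diff_cancel_left' dist_commute dist_norm dist_triangle)+
      ultimately have "dist (x t + s *\<^sub>R h, v t + s *\<^sub>R u') (x0, v0) < \<rho>"
        using dist_Pair_le[of "x t + s *\<^sub>R h" "v t + s *\<^sub>R u'" x0 v0] xt h r that by linarith
      then show ?thesis by (simp add: z_def dist_commute)
    qed
    have xC': "x t + h \<in> C"
    proof -
      have "z t + 1 *\<^sub>R (h, 0) \<in> slit" using near[of 1 0] k(2,4) by auto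
      then show ?thesis by (simp add: z_def mem_slit)
    qed
    have "L (x t + h, w) \<ge> 1 / 2 + Lx (z t) \<bullet> h + Lv (z t) \<bullet> u - k / 2 * (norm h)\<^sup>2 - \<kappa> * (h \<bullet> u)"
    proof (cases "norm u < \<rho> / 2")
      case True
      \<comment> \<open>Adding \<open>s\<^sup>2 * P\<close> along the segment makes the second
        derivative in \<open>s\<close> nonnegative by the choice of \<open>k\<close>; at
        \<open>s = 1\<close> this term is exactly the error that the claim allows.\<close>
      define P where "P = k / 2 * (norm h)\<^sup>2 + \<kappa> * (h \<bullet> u)"
      have *: "z t + s *\<^sub>R (h, u) \<in> slit" if "s \<in> {0..1}" for s
        using near[OF that True] k(4) by blast
      have "L (z t + 1 *\<^sub>R (h, u)) + 1\<^sup>2 * P \<ge> (L (z t + 0 *\<^sub>R (h, u)) + 0\<^sup>2 * P) + (DL (z t + 0 *\<^sub>R (h, u)) (h, u) + 2 * 0 * P)"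
      proof (rule above_tangent(1))
        fix s :: real assume s: "s \<in> {0..1}"
        show "((\<lambda>s. L (z t + s *\<^sub>R (h, u)) + s\<^sup>2 * P) has_real_derivative
            DL (z t + s *\<^sub>R (h, u)) (h, u) + 2 * s * P) (at s)"
          by (rule DERIV_add[OF L_line[OF *[OF s]]]) (auto intro!: derivative_eq_intros)
        show "((\<lambda>s. DL (z t + s *\<^sub>R (h, u)) (h, u) + 2 * s * P) has_real_derivative
            dirder2 L (z t + s *\<^sub>R (h, u)) (h, u) + 2 * P) (at s)"
          by (rule DERIV_add[OF DL_line[OF *[OF s]]]) (auto intro!: derivative_eq_intros)
        show "0 \<le> dirder2 L (z t + s *\<^sub>R (h, u)) (h, u) + 2 * P"
          using k(5)[OF near[OF s True] \<kappa>, of h u] by (simp add: P_def)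
      qed
      moreover have "z t + 1 *\<^sub>R (h, u) = (x t + h, w)" by (simp add: z_def u_def)
      ultimately show ?thesis
        using DL_eq[OF z_slit[OF tab], of h u] L1[OF tab] by (simp add: P_def zero_prod_def[symmetric])
    next
      case False
      \<comment> \<open>The velocity \<open>w\<close> has homogeneous coordinates
        \<open>(w, 1)\<close>. Division by \<open>n\<close> moves them to the unit sphere and
        multiplies \<open>J\<close> by the positive factor \<open>(1 / n)\<^sup>2\<close>.\<close>
      define n where "n = norm (w, 1 :: real)"
      have n: "n > 0" unfolding n_def by (simp add: zero_prod_def)
      have "norm u \<le> norm (w - v0) + dist (v t) v0"
        unfolding u_def by (metis add.commute dist_norm dist_triangle2 norm_minus_commute)
      then have "\<rho> / 4 \<le> norm (w - v0)" using False xt(2) k(2) by linarith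
      then have "(1 / n) * (\<rho> / 4) \<le> (1 / n) * norm (w - v0)" using n by (intro mult_left_mono) auto
      also have "\<dots> = norm ((1 / n) *\<^sub>R w - (1 / n) *\<^sub>R v0)"
        using n by (simp add: scaleR_diff_right[symmetric])
      finally have "\<rho> / 4 * (1 / n) \<le> norm ((1 / n) *\<^sub>R w - (1 / n) *\<^sub>R v0)" by (simp add: mult.commute)
      moreover have "norm ((1 / n) *\<^sub>R w, 1 / n) = 1"
      proof -
        have "norm ((1 / n) *\<^sub>R (w, 1 :: real)) = 1" using n by (simp only: norm_scaleR n_def[symmetric]) simp
        then show ?thesis by simp
      qed
      ultimately have "((1 / n) *\<^sub>R w, 1 / n) \<in> K" using n by (simp add: K_def)
      moreover have "(t, h) \<in> U" using tab xC' by (simp add: U_def)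
      moreover have "dist (t, h) (a, 0) < e"
        using dist_Pair_le[of t h a 0] t h \<delta> r e(1) by (simp add: dist_real_def)
      ultimately have "J ((t, h), ((1 / n) *\<^sub>R w, 1 / n)) > 0" using e(2) by blast
      also have "J ((t, h), ((1 / n) *\<^sub>R w, 1 / n)) = (1 / n)\<^sup>2 * J ((t, h), (w, 1))"
        using L_hom[OF xC', of "1 / n" w] n
        by (simp add: J_def Let_def field_simps power2_eq_square inner_diff_right)
      finally have "J ((t, h), (w, 1)) > 0" using n by (simp add: zero_less_mult_iff)
      moreover have "Lv (z t) \<bullet> v t = 1"
        using Lv_self[OF xC G1] tab by (simp add: z_def)
      ultimately show ?thesis
        by (simp add: J_def u_def \<kappa>_def inner_diff_right)
    qed
    then show "x t + h \<in> C \<and> L (x t + h, w) \<ge> 1 / 2 + Lx (x t, v t) \<bullet> h + Lv (x t, v t) \<bullet> (w - v t)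
         - k / 2 * (norm h)\<^sup>2 - k * (t - a) * (h \<bullet> (w - v t))"
      using xC' by (simp add: z_def u_def \<kappa>_def)
  qed
qed

text \<open>The calibration argument for a comparison curve \<open>y\<close> in coordinates. The
  condition on \<open>y p\<close> is what orthogonality to \<open>N\<close> provides in a slice
  chart. The speed is an abstract \<open>K\<close> that equals \<open>G (y t, y' t)\<close> off a
  finite set, since at break points the actual speed is unspecified and could be negative.\<close>

lemma core_length:
  fixes x v :: "real \<Rightarrow> 'a"
  assumes ab: "a < b" and x: "continuous_on {a..b} x" and v: "continuous_on {a..b} v"
    and xC: "\<And>t. t \<in> {a..b} \<Longrightarrow> x t \<in> C" and G1: "\<And>t. t \<in> {a..b} \<Longrightarrow> G (x t, v t) = 1"
    and xv: "\<And>t. t \<in> {a<..<b} \<Longrightarrow> (x has_vector_derivative v t) (at t)"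
    and EL: "\<And>t. t \<in> {a<..<b} \<Longrightarrow>
      ((\<lambda>t. Lv (x t, v t)) has_vector_derivative Lx (x t, v t)) (at t)"
  obtains \<delta> r where "\<delta> > 0" "r > 0" "a + \<delta> \<le> b"
    "\<And>d y y' K p q S. 0 < d \<Longrightarrow> d \<le> \<delta> \<Longrightarrow> p < q \<Longrightarrow> continuous_on {p..q} y \<Longrightarrow> finite S \<Longrightarrow>
      \<forall>t\<in>{p<..<q} - S. (y has_vector_derivative y' t) (at t) \<and> K t = G (y t, y' t) \<and> isCont K t \<Longrightarrow>
      K integrable_on {p..q} \<Longrightarrow> \<forall>t. K t \<ge> 0 \<Longrightarrow> \<forall>t\<in>{p..q}. norm (y t - x a) \<le> r \<Longrightarrow>
      Lv (x a, v a) \<bullet> (y p - x a) = 0 \<Longrightarrow> y q = x (a + d) \<Longrightarrow> d \<le> integral {p..q} K"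
proof -
  obtain k \<delta>1 r1 where k: "k > 0" "\<delta>1 > 0" "r1 > 0" "a + \<delta>1 \<le> b"
    "\<And>t h w. t \<in> {a..a + \<delta>1} \<Longrightarrow> norm h \<le> r1 \<Longrightarrow> x t + h \<in> C \<and>
       L (x t + h, w) \<ge> 1 / 2 + Lx (x t, v t) \<bullet> h + Lv (x t, v t) \<bullet> (w - v t)
         - k / 2 * (norm h)\<^sup>2 - k * (t - a) * (h \<bullet> (w - v t))"
    using lagrangian_lower_bound[OF ab x v xC G1] by metis
  obtain d1 where d1: "d1 > 0" "\<And>t. t \<in> {a..b} \<Longrightarrow> dist t a < d1 \<Longrightarrow> dist (x t) (x a) < r1 / 2"
    using x ab k(3) unfolding continuous_on_iff by (metis atLeastAtMost_iff less_eq_real_def half_gt_zero)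
  define \<delta> where "\<delta> = min \<delta>1 (d1 / 2)"
  have \<delta>: "\<delta> > 0" "\<delta> \<le> \<delta>1" "\<delta> < d1" using k d1 by (auto simp: \<delta>_def)
  define \<xi> where "\<xi> t = Lv (x t, v t)" for t
  have \<xi>c: "continuous_on {a..b} \<xi>"
  proof -
    have "v t \<noteq> 0" if "t \<in> {a..b}" for t
      using G1[OF that] G_zero[OF xC[OF that]] by auto
    then show ?thesis unfolding \<xi>_def
      by (intro continuous_on_compose2[OF Lv_cont] continuous_intros x v) (auto simp: mem_slit xC)
  qed
  show ?thesis
  proof (rule that[of \<delta> "r1 / 2"])
    fix d p q :: real and y y' :: "real \<Rightarrow> 'a" and K S
    assume d: "0 < d" "d \<le> \<delta>" and pq: "p < q" and y: "continuous_on {p..q} y" and S: "finite S"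
      and reg: "\<forall>t\<in>{p<..<q} - S. (y has_vector_derivative y' t) (at t) \<and> K t = G (y t, y' t) \<and> isCont K t"
      and Ki: "K integrable_on {p..q}" and K0': "\<forall>t. K t \<ge> 0"
      and yr': "\<forall>t\<in>{p..q}. norm (y t - x a) \<le> r1 / 2"
      and yp: "Lv (x a, v a) \<bullet> (y p - x a) = 0" and yq: "y q = x (a + d)"
    have yd: "(y has_vector_derivative y' t) (at t)" and KG: "K t = G (y t, y' t)" and Kc: "isCont K t"
      if "t \<in> {p<..<q} - S" for t
      using reg that by blast+
    have K0: "K t \<ge> 0" for t using K0' by simp
    have yr: "norm (y t - x a) \<le> r1 / 2" if "t \<in> {p..q}" for t using yr' that by simp
    define len where "len = integral {p..q} K"
    have len0: "len \<ge> 0" unfolding len_def by (intro integral_nonneg Ki K0)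
    have main: "d\<^sup>2 \<le> (len + \<epsilon>) * len" if \<epsilon>: "\<epsilon> > 0" for \<epsilon>
    proof -
      \<comment> \<open>The new time \<theta> grows in proportion to the length plus a linear term
        of total amount \<epsilon>. The linear term makes \<theta> strictly increasing even where
        \<open>K\<close> vanishes, so that the velocity with respect to \<theta> makes
        sense.\<close>
      define \<epsilon>' where "\<epsilon>' = \<epsilon> / (q - p)"
      have \<epsilon>': "\<epsilon>' > 0" using \<epsilon> pq by (simp add: \<epsilon>'_def)
      define M where "M = len + \<epsilon>"
      have M: "M > 0" using len0 \<epsilon> by (simp add: M_def)
      define I where "I t = integral {p..t} K" for t
      have I0: "I p = 0" "I q = len" by (simp_all add: I_def len_def)
      have Ic: "continuous_on {p..q} I" unfolding I_def by (rule indefinite_integral_continuous_1[OF Ki])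
      have Imono: "I s \<le> I t" if "p \<le> s" "s \<le> t" "t \<le> q" for s t
        unfolding I_def using that K0
        by (intro integral_subset_le) (auto intro: integrable_on_subinterval[OF Ki])
      have Id: "(I has_real_derivative K t) (at t)" if "t \<in> {p<..<q} - S" for t
      proof -
        have "((\<lambda>u. integral {p..u} K) has_vector_derivative K t) (at t within ({p..q} - {}))"
          using that Kc[OF that]
          by (intro integral_has_vector_derivative_continuous_at Ki)
            (auto intro: continuous_at_imp_continuous_within)
        moreover have "at t within {p..q} = at t"
          using that by (intro at_within_interior) (auto simp: interior_atLeastAtMost_real)
        ultimately show ?thesis
          by (simp add: I_def[abs_def] has_real_derivative_iff_has_vector_derivative)
      qed
      define \<theta> where "\<theta> t = a + d / M * (I t + \<epsilon>' * (t - p))" for t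
      have dM: "d / M > 0" using d M by simp
      have \<theta>pq: "\<theta> p = a" "\<theta> q = a + d"
        using M pq by (simp_all add: \<theta>_def I0 \<epsilon>'_def M_def)
      have \<theta>c: "continuous_on {p..q} \<theta>" unfolding \<theta>_def by (intro continuous_intros Ic)
      have \<theta>mono: "\<theta> s < \<theta> t" if "p \<le> s" "s < t" "t \<le> q" for s t
      proof -
        have "I s + \<epsilon>' * (s - p) < I t + \<epsilon>' * (t - p)"
          using Imono[of s t] that \<epsilon>' by (intro add_le_less_mono mult_strict_left_mono) auto
        then show ?thesis unfolding \<theta>_def using mult_strict_left_mono[OF _ dM] by fastforce
      qed
      have \<theta>in: "\<theta> t \<in> {a..a + d}" if "t \<in> {p..q}" for t
        using \<theta>mono[of p t] \<theta>mono[of t q] that \<theta>pq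
        by (cases "t = p"; cases "t = q") auto
      have \<theta>in': "\<theta> t \<in> {a<..<a + d}" if "t \<in> {p<..<q}" for t
        using \<theta>mono[of p t] \<theta>mono[of t q] that \<theta>pq by auto
      have \<theta>sub: "{a..a + d} \<subseteq> {a..b}" "{a<..<a + d} \<subseteq> {a<..<b}" "{a..a + d} \<subseteq> {a..a + \<delta>1}"
        using d \<delta> k(4) by auto
      define \<eta> where "\<eta> t = y t - x (\<theta> t)" for t
      have \<eta>c: "continuous_on {p..q} \<eta>" unfolding \<eta>_def
        by (intro continuous_intros y continuous_on_compose2[OF x \<theta>c]) (use \<theta>in \<theta>sub(1) in blast)
      have \<eta>r: "norm (\<eta> t) \<le> r1" if "t \<in> {p..q}" for t
      proof -
        have "dist (x (\<theta> t)) (x a) < r1 / 2"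
          using \<theta>in[OF that] \<theta>sub(1) d \<delta> by (intro d1(2)) (auto simp: dist_real_def)
        then show ?thesis using yr[OF that] unfolding \<eta>_def dist_norm
          by (smt (verit) norm_triangle_ineq4 add_diff_cancel diff_diff_eq2 field_sum_of_halves diff_add_cancel)
      qed
      \<comment> \<open>The calibrating function along \<open>y\<close>. In the time \<theta> the
        energy grows at the rate \<open>(K t)\<^sup>2 / (2 * \<theta>')\<close>, which is at most
        \<open>M / (2 * d) * K t\<close>; hence the first term of \<open>Z\<close>, an upper bound
        for the energy.\<close>
      define \<Phi> where "\<Phi> t = \<xi> (\<theta> t) \<bullet> \<eta> t - k / 2 * (\<theta> t - a) * (\<eta> t \<bullet> \<eta> t) + 1 / 2 * (\<theta> t - a)" for t
      define Z where "Z t = M / (2 * d) * I t - \<Phi> t" for t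
      have \<xi>\<theta>c: "continuous_on {p..q} (\<lambda>t. \<xi> (\<theta> t))"
        by (rule continuous_on_compose2[OF \<xi>c \<theta>c]) (use \<theta>in \<theta>sub(1) in blast)
      have Zc: "continuous_on {p..q} Z" unfolding Z_def \<Phi>_def
        by (intro continuous_intros Ic \<xi>\<theta>c \<eta>c \<theta>c) auto
      have "\<exists>D\<ge>0. (Z has_vector_derivative D) (at t)" if t: "t \<in> {p<..<q} - S" for t
      proof -
        define \<theta>' where "\<theta>' = d / M * (K t + \<epsilon>')"
        define w where "w = (1 / \<theta>') *\<^sub>R y' t"
        define X V where "X = x (\<theta> t)" and "V = v (\<theta> t)"
        have \<theta>': "\<theta>' > 0" unfolding \<theta>'_def using dM K0[of t] \<epsilon>' by (intro mult_pos_pos) auto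
        have y'w: "y' t = \<theta>' *\<^sub>R w" using \<theta>' by (simp add: w_def)
        have \<theta>d: "(\<theta> has_real_derivative \<theta>') (at t)"
          unfolding \<theta>_def \<theta>'_def by (use M in \<open>auto intro!: derivative_eq_intros Id[OF t]\<close>)
        have \<theta>ab: "\<theta> t \<in> {a<..<b}" using \<theta>in'[of t] t \<theta>sub(2) by blast
        have chain: "((\<lambda>t. f (\<theta> t)) has_vector_derivative \<theta>' *\<^sub>R f') (at t)"
          if "(f has_vector_derivative f') (at (\<theta> t))" for f :: "real \<Rightarrow> 'a" and f'
          using vector_diff_chain_at[of \<theta> \<theta>' t f f'] that \<theta>d
          by (simp add: o_def has_real_derivative_iff_has_vector_derivative)
        have xd: "((\<lambda>t. x (\<theta> t)) has_vector_derivative \<theta>' *\<^sub>R V) (at t)"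
          unfolding V_def by (rule chain[OF xv[OF \<theta>ab]])
        have \<xi>d: "((\<lambda>t. \<xi> (\<theta> t)) has_vector_derivative \<theta>' *\<^sub>R Lx (X, V)) (at t)"
          unfolding X_def V_def by (rule chain) (use EL[OF \<theta>ab] in \<open>simp add: \<xi>_def\<close>)
        have \<eta>d: "(\<eta> has_vector_derivative \<theta>' *\<^sub>R (w - V)) (at t)"
          unfolding \<eta>_def using has_vector_derivative_diff[OF yd[OF t] xd]
          by (simp add: y'w scaleR_diff_right)
        define D where "D = M / (2 * d) * K t - \<theta>' * (1 / 2 + Lx (X, V) \<bullet> \<eta> t + \<xi> (\<theta> t) \<bullet> (w - V)
              - k / 2 * (\<eta> t \<bullet> \<eta> t) - k * (\<theta> t - a) * (\<eta> t \<bullet> (w - V)))"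
        have inn: "((\<lambda>t. f t \<bullet> g t) has_real_derivative f t \<bullet> g' + f' \<bullet> g t) (at t)"
          if "(f has_vector_derivative f') (at t)" "(g has_vector_derivative g') (at t)"
          for f g :: "real \<Rightarrow> 'a" and f' g'
          using bounded_bilinear.has_vector_derivative[OF bounded_bilinear_inner that]
          by (simp add: has_real_derivative_iff_has_vector_derivative)
        have "(Z has_real_derivative D) (at t)"
          unfolding Z_def \<Phi>_def D_def
          by (rule derivative_eq_intros inn[OF \<xi>d \<eta>d] inn[OF \<eta>d \<eta>d] \<theta>d Id[OF t] refl)+
            (simp add: inner_commute[of "w - V"], simp add: field_simps)
        moreover have "D \<ge> 0"
        proof -
          have "norm (\<eta> t) \<le> r1" "\<theta> t \<in> {a..a + \<delta>1}"
            using \<eta>r[of t] \<theta>in[of t] \<theta>sub(3) t by auto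
          then have kk: "X + \<eta> t \<in> C" "L (X + \<eta> t, w) \<ge> 1 / 2 + Lx (X, V) \<bullet> \<eta> t + \<xi> (\<theta> t) \<bullet> (w - V)
              - k / 2 * (\<eta> t \<bullet> \<eta> t) - k * (\<theta> t - a) * (\<eta> t \<bullet> (w - V))"
            using k(5)[of "\<theta> t" "\<eta> t" w] by (simp_all add: X_def V_def \<xi>_def power2_norm_eq_inner)
          have "X + \<eta> t = y t" by (simp add: X_def \<eta>_def)
          then have "L (X + \<eta> t, w) = (1 / \<theta>')\<^sup>2 * L (y t, y' t)"
            using L_hom[of "y t" "1 / \<theta>'" "y' t"] kk(1) \<theta>' by (simp add: w_def)
          then have "\<theta>' * L (X + \<eta> t, w) = (K t)\<^sup>2 / (2 * \<theta>')"
            using \<theta>' KG[OF t] by (simp add: L_def power2_eq_square)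
          also have "\<dots> = M / (2 * d) * (K t * (K t / (K t + \<epsilon>')))"
            using d M by (simp add: \<theta>'_def power2_eq_square mult_ac)
          also have "\<dots> \<le> M / (2 * d) * (K t * 1)"
            using K0[of t] \<epsilon>' d M by (intro mult_left_mono) (auto simp: divide_le_eq)
          finally have "\<theta>' * L (X + \<eta> t, w) \<le> M / (2 * d) * K t" by simp
          with mult_left_mono[OF kk(2), of \<theta>'] \<theta>' show ?thesis
            unfolding D_def by linarith
        qed
        ultimately show ?thesis by (auto simp: has_real_derivative_iff_has_vector_derivative)
      qed
      then obtain D where D: "\<And>t. t \<in> {p<..<q} - S \<Longrightarrow> D t \<ge> 0 \<and> (Z has_vector_derivative D t) (at t)"
        by metis
      have "((\<lambda>t. if t \<in> {p<..<q} - S then D t else 0) has_integral (Z q - Z p)) {p..q}"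
        using D by (intro fundamental_theorem_of_calculus_interior_strong[OF S] Zc) (use pq in auto)
      then have "Z q - Z p \<ge> 0"
        by (rule has_integral_nonneg) (use D in auto)
      \<comment> \<open>At the start only the momentum term of \<open>\<Phi>\<close> could survive,
        and it vanishes by the condition on \<open>y p\<close>. At the end \<eta> is 0, so
        \<open>\<Phi>\<close> equals \<open>d / 2\<close>.\<close>
      moreover have "Z p = 0"
        using yp by (simp add: Z_def \<Phi>_def I0 \<theta>pq \<eta>_def \<xi>_def)
      moreover have "Z q = M / (2 * d) * len - d / 2"
        using yq by (simp add: Z_def \<Phi>_def I0 \<theta>pq \<eta>_def)
      ultimately have "d / 2 \<le> M / (2 * d) * len" by simp
      then show ?thesis using d by (simp add: M_def field_simps power2_eq_square)
    qed
    have "d\<^sup>2 \<le> len * len"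
    proof (rule field_le_epsilon)
      fix e :: real assume "e > 0"
      then have "d\<^sup>2 \<le> (len + e / (len + 1)) * len" using len0 by (intro main) simp
      also have "\<dots> = len * len + e * (len / (len + 1))" by (simp add: algebra_simps)
      also have "e * (len / (len + 1)) \<le> e * 1" using len0 \<open>e > 0\<close> by (intro mult_left_mono) auto
      finally show "d\<^sup>2 \<le> len * len + e" by simp
    qed
    then show "d \<le> integral {p..q} K"
      using len0 unfolding len_def[symmetric] by (metis power2_eq_square power2_le_imp_le)
  qed (use \<delta> k in auto)
qed

end

section \<open>Charts and tangent vectors\<close>

locale finsler =
  fixes A :: "('m::{t2_space,second_countable_topology}, 'e::euclidean_space) chart set"
    and F :: "'m \<Rightarrow> ('m, 'e) tvec \<Rightarrow> real"
  assumes finsler: "finsler_manifold A F"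
begin

abbreviation tv where "tv \<equiv> tangent_vec A"

abbreviation LE where "LE \<equiv> local_expr A F"

lemma is_chart: "c \<in> A \<Longrightarrow> is_chart c"
  using finsler by (auto simp: finsler_manifold_def smooth_manifold_def smooth_structure_def)

lemma chart_exists: obtains c where "c \<in> A" "p \<in> chart_dom c"
proof -
  have "p \<in> (\<Union>c\<in>A. chart_dom c)"
    using finsler by (simp add: finsler_manifold_def smooth_manifold_def smooth_structure_def)
  then show ?thesis using that by blast
qed

lemma connected_M: "connected (UNIV :: 'm set)"
  using finsler by (auto simp: finsler_manifold_def smooth_manifold_def)

lemma open_dom: "c \<in> A \<Longrightarrow> open (chart_dom c)" and open_cod: "c \<in> A \<Longrightarrow> open (chart_cod c)"
  using is_chart by (auto simp: is_chart_def)

lemma cont_map: "c \<in> A \<Longrightarrow> continuous_on (chart_dom c) (chart_map c)"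
  and cont_inv: "c \<in> A \<Longrightarrow> continuous_on (chart_cod c) (chart_inv c)"
  using is_chart by (auto simp: is_chart_def homeomorphism_def)

lemma inv_map: "c \<in> A \<Longrightarrow> p \<in> chart_dom c \<Longrightarrow> chart_inv c (chart_map c p) = p"
  and map_inv: "c \<in> A \<Longrightarrow> x \<in> chart_cod c \<Longrightarrow> chart_map c (chart_inv c x) = x"
  and inv_dom: "c \<in> A \<Longrightarrow> x \<in> chart_cod c \<Longrightarrow> chart_inv c x \<in> chart_dom c"
  using is_chart[of c] by (auto simp: is_chart_def homeomorphism_def)

lemma map_cod: "p \<in> chart_dom c \<Longrightarrow> chart_map c p \<in> chart_cod c"
  by (simp add: chart_cod_def)

lemma open_chart_image:
  assumes "c \<in> A" "open V" "V \<subseteq> chart_dom c"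
  shows "open (chart_map c ` V)"
proof -
  have "chart_map c ` V = chart_cod c \<inter> chart_inv c -` V"
  proof (intro equalityI subsetI)
    fix x assume "x \<in> chart_map c ` V"
    then obtain p where "p \<in> V" "x = chart_map c p" by blast
    then show "x \<in> chart_cod c \<inter> chart_inv c -` V"
      using assms by (auto simp: inv_map[OF assms(1)] intro: map_cod)
  next
    fix x assume "x \<in> chart_cod c \<inter> chart_inv c -` V"
    then show "x \<in> chart_map c ` V"
      using map_inv[OF assms(1), of x] by (auto intro: rev_image_eqI)
  qed
  then show ?thesis
    using continuous_open_preimage[OF cont_inv[OF assms(1)] open_cod[OF assms(1)] assms(2)] by simp
qed

abbreviation overlap where "overlap c c' \<equiv> chart_map c ` (chart_dom c \<inter> chart_dom c')"

lemma open_overlap: "c \<in> A \<Longrightarrow> c' \<in> A \<Longrightarrow> open (overlap c c')"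
  by (intro open_chart_image open_Int open_dom) auto

lemma transition_smooth: "c \<in> A \<Longrightarrow> c' \<in> A \<Longrightarrow> smooth_on (overlap c c') (transition c c')"
  using finsler
  by (auto simp: finsler_manifold_def smooth_manifold_def smooth_structure_def compatible_def)

lemma transition_map: "c \<in> A \<Longrightarrow> p \<in> chart_dom c \<Longrightarrow> transition c c' (chart_map c p) = chart_map c' p"
  by (simp add: transition_def inv_map)

lemma transition_has_derivative:
  "c \<in> A \<Longrightarrow> c' \<in> A \<Longrightarrow> p \<in> chart_dom c \<Longrightarrow> p \<in> chart_dom c' \<Longrightarrow>
    (transition c c' has_derivative frechet_derivative (transition c c') (at (chart_map c p)))
      (at (chart_map c p))"
  by (rule smooth_on_has_derivative[OF transition_smooth]) auto

lemma transition_linear: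
  "c \<in> A \<Longrightarrow> c' \<in> A \<Longrightarrow> p \<in> chart_dom c \<Longrightarrow> p \<in> chart_dom c' \<Longrightarrow>
    linear (frechet_derivative (transition c c') (at (chart_map c p)))"
  using transition_has_derivative has_derivative_linear by blast

lemma tv_self: assumes "c \<in> A" "p \<in> chart_dom c" shows "tv c p u c = u"
proof -
  have "((\<lambda>x. x) has_derivative (\<lambda>x. x)) (at (chart_map c p))" by (rule has_derivative_ident)
  then have "(transition c c has_derivative (\<lambda>x. x)) (at (chart_map c p))"
    by (rule has_derivative_transform_within_open[where s = "chart_cod c"])
      (use assms in \<open>auto simp: transition_def map_inv intro: open_cod map_cod\<close>)
  then show ?thesis
    using frechet_derivative_at[of "transition c c"] assms by (fastforce simp: tangent_vec_def)
qed

text \<open>The chain rule for transition maps; it provides the compatibility condition of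
  \<open>tangent_space\<close>.\<close>

lemma tv_trans:
  assumes "c \<in> A" "c' \<in> A" "c'' \<in> A" "p \<in> chart_dom c" "p \<in> chart_dom c'" "p \<in> chart_dom c''"
  shows "tv c p u c'' = frechet_derivative (transition c' c'') (at (chart_map c' p)) (tv c p u c')"
proof -
  let ?D = "\<lambda>c c'. frechet_derivative (transition c c') (at (chart_map c p))"
  have "((\<lambda>x. transition c' c'' (transition c c' x)) has_derivative (\<lambda>u. ?D c' c'' (?D c c' u)))
      (at (chart_map c p))"
    by (rule has_derivative_compose[OF transition_has_derivative])
      (use assms transition_has_derivative[of c' c'' p] in \<open>auto simp: transition_map\<close>)
  then have "(transition c c'' has_derivative (\<lambda>u. ?D c' c'' (?D c c' u))) (at (chart_map c p))"
    by (rule has_derivative_transform_within_open[where s = "overlap c c'"])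
      (use assms in \<open>auto simp: transition_map intro: open_overlap\<close>)
  from frechet_derivative_at[OF this, symmetric] show ?thesis
    using assms by (simp add: tangent_vec_def)
qed

lemma tv_tangent:
  assumes "c \<in> A" "p \<in> chart_dom c"
  shows "tv c p u \<in> tangent_space A p"
  unfolding tangent_space_def mem_Collect_eq
proof (intro conjI ballI allI impI)
  fix c' c'' assume "c' \<in> A" "c'' \<in> A" "p \<in> chart_dom c' \<inter> chart_dom c''"
  then show "tv c p u c'' = frechet_derivative (transition c' c'') (at (chart_map c' p)) (tv c p u c')"
    using tv_trans[OF assms(1) _ _ assms(2)] by blast
qed (auto simp: tangent_vec_def)

lemma tv_change:
  assumes "c \<in> A" "c' \<in> A" "p \<in> chart_dom c" "p \<in> chart_dom c'"
  shows "tv c' p (tv c p u c') = tv c p u"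
proof
  fix c''
  show "tv c' p (tv c p u c') c'' = tv c p u c''"
  proof (cases "c'' \<in> A \<and> p \<in> chart_dom c''")
    case True
    then have "tv c' p (tv c p u c') c'' =
        frechet_derivative (transition c' c'') (at (chart_map c' p)) (tv c p u c')"
      by (subst tangent_vec_def) simp
    then show ?thesis using tv_trans[OF assms(1,2) _ assms(3,4), of c''] True by simp
  next
    case False
    then show ?thesis by (auto simp: tangent_vec_def)
  qed
qed

lemma tv_add_scale: assumes "c \<in> A" "p \<in> chart_dom c"
  shows "tv c p (u + s *\<^sub>R w) = (\<lambda>c'. tv c p u c' + s *\<^sub>R tv c p w c')"
  using transition_linear[OF assms(1) _ assms(2)]
  by (auto simp: tangent_vec_def fun_eq_iff linear_add linear_scale)

lemma tv_scale: assumes "c \<in> A" "p \<in> chart_dom c"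
  shows "tv c p (r *\<^sub>R u) = (\<lambda>c'. r *\<^sub>R tv c p u c')"
  using transition_linear[OF assms(1) _ assms(2)]
  by (auto simp: tangent_vec_def fun_eq_iff linear_scale)

lemma tv_nonzero: "c \<in> A \<Longrightarrow> p \<in> chart_dom c \<Longrightarrow> u \<noteq> 0 \<Longrightarrow> tv c p u \<noteq> (\<lambda>_. 0)"
  using tv_self by (metis (full_types))

lemma LE_map: "c \<in> A \<Longrightarrow> p \<in> chart_dom c \<Longrightarrow> LE c (chart_map c p, u) = F p (tv c p u)"
  by (simp add: local_expr_def inv_map)

lemma LE_change: "c \<in> A \<Longrightarrow> c' \<in> A \<Longrightarrow> p \<in> chart_dom c \<Longrightarrow> p \<in> chart_dom c' \<Longrightarrow>
    LE c' (chart_map c' p, tv c p u c') = LE c (chart_map c p, u)"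
  by (simp add: LE_map tv_change)

text \<open>Linearity of \<open>tv c p\<close> carries homogeneity and the fundamental tensor from
  \<open>F\<close> over to \<open>LE c\<close>, and its injectivity keeps nonzero vectors nonzero.
  Thus the coordinate analysis of \<open>local_finsler\<close> applies in every chart.\<close>

lemma LE_local_finsler: assumes c: "c \<in> A" shows "local_finsler (chart_cod c) (LE c)"
proof
  have fm: "finsler_metric A F" using finsler by (simp add: finsler_manifold_def)
  show "open (chart_cod c)" by (rule open_cod[OF c])
  show "continuous_on (chart_cod c \<times> UNIV) (LE c)" using fm c by (simp add: finsler_metric_def)
  show "Ck_on 2 (chart_cod c \<times> (UNIV - {0})) (LE c)"
    using fm c by (simp add: finsler_metric_def smooth_on_Ck)
  fix x u :: 'e assume x: "x \<in> chart_cod c" and u: "u \<noteq> 0"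
  define p where "p = chart_inv c x"
  have p: "p \<in> chart_dom c" "chart_map c p = x" using x c by (auto simp: p_def inv_dom map_inv)
  have LE: "LE c (x, w) = F p (tv c p w)" for w using LE_map[OF c p(1)] p(2) by simp
  have mem: "tv c p w \<in> tangent_space A p - {\<lambda>_. 0}" if "w \<noteq> 0" for w
    using tv_tangent[OF c p(1)] tv_nonzero[OF c p(1) that] by blast
  show "LE c (x, r *\<^sub>R u) = r * LE c (x, u)" if "r > 0" for r
    using fm mem[OF u] that by (simp add: LE tv_scale[OF c p(1)] finsler_metric_def)
  show "deriv (\<lambda>s1. deriv (\<lambda>s2. (LE c (x, u + s1 *\<^sub>R w + s2 *\<^sub>R w))\<^sup>2) 0) 0 > 0" if w: "w \<noteq> 0" for w
  proof -
    have "fundamental_tensor F p (tv c p u) (tv c p w) (tv c p w) > 0"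
      using fm mem[OF u] mem[OF w] unfolding finsler_metric_def by blast
    moreover have "F p (\<lambda>c'. tv c p u c' + s1 *\<^sub>R tv c p w c' + s2 *\<^sub>R tv c p w c') =
        LE c (x, u + s1 *\<^sub>R w + s2 *\<^sub>R w)" for s1 s2
      unfolding LE by (simp add: tv_add_scale[OF c p(1)])
    ultimately show ?thesis by (simp add: fundamental_tensor_def)
  qed
qed


section \<open>Smooth curves\<close>

lemma smooth_map_on_subset:
  assumes "smooth_map_on A S f" "T \<subseteq> S"
  shows "smooth_map_on A T f"
  unfolding smooth_map_on_def
proof
  fix x assume "x \<in> T"
  then obtain c W g where "c \<in> A" "open W" "x \<in> W" "f ` (S \<inter> W) \<subseteq> chart_dom c" "smooth_on W g"
      "\<forall>y\<in>S \<inter> W. chart_map c (f y) = g y"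
    using assms unfolding smooth_map_on_def by (meson subsetD)
  then show "\<exists>c\<in>A. \<exists>W g. open W \<and> x \<in> W \<and> f ` (T \<inter> W) \<subseteq> chart_dom c \<and> smooth_on W g \<and>
      (\<forall>y\<in>T \<inter> W. chart_map c (f y) = g y)"
    using assms(2) by (intro bexI[of _ c] exI[of _ W] exI[of _ g]) auto
qed

lemma smooth_map_on_cong:
  assumes "smooth_map_on A S f" "\<And>x. x \<in> S \<Longrightarrow> f x = g x"
  shows "smooth_map_on A S g"
proof -
  have "f ` (S \<inter> W) = g ` (S \<inter> W)" for W using assms(2) by (auto simp: image_def)
  moreover have "(\<forall>y\<in>S \<inter> W. chart_map c (f y) = h y) \<longleftrightarrow> (\<forall>y\<in>S \<inter> W. chart_map c (g y) = h y)" for c :: "('m, 'e) chart" and W h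
    using assms(2) by auto
  ultimately show ?thesis using assms(1) unfolding smooth_map_on_def by simp
qed

text \<open>\<open>smooth_map_on\<close> offers at each point some chart of its own choice;
  composition with a transition map yields a prescribed one. The neighbourhood is shrunk so that the
  extension \<open>g\<close> takes values in the chart even off \<open>S\<close>.\<close>

lemma smooth_map_on_chart:
  fixes f :: "'a::euclidean_space \<Rightarrow> 'm"
  assumes "smooth_map_on A S f" "x \<in> S" "c \<in> A" "f x \<in> chart_dom c"
  obtains W g where "open W" "x \<in> W" "smooth_on W g"
    "\<And>y. y \<in> S \<Longrightarrow> y \<in> W \<Longrightarrow> f y \<in> chart_dom c \<and> chart_map c (f y) = g y"
    "\<And>y. y \<in> W \<Longrightarrow> g y \<in> chart_cod c"
proof -
  obtain c1 W1 g1 where 1: "c1 \<in> A" "open W1" "x \<in> W1" "f ` (S \<inter> W1) \<subseteq> chart_dom c1" "smooth_on W1 g1"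
      "\<And>y. y \<in> S \<inter> W1 \<Longrightarrow> chart_map c1 (f y) = g1 y"
    using assms(1,2) unfolding smooth_map_on_def by meson
  define W where "W = W1 \<inter> g1 -` overlap c1 c"
  have oW: "open W" unfolding W_def
    by (rule continuous_open_preimage[OF smooth_on_continuous[OF 1(5)] 1(2) open_overlap[OF 1(1) assms(3)]])
  have fx: "f x \<in> chart_dom c1" using 1(3,4) assms(2) by auto
  have g1x: "chart_map c1 (f x) = g1 x" using 1(3,6) assms(2) by blast
  have xW: "x \<in> W" using fx assms(4) g1x[symmetric] 1(3) by (auto simp: W_def)
  have sm: "smooth_on W (\<lambda>y. transition c1 c (g1 y))"
    by (rule smooth_on_compose[OF oW open_overlap[OF 1(1) assms(3)] _ transition_smooth[OF 1(1) assms(3)]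
          smooth_on_subset[OF 1(5)]]) (auto simp: W_def)
  show ?thesis
  proof (rule that[OF oW xW sm])
    fix y assume y: "y \<in> S" "y \<in> W"
    then obtain p where p: "g1 y = chart_map c1 p" "p \<in> chart_dom c1" "p \<in> chart_dom c"
      by (auto simp: W_def)
    have fy: "f y \<in> chart_dom c1" "chart_map c1 (f y) = g1 y" using 1(4,6) y by (auto simp: W_def)
    have "f y = p" using fy p inv_map[OF 1(1)] by metis
    then show "f y \<in> chart_dom c \<and> chart_map c (f y) = transition c1 c (g1 y)"
      using p 1(1) by (simp add: transition_map)
  next
    fix y assume "y \<in> W"
    then obtain p where p: "g1 y = chart_map c1 p" "p \<in> chart_dom c1" "p \<in> chart_dom c"
      by (auto simp: W_def)
    then show "transition c1 c (g1 y) \<in> chart_cod c"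
      using 1(1) by (simp add: transition_map map_cod)
  qed
qed

lemma smooth_map_on_chartI:
  fixes f :: "'a::euclidean_space \<Rightarrow> 'm"
  assumes "c \<in> A" "open W" "S \<subseteq> W" "smooth_on W g" "\<And>y. y \<in> S \<Longrightarrow> f y \<in> chart_dom c"
    "\<And>y. y \<in> S \<Longrightarrow> chart_map c (f y) = g y"
  shows "smooth_map_on A S f"
  unfolding smooth_map_on_def
  by (intro ballI bexI[OF _ assms(1)] exI[of _ W] exI[of _ g]) (use assms in auto)

lemma smooth_map_on_continuous:
  fixes f :: "'a::euclidean_space \<Rightarrow> 'm"
  assumes "smooth_map_on A S f"
  shows "continuous_on S f"
  unfolding continuous_on_eq_continuous_within
proof
  fix x assume x: "x \<in> S"
  obtain c where c: "c \<in> A" "f x \<in> chart_dom c" by (rule chart_exists)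
  obtain W g where W: "open W" "x \<in> W" "smooth_on W g"
    "\<And>y. y \<in> S \<Longrightarrow> y \<in> W \<Longrightarrow> f y \<in> chart_dom c \<and> chart_map c (f y) = g y"
    "\<And>y. y \<in> W \<Longrightarrow> g y \<in> chart_cod c"
    using smooth_map_on_chart[OF assms x c] by blast
  have "continuous_on W (\<lambda>y. chart_inv c (g y))"
    by (rule continuous_on_compose2[OF cont_inv[OF c(1)] smooth_on_continuous[OF W(3)]]) (use W(5) in auto)
  then have "continuous_on (S \<inter> W) f"
    by (rule continuous_on_eq[OF continuous_on_subset]) (use W(4) inv_map[OF c(1)] in \<open>auto, metis\<close>)
  then have "continuous (at x within (S \<inter> W)) f"
    using x W(2) by (simp add: continuous_on_eq_continuous_within)
  moreover have "at x within (S \<inter> W) = at x within S"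
    using W(1,2) by (intro at_within_nhd[of x W]) auto
  ultimately show "continuous (at x within S) f" by (simp add: continuous_within)
qed

text \<open>The chain rule determines all coordinates of the velocity from those in one chart. The
  assumption \<open>uniq\<close> covers both two-sided derivatives and one-sided ones at the end
  points of an interval.\<close>

lemma velocity_chart:
  assumes c: "c \<in> A" "\<gamma> t \<in> chart_dom c"
    and d: "((\<lambda>s. chart_map c (\<gamma> s)) has_vector_derivative y) (at t within T)"
    and W: "open W" "t \<in> W" "\<And>s. s \<in> T \<Longrightarrow> s \<in> W \<Longrightarrow> \<gamma> s \<in> chart_dom c" and tT: "t \<in> T"
    and uniq: "\<And>(f :: real \<Rightarrow> 'e) f'. (f has_vector_derivative f') (at t within T) \<Longrightarrow>
      vector_derivative f (at t within T) = f'"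
  shows "velocity A T \<gamma> t = tv c (\<gamma> t) y"
proof
  fix c'
  show "velocity A T \<gamma> t c' = tv c (\<gamma> t) y c'"
  proof (cases "c' \<in> A \<and> \<gamma> t \<in> chart_dom c'")
    case True
    let ?D = "frechet_derivative (transition c c') (at (chart_map c (\<gamma> t)))"
    have "((\<lambda>s. transition c c' (chart_map c (\<gamma> s))) has_derivative (\<lambda>h. ?D (h *\<^sub>R y))) (at t within T)"
      using has_derivative_compose[OF d[unfolded has_vector_derivative_def]
          transition_has_derivative[OF c(1) _ c(2)]] True by simp
    moreover have "\<forall>\<^sub>F s in at t within T. transition c c' (chart_map c (\<gamma> s)) = chart_map c' (\<gamma> s)"
      unfolding eventually_at_topological using W c(1) by (auto simp: transition_map intro!: exI[of _ W])
    ultimately have "((\<lambda>s. chart_map c' (\<gamma> s)) has_derivative (\<lambda>h. ?D (h *\<^sub>R y))) (at t within T)"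
      by (rule has_derivative_transform_eventually) (simp_all add: transition_map[OF c] tT)
    then have "((\<lambda>s. chart_map c' (\<gamma> s)) has_vector_derivative ?D y) (at t within T)"
      using transition_linear[OF c(1) _ c(2)] True by (simp add: has_vector_derivative_def linear_scale)
    from uniq[OF this] True show ?thesis by (simp add: velocity_def tangent_vec_def)
  qed (auto simp: velocity_def tangent_vec_def)
qed

text \<open>The two-sided velocity is used, so that the integrand no longer depends on the interval
  and lengths can be cut and joined. It agrees with the integrand of \<open>curve_length\<close>
  except possibly at the two end points.\<close>

definition speed :: "(real \<Rightarrow> 'm) \<Rightarrow> real \<Rightarrow> real" where
  "speed \<gamma> t = F (\<gamma> t) (velocity A UNIV \<gamma> t)"

lemma velocity_interior: "t \<in> {a<..<b} \<Longrightarrow> velocity A {a..b} \<gamma> t = velocity A UNIV \<gamma> t"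
  by (auto simp: velocity_def at_within_Icc_at)

lemma velocity_cong:
  assumes "open W" "t \<in> W" "\<And>s. s \<in> W \<Longrightarrow> \<gamma> s = \<gamma>' s"
  shows "velocity A UNIV \<gamma> t = velocity A UNIV \<gamma>' t"
proof -
  have "\<forall>\<^sub>F s in nhds t. \<gamma> s = \<gamma>' s"
    using assms eventually_nhds by blast
  then have "vector_derivative (\<lambda>s. chart_map c (\<gamma> s)) (at t) = vector_derivative (\<lambda>s. chart_map c (\<gamma>' s)) (at t)" for c :: "('m, 'e) chart"
    by (intro vector_derivative_cong_eq refl) (auto elim!: eventually_mono)
  then show ?thesis using assms by (auto simp: velocity_def fun_eq_iff)
qed

lemma speed_cong:
  assumes "open W" "t \<in> W" "\<And>s. s \<in> W \<Longrightarrow> \<gamma> s = \<gamma>' s"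
  shows "speed \<gamma> t = speed \<gamma>' t"
  using velocity_cong[of W t \<gamma> \<gamma>'] assms by (simp add: speed_def)

lemma curve_length_speed: "curve_length A F \<gamma> a b = integral {a..b} (speed \<gamma>)"
  unfolding curve_length_def
  by (rule integral_spike[of "{a, b}"]) (auto simp: speed_def velocity_interior)

lemma curve_energy_speed: "curve_energy A F \<gamma> a b = 1 / 2 * integral {a..b} (\<lambda>t. (speed \<gamma> t)\<^sup>2)"
  unfolding curve_energy_def
  by (intro arg_cong[of _ _ "(*) (1/2)"] integral_spike[of "{a, b}"]) (auto simp: speed_def velocity_interior)

lemma smooth_on_vector_derivative:
  fixes g :: "real \<Rightarrow> 'e"
  assumes "smooth_on W g" "t \<in> W"
  shows "(g has_vector_derivative frechet_derivative g (at t) 1) (at t)"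
  using smooth_on_has_derivative[OF assms] has_derivative_linear
  by (fastforce simp: has_vector_derivative_def linear_scale[symmetric])

lemma speed_chart:
  assumes "smooth_map_on A W \<gamma>" "open W" "t \<in> W" "c \<in> A" "\<gamma> t \<in> chart_dom c"
  obtains W' g where "open W'" "W' \<subseteq> W" "t \<in> W'" "smooth_on W' g"
    "\<And>s. s \<in> W' \<Longrightarrow> \<gamma> s \<in> chart_dom c \<and> chart_map c (\<gamma> s) = g s"
    "\<And>s. s \<in> W' \<Longrightarrow> ((\<lambda>s. chart_map c (\<gamma> s)) has_vector_derivative frechet_derivative g (at s) 1) (at s)"
    "\<And>s. s \<in> W' \<Longrightarrow> speed \<gamma> s = LE c (g s, frechet_derivative g (at s) 1)"
proof -
  obtain W' g where W: "open W'" "t \<in> W'" "smooth_on W' g"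
    "\<And>y. y \<in> W \<Longrightarrow> y \<in> W' \<Longrightarrow> \<gamma> y \<in> chart_dom c \<and> chart_map c (\<gamma> y) = g y"
    using smooth_map_on_chart[OF assms(1,3-5)] by metis
  define V where "V = W \<inter> W'"
  have V: "open V" "t \<in> V" "V \<subseteq> W" "smooth_on V g" using W assms by (auto simp: V_def intro: smooth_on_subset)
  have eq: "\<gamma> y \<in> chart_dom c \<and> chart_map c (\<gamma> y) = g y" if "y \<in> V" for y using that W by (auto simp: V_def)
  have d: "((\<lambda>s. chart_map c (\<gamma> s)) has_vector_derivative frechet_derivative g (at s) 1) (at s)" if "s \<in> V" for s
    by (rule has_vector_derivative_transform_within_open[OF smooth_on_vector_derivative[OF V(4) that] V(1) that])
      (use eq in auto)
  show ?thesis
  proof (rule that[OF V(1,3,2,4) eq d])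
    fix s assume s: "s \<in> V"
    have "velocity A UNIV \<gamma> s = tv c (\<gamma> s) (frechet_derivative g (at s) 1)"
      by (rule velocity_chart[of _ _ _ _ _ V]) (use assms eq d s V in \<open>auto intro: vector_derivative_at\<close>)
    then show "speed \<gamma> s = LE c (g s, frechet_derivative g (at s) 1)"
      using LE_map[OF assms(4)] eq[OF s] by (metis speed_def)
  qed
qed

lemma smooth_on_derivative_continuous:
  "smooth_on W g \<Longrightarrow> continuous_on W (\<lambda>s. frechet_derivative g (at s) 1)"
  using smooth_on_Ck[of W g 1] by simp

lemma LE_cont: "c \<in> A \<Longrightarrow> continuous_on (chart_cod c \<times> UNIV) (LE c)"
  using LE_local_finsler local_finsler.G_cont by blast

lemma speed_isCont:
  assumes "smooth_map_on A W \<gamma>" "open W" "t \<in> W"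
  shows "isCont (speed \<gamma>) t"
proof -
  obtain c where c: "c \<in> A" "\<gamma> t \<in> chart_dom c" by (rule chart_exists)
  obtain W' g where W: "open W'" "t \<in> W'" "smooth_on W' g"
    "\<And>s. s \<in> W' \<Longrightarrow> \<gamma> s \<in> chart_dom c \<and> chart_map c (\<gamma> s) = g s"
    "\<And>s. s \<in> W' \<Longrightarrow> speed \<gamma> s = LE c (g s, frechet_derivative g (at s) 1)"
    using speed_chart[OF assms c] by metis
  have cod: "g s \<in> chart_cod c" if "s \<in> W'" for s
    using W(4)[OF that] map_cod[of "\<gamma> s" c] by auto
  have "continuous_on W' (\<lambda>s. LE c (g s, frechet_derivative g (at s) 1))"
    by (rule continuous_on_compose2[OF LE_cont[OF c(1)]])
      (use cod in \<open>auto intro!: continuous_intros smooth_on_continuous[OF W(3)]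
          smooth_on_derivative_continuous[OF W(3)] simp del: split_paired_All\<close>)
  then have "continuous_on W' (speed \<gamma>)"
    by (rule continuous_on_eq) (simp add: W)
  then show ?thesis using continuous_on_eq_continuous_at[OF W(1)] W(2) by blast
qed

text \<open>The speed formed with one-sided velocities is continuous up to the end points, because
  the coordinates extend smoothly beyond them. It differs from \<open>speed\<close> at the end
  points only.\<close>

lemma speed_integrable_piece:
  assumes "a < b" "smooth_map_on A {a..b} \<gamma>"
  shows "speed \<gamma> integrable_on {a..b}"
proof -
  define K where "K t = F (\<gamma> t) (velocity A {a..b} \<gamma> t)" for t
  have "continuous_on {a..b} K"
    unfolding continuous_on_eq_continuous_within
  proof
    fix t assume t: "t \<in> {a..b}"
    obtain c where c: "c \<in> A" "\<gamma> t \<in> chart_dom c" by (rule chart_exists)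
    obtain W g where W: "open W" "t \<in> W" "smooth_on W g"
      "\<And>y. y \<in> {a..b} \<Longrightarrow> y \<in> W \<Longrightarrow> \<gamma> y \<in> chart_dom c \<and> chart_map c (\<gamma> y) = g y"
      "\<And>y. y \<in> W \<Longrightarrow> g y \<in> chart_cod c"
      using smooth_map_on_chart[OF assms(2) t c] by blast
    have K: "LE c (g s, frechet_derivative g (at s) 1) = K s" if s: "s \<in> {a..b} \<inter> W" for s
    proof -
      have "(g has_vector_derivative frechet_derivative g (at s) 1) (at s within {a..b})"
        using smooth_on_vector_derivative[OF W(3)] s by (auto intro: has_vector_derivative_at_within)
      moreover have "\<forall>\<^sub>F r in at s within {a..b}. g r = chart_map c (\<gamma> r)"
        unfolding eventually_at_topological using W s by (auto intro!: exI[of _ W])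
      ultimately have "((\<lambda>s. chart_map c (\<gamma> s)) has_vector_derivative frechet_derivative g (at s) 1) (at s within {a..b})"
        unfolding has_vector_derivative_def
        by (rule has_derivative_transform_eventually) (use W s in auto)
      then have "velocity A {a..b} \<gamma> s = tv c (\<gamma> s) (frechet_derivative g (at s) 1)"
        by (rule velocity_chart[of _ _ _ _ _ W, rotated 2])
          (use assms c W s in \<open>auto intro: vector_derivative_within_closed_interval\<close>)
      then show ?thesis using LE_map[OF c(1)] W(4) s by (metis IntE K_def)
    qed
    have "continuous_on ({a..b} \<inter> W) (\<lambda>s. LE c (g s, frechet_derivative g (at s) 1))"
    proof (rule continuous_on_compose2[OF LE_cont[OF c(1)]])
      show "continuous_on ({a..b} \<inter> W) (\<lambda>s. (g s, frechet_derivative g (at s) 1))"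
        using smooth_on_continuous[OF W(3)] smooth_on_derivative_continuous[OF W(3)]
        by (auto intro!: continuous_intros elim: continuous_on_subset)
    qed (use W in auto)
    then have "continuous_on ({a..b} \<inter> W) K"
      by (rule continuous_on_eq) (rule K)
    then have "continuous (at t within ({a..b} \<inter> W)) K"
      using t W(2) by (simp add: continuous_on_eq_continuous_within)
    moreover have "at t within ({a..b} \<inter> W) = at t within {a..b}"
      using W(1,2) by (intro at_within_nhd[of t W]) auto
    ultimately show "continuous (at t within {a..b}) K" by (simp add: continuous_within)
  qed
  then have "K integrable_on {a..b}" by (rule integrable_continuous_interval)
  then show ?thesis
    by (rule integrable_spike[of _ _ "{a, b}"]) (auto simp: K_def speed_def velocity_interior)
qed


section \<open>Piecewise smooth curves\<close>

lemma pw_smooth_piece: "a < b \<Longrightarrow> smooth_map_on A {a..b} \<gamma> \<Longrightarrow> pw_smooth_curve A \<gamma> a b"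
  unfolding pw_smooth_curve_def
  by (intro conjI exI[of _ "1::nat"] exI[of _ "\<lambda>i. if i = 0 then a else b"]) auto

lemma pw_smooth_append:
  assumes "pw_smooth_curve A \<gamma> a b" "b < c" "smooth_map_on A {b..c} \<gamma>"
  shows "pw_smooth_curve A \<gamma> a c"
proof -
  obtain n t where t: "t 0 = a" "t n = b" "\<forall>i<n. t i < t (Suc i) \<and> smooth_map_on A {t i..t (Suc i)} \<gamma>"
    and ab: "a < b"
    using assms(1) by (auto simp: pw_smooth_curve_def)
  define t' where "t' i = (if i \<le> n then t i else c)" for i
  have "\<forall>i<Suc n. t' i < t' (Suc i) \<and> smooth_map_on A {t' i..t' (Suc i)} \<gamma>"
    using t assms by (auto simp: t'_def less_Suc_eq_le le_less)
  moreover have "t' 0 = a" "t' (Suc n) = c" using t by (auto simp: t'_def)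
  ultimately show ?thesis using ab assms(2) unfolding pw_smooth_curve_def
    by (intro conjI exI[of _ "Suc n"] exI[of _ t']) simp_all
qed

text \<open>Hides the partition in the definition: a piecewise smooth curve arises by appending
  smooth pieces on the right.\<close>

lemma pw_smooth_induct [consumes 1, case_names piece append]:
  assumes "pw_smooth_curve A \<gamma> a b"
    and "\<And>a b. a < b \<Longrightarrow> smooth_map_on A {a..b} \<gamma> \<Longrightarrow> P a b"
    and "\<And>a b c. pw_smooth_curve A \<gamma> a b \<Longrightarrow> P a b \<Longrightarrow> b < c \<Longrightarrow> smooth_map_on A {b..c} \<gamma> \<Longrightarrow> P a c"
  shows "P a b"
proof -
  obtain n t where t: "t 0 = a" "t n = b" "\<forall>i<n. t i < t (Suc i) \<and> smooth_map_on A {t i..t (Suc i)} \<gamma>"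
    and ab: "a < b"
    using assms(1) by (auto simp: pw_smooth_curve_def)
  have "m < n \<Longrightarrow> pw_smooth_curve A \<gamma> a (t (Suc m)) \<and> P a (t (Suc m))" for m
  proof (induction m)
    case 0
    then show ?case using t assms(2) pw_smooth_piece by auto
  next
    case (Suc m)
    then show ?case using t assms(3)[of a "t (Suc m)" "t (Suc (Suc m))"] pw_smooth_append[of \<gamma> a "t (Suc m)"] by auto
  qed
  moreover have "n \<noteq> 0" using t(1,2) ab by (metis less_irrefl)
  ultimately show ?thesis using t(2) by (metis lessI not0_implies_Suc)
qed

lemma pw_smooth_less: "pw_smooth_curve A \<gamma> a b \<Longrightarrow> a < b"
  by (simp add: pw_smooth_curve_def)

lemma pw_smooth_continuous: "pw_smooth_curve A \<gamma> a b \<Longrightarrow> continuous_on {a..b} \<gamma>"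
proof (induction rule: pw_smooth_induct)
  case (append a b c)
  have "continuous_on {b..c} \<gamma>" by (rule smooth_map_on_continuous[OF append.hyps(3)])
  then have "continuous_on ({a..b} \<union> {b..c}) \<gamma>"
    using append by (intro continuous_on_closed_Un) auto
  moreover have "{a..b} \<union> {b..c} = {a..c}" using append pw_smooth_less by (intro ivl_disj_un_two_touch(4)) force+
  ultimately show ?case by simp
qed (rule smooth_map_on_continuous)

lemma speed_integrable: "pw_smooth_curve A \<gamma> a b \<Longrightarrow> speed \<gamma> integrable_on {a..b}"
proof (induction rule: pw_smooth_induct)
  case (append a b c)
  have "a \<le> b" "b \<le> c" using append pw_smooth_less by fastforce+
  then show ?case
    by (rule Henstock_Kurzweil_Integration.integrable_combine[OF _ _ append.IH speed_integrable_piece[OF append.hyps(2,3)]])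
qed (rule speed_integrable_piece)

lemma pw_smooth_regular:
  "pw_smooth_curve A \<gamma> a b \<Longrightarrow> \<exists>S. finite S \<and> (\<forall>t\<in>{a<..<b} - S. \<exists>W. open W \<and> t \<in> W \<and> smooth_map_on A W \<gamma>)"
proof (induction rule: pw_smooth_induct)
  case (piece a b)
  have "smooth_map_on A {a<..<b} \<gamma>"
    by (rule smooth_map_on_subset[OF piece(2)]) auto
  then show ?case
    by (metis DiffD1 finite.emptyI open_greaterThanLessThan)
next
  case (append a b c)
  obtain S where S: "finite S" "\<And>t. t \<in> {a<..<b} - S \<Longrightarrow> \<exists>W. open W \<and> t \<in> W \<and> smooth_map_on A W \<gamma>"
    using append.IH by metis
  have sm: "smooth_map_on A {b<..<c} \<gamma>"
    by (rule smooth_map_on_subset[OF append.hyps(3)]) auto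
  show ?case
  proof (rule exI[of _ "insert b S"], intro conjI ballI)
    show "finite (insert b S)" using S(1) by simp
    fix t assume t: "t \<in> {a<..<c} - insert b S"
    show "\<exists>W. open W \<and> t \<in> W \<and> smooth_map_on A W \<gamma>"
    proof (cases "t < b")
      case True
      then show ?thesis using t by (intro S(2)) auto
    next
      case False
      then have "t \<in> {b<..<c}" using t by auto
      then show ?thesis using sm open_greaterThanLessThan by metis
    qed
  qed
qed

lemma pw_smooth_sub:
  "pw_smooth_curve A \<gamma> a b \<Longrightarrow> a \<le> p \<Longrightarrow> p < q \<Longrightarrow> q \<le> b \<Longrightarrow> pw_smooth_curve A \<gamma> p q"
proof (induction arbitrary: p q rule: pw_smooth_induct)
  case (piece a b)
  then show ?case by (intro pw_smooth_piece smooth_map_on_subset[OF piece(2)]) auto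
next
  case (append a b c)
  consider "q \<le> b" | "b \<le> p" | "p < b" "b < q" by linarith
  then show ?case
  proof cases
    case 1
    then show ?thesis using append.prems by (intro append.IH)
  next
    case 2
    have "smooth_map_on A {p..q} \<gamma>"
      by (rule smooth_map_on_subset[OF append.hyps(3)]) (use 2 append.prems in auto)
    then show ?thesis using append.prems by (intro pw_smooth_piece)
  next
    case 3
    have "smooth_map_on A {b..q} \<gamma>"
      by (rule smooth_map_on_subset[OF append.hyps(3)]) (use append.prems in auto)
    moreover have "pw_smooth_curve A \<gamma> p b"
      using append.prems 3 by (intro append.IH) auto
    ultimately show ?thesis using pw_smooth_append[of \<gamma> p b q] 3(2) by simp
  qed
qed

end

section \<open>The first variation\<close>

text \<open>The test functions are the polynomials \<open>(t - a) * (T - t)\<close>, which vanish at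
  both ends, and the end time \<open>T\<close> varies instead of their shape. One differentiation in
  \<open>T\<close> shows that the integral of \<open>(t - a) * \<Lambda> t + B t\<close> over
  \<open>{a..T}\<close> is \<open>(T - a) * B T\<close>. This expresses \<open>B\<close> by an
  integral, so it is differentiable, and a second differentiation gives the derivative.\<close>

lemma du_bois_reymond:
  fixes B \<Lambda> :: "real \<Rightarrow> real"
  assumes B: "continuous_on {a..b} B" and \<Lambda>: "continuous_on {a..b} \<Lambda>"
    and I: "\<And>T. T \<in> {a<..b} \<Longrightarrow> integral {a..T} (\<lambda>t. (t - a) * (T - t) * \<Lambda> t + (T + a - 2 * t) * B t) = 0"
    and T: "T \<in> {a<..<b}"
  shows "(B has_real_derivative \<Lambda> T) (at T)"
proof -
  define J where "J f T = integral {a..T} f" for f :: "real \<Rightarrow> real" and T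
  have Jd: "((J f) has_real_derivative f T) (at T)" if "continuous_on {a..b} f" "T \<in> {a<..<b}" for f T
    using integral_has_real_derivative[OF that(1), of T] that(2)
    by (simp add: J_def[abs_def] at_within_Icc_at)
  let ?A = "\<lambda>t. (t - a) * \<Lambda> t"
  have cont: "continuous_on {a..b} ?A" "continuous_on {a..b} (\<lambda>t. t * ?A t)" "continuous_on {a..b} (\<lambda>t. t * B t)"
    "continuous_on {a..b} (\<lambda>t. ?A t + B t)"
    using B \<Lambda> by (auto intro!: continuous_intros)
  have 1: "J (\<lambda>t. ?A t + B t) T = (T - a) * B T" if T: "T \<in> {a<..<b}" for T
  proof -
    let ?f = "\<lambda>T. T * J ?A T - J (\<lambda>t. t * ?A t) T + (T + a) * J B T - 2 * J (\<lambda>t. t * B t) T"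
    have 0: "?f T = 0" if T: "T \<in> {a<..<b}" for T
    proof -
      have sub: "{a..T} \<subseteq> {a..b}" using T by auto
      have int: "f integrable_on {a..T}" if "continuous_on {a..b} f" for f :: "real \<Rightarrow> real"
        by (intro integrable_continuous_interval continuous_on_subset[OF that sub])
      have "((\<lambda>t. T * ?A t - t * ?A t + (T + a) * B t - 2 * (t * B t)) has_integral ?f T) {a..T}"
        unfolding J_def
        by (intro has_integral_add has_integral_diff has_integral_mult_right integrable_integral int cont B)
      then have "?f T = integral {a..T} (\<lambda>t. T * ?A t - t * ?A t + (T + a) * B t - 2 * (t * B t))"
        by (simp add: integral_unique)
      also have "\<dots> = integral {a..T} (\<lambda>t. (t - a) * (T - t) * \<Lambda> t + (T + a - 2 * t) * B t)"
        by (rule arg_cong[where f = "integral {a..T}"]) (auto simp: algebra_simps)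
      also have "\<dots> = 0" using T by (intro I) auto
      finally show ?thesis .
    qed
    have "(?f has_real_derivative (J ?A T + T * ?A T) - T * ?A T + (J B T + (T + a) * B T) - 2 * (T * B T)) (at T)"
      by (rule derivative_eq_intros Jd[OF cont(1) T] Jd[OF cont(2) T] Jd[OF B T] Jd[OF cont(3) T] refl)+
        (simp add: algebra_simps)
    moreover have "(?f has_real_derivative 0) (at T)"
      by (rule has_field_derivative_transform_within_open[of "\<lambda>_. 0" _ _ "{a<..<b}"]) (use T 0 in auto)
    ultimately have "(J ?A T + T * ?A T) - T * ?A T + (J B T + (T + a) * B T) - 2 * (T * B T) = 0"
      by (rule DERIV_unique)
    moreover have "J (\<lambda>t. ?A t + B t) T = J ?A T + J B T"
      unfolding J_def using T
      by (intro integral_add integrable_continuous_interval continuous_on_subset[OF cont(1)] continuous_on_subset[OF B]) auto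
    ultimately show ?thesis by (simp add: algebra_simps)
  qed
  have "((\<lambda>T. J (\<lambda>t. ?A t + B t) T / (T - a)) has_real_derivative
      ((?A T + B T) * (T - a) - J (\<lambda>t. ?A t + B t) T * 1) / ((T - a) * (T - a))) (at T)"
    by (rule DERIV_divide[OF Jd[OF cont(4) T]]) (use T in \<open>auto intro!: derivative_eq_intros\<close>)
  moreover have "((?A T + B T) * (T - a) - J (\<lambda>t. ?A t + B t) T * 1) / ((T - a) * (T - a)) = \<Lambda> T"
  proof -
    have "T - a \<noteq> 0" using T by simp
    then show ?thesis unfolding 1[OF T] by (simp add: divide_simps) (simp add: algebra_simps)
  qed
  ultimately have "((\<lambda>T. J (\<lambda>t. ?A t + B t) T / (T - a)) has_real_derivative \<Lambda> T) (at T)" by simp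
  then show ?thesis
    by (rule has_field_derivative_transform_within_open[of _ _ _ "{a<..<b}"]) (use T 1 in auto)
qed

text \<open>The test function \<open>T - t\<close> does not vanish at \<open>a\<close>.
  Differentiation in \<open>T\<close> identifies \<open>B T\<close> with the integral of \<Lambda>
  over \<open>{a..T}\<close>, and \<open>T\<close> tends to \<open>a\<close>.\<close>

lemma natural_boundary:
  fixes B \<Lambda> :: "real \<Rightarrow> real"
  assumes ab: "a < b" and B: "continuous_on {a..b} B" and \<Lambda>: "continuous_on {a..b} \<Lambda>"
    and I: "\<And>T. T \<in> {a<..b} \<Longrightarrow> integral {a..T} (\<lambda>t. (T - t) * \<Lambda> t - B t) = 0"
  shows "B a = 0"
proof -
  define J where "J f T = integral {a..T} f" for f :: "real \<Rightarrow> real" and T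
  have Jd: "((J f) has_real_derivative f T) (at T)" if "continuous_on {a..b} f" "T \<in> {a<..<b}" for f T
    using integral_has_real_derivative[OF that(1), of T] that(2)
    by (simp add: J_def[abs_def] at_within_Icc_at)
  have cont: "continuous_on {a..b} (\<lambda>t. t * \<Lambda> t)"
    using \<Lambda> by (auto intro!: continuous_intros)
  have 1: "J \<Lambda> T - B T = 0" if T: "T \<in> {a<..<b}" for T
  proof -
    let ?f = "\<lambda>T. T * J \<Lambda> T - J (\<lambda>t. t * \<Lambda> t) T - J B T"
    have 0: "?f T = 0" if T: "T \<in> {a<..<b}" for T
    proof -
      have sub: "{a..T} \<subseteq> {a..b}" using T by auto
      have int: "f integrable_on {a..T}" if "continuous_on {a..b} f" for f :: "real \<Rightarrow> real"
        by (intro integrable_continuous_interval continuous_on_subset[OF that sub])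
      have "((\<lambda>t. T * \<Lambda> t - t * \<Lambda> t - B t) has_integral ?f T) {a..T}"
        unfolding J_def
        by (intro has_integral_add has_integral_diff has_integral_mult_right integrable_integral int cont B \<Lambda>)
      then have "?f T = integral {a..T} (\<lambda>t. T * \<Lambda> t - t * \<Lambda> t - B t)"
        by (simp add: integral_unique)
      also have "\<dots> = integral {a..T} (\<lambda>t. (T - t) * \<Lambda> t - B t)"
        by (rule arg_cong[where f = "integral {a..T}"]) (auto simp: algebra_simps)
      also have "\<dots> = 0" using T by (intro I) auto
      finally show ?thesis .
    qed
    have "(?f has_real_derivative (J \<Lambda> T + T * \<Lambda> T) - T * \<Lambda> T - B T) (at T)"
      by (rule derivative_eq_intros Jd[OF cont(1) T] Jd[OF \<Lambda> T] Jd[OF B T] refl)+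
        (simp add: algebra_simps)
    moreover have "(?f has_real_derivative 0) (at T)"
      by (rule has_field_derivative_transform_within_open[of "\<lambda>_. 0" _ _ "{a<..<b}"]) (use T 0 in auto)
    ultimately have "(J \<Lambda> T + T * \<Lambda> T) - T * \<Lambda> T - B T = 0" by (rule DERIV_unique)
    then show ?thesis by simp
  qed
  have "continuous_on (closure {a<..<b}) (\<lambda>T. J \<Lambda> T - B T)"
    unfolding J_def using ab
    by (auto intro!: continuous_intros B indefinite_integral_continuous_1 integrable_continuous_interval \<Lambda>)
  from continuous_constant_on_closure[OF this 1, of a] have "J \<Lambda> a - B a = 0" using ab by simp
  then show ?thesis by (simp add: J_def)
qed

context finsler
begin

text \<open>\<open>variation\<close> asks for strips over all of \<open>{a..b}\<close>. One strip
  carries the motion up to \<open>T\<close>; the others come from a partition for \<gamma> on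
  \<open>{T..b}\<close>, where the variation is constant in \<open>s\<close>.\<close>

lemma variation_prefix:
  assumes pw: "pw_smooth_curve A \<gamma> a b" and T: "a < T" "T < b" and \<epsilon>: "\<epsilon> > 0"
    and H0: "\<And>t. t \<in> {a..b} \<Longrightarrow> H 0 t = \<gamma> t"
    and H1: "smooth_map_on A ({-\<epsilon><..<\<epsilon>} \<times> {a..T}) (\<lambda>(s, t). H s t)"
    and H2: "\<And>s t. s \<in> {-\<epsilon><..<\<epsilon>} \<Longrightarrow> T \<le> t \<Longrightarrow> t \<le> b \<Longrightarrow> H s t = \<gamma> t"
  shows "variation A \<gamma> a b \<epsilon> H"
proof -
  have "pw_smooth_curve A \<gamma> T b" using pw_smooth_sub[OF pw, of T b] T by simp
  then obtain n t where t: "t 0 = T" "t n = b"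
      "\<forall>i<n. t i < t (Suc i) \<and> smooth_map_on A {t i..t (Suc i)} \<gamma>"
    by (auto simp: pw_smooth_curve_def)
  have mono: "i \<le> n \<Longrightarrow> T \<le> t i" for i
  proof (induction i)
    case (Suc i)
    then have "t i < t (Suc i)" using t(3) by simp
    then show ?case using Suc by simp
  qed (use t in auto)
  have mono': "i \<le> n \<Longrightarrow> t (n - i) \<le> b" for i
  proof (induction i)
    case (Suc i)
    then have "t (n - Suc i) < t (Suc (n - Suc i))" using t(3) by auto
    moreover have "Suc (n - Suc i) = n - i" using Suc by simp
    ultimately show ?case using Suc by simp
  qed (use t in auto)
  define t' where "t' i = (case i of 0 \<Rightarrow> a | Suc j \<Rightarrow> t j)" for i
  have "t' i < t' (Suc i) \<and> smooth_map_on A ({-\<epsilon><..<\<epsilon>} \<times> {t' i..t' (Suc i)}) (\<lambda>(s, t). H s t)"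
    if i: "i < Suc n" for i
  proof (cases i)
    case 0
    then show ?thesis using t T H1 by (simp add: t'_def)
  next
    case (Suc j)
    then have j: "j < n" using i by simp
    have sm: "smooth_map_on A {t j..t (Suc j)} \<gamma>" using t(3) j by simp
    have le: "T \<le> t j" "t (Suc j) \<le> b" using mono[of j] mono'[of "n - Suc j"] j by auto
    have "smooth_map_on A ({-\<epsilon><..<\<epsilon>} \<times> {t j..t (Suc j)}) (\<lambda>p. \<gamma> (snd p))"
      unfolding smooth_map_on_def
    proof
      fix p :: "real \<times> real" assume p: "p \<in> {-\<epsilon><..<\<epsilon>} \<times> {t j..t (Suc j)}"
      then obtain c W g where c: "c \<in> A" "open W" "snd p \<in> W" "\<gamma> ` ({t j..t (Suc j)} \<inter> W) \<subseteq> chart_dom c"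
          "smooth_on W g" "\<forall>y\<in>{t j..t (Suc j)} \<inter> W. chart_map c (\<gamma> y) = g y"
        using sm unfolding smooth_map_on_def by (metis mem_Times_iff)
      have oW: "open (UNIV \<times> W :: (real \<times> real) set)" using c(2) by (simp add: open_Times)
      have "smooth_on (UNIV \<times> W) (\<lambda>p :: real \<times> real. g (snd p))"
        by (rule smooth_on_compose[OF oW c(2) _ c(5)])
          (auto intro: smooth_on_bounded_linear oW bounded_linear_snd)
      then show "\<exists>c\<in>A. \<exists>W g. open W \<and> p \<in> W \<and>
          (\<lambda>p. \<gamma> (snd p)) ` (({-\<epsilon><..<\<epsilon>} \<times> {t j..t (Suc j)}) \<inter> W) \<subseteq> chart_dom c \<and> smooth_on W g \<and>
          (\<forall>y\<in>({-\<epsilon><..<\<epsilon>} \<times> {t j..t (Suc j)}) \<inter> W. chart_map c (\<gamma> (snd y)) = g y)"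
        using c oW by (intro bexI[OF _ c(1)] exI[of _ "UNIV \<times> W"] exI[of _ "\<lambda>p. g (snd p)"]) (auto simp: mem_Times_iff)
    qed
    then have "smooth_map_on A ({-\<epsilon><..<\<epsilon>} \<times> {t j..t (Suc j)}) (\<lambda>(s, t). H s t)"
      by (rule smooth_map_on_cong) (use H2 le in auto)
    then show ?thesis using t(3) j Suc by (simp add: t'_def)
  qed
  moreover have "t' 0 = a" "t' (Suc n) = b" using t by (simp_all add: t'_def)
  ultimately show ?thesis
    unfolding variation_def using \<epsilon> H0 by blast
qed

text \<open>The curve is moved to \<open>x t + s *\<^sub>R \<eta> t\<close> in the slice chart up to
  time \<open>T\<close> and left alone afterwards. The start stays on \<open>N\<close> because
  \<open>N\<close> is linear in this chart and \<open>\<eta> a \<in> V\<close>. The integral is the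
  derivative of the energy, computed by differentiation under the integral.\<close>

lemma first_variation:
  assumes c: "c \<in> A" and NV: "chart_map c ` (chart_dom c \<inter> N) = chart_cod c \<inter> V" and V: "subspace V"
    and geo: "N_geodesic A F N \<gamma> a b" and us: "unit_speed A F \<gamma> a b"
    and W: "open W" "{a..T} \<subseteq> W" "smooth_on W x" and T: "a < T" "T < b"
    and \<gamma>x: "\<And>t. t \<in> {a..T} \<Longrightarrow> \<gamma> t \<in> chart_dom c \<and> chart_map c (\<gamma> t) = x t"
    and v: "\<And>t. v t = frechet_derivative x (at t) 1"
    and G1: "\<And>t. t \<in> {a..T} \<Longrightarrow> LE c (x t, v t) = 1"
    and \<eta>: "smooth_on UNIV \<eta>" "\<And>t. (\<eta> has_vector_derivative \<eta>' t) (at t)" "\<eta> a \<in> V" "\<eta> T = 0"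
  shows "integral {a..T} (\<lambda>t. local_finsler.Lx (LE c) (x t, v t) \<bullet> \<eta> t +
      local_finsler.Lv (LE c) (x t, v t) \<bullet> \<eta>' t) = 0"
proof -
  interpret lf: local_finsler "chart_cod c" "LE c" by (rule LE_local_finsler[OF c])
  have xC: "x t \<in> chart_cod c" if "t \<in> {a..T}" for t using \<gamma>x[OF that] map_cod by metis
  have v0: "v t \<noteq> 0" if "t \<in> {a..T}" for t using G1[OF that] lf.G_zero[OF xC[OF that]] by auto
  have \<eta>'_eq: "\<eta>' t = frechet_derivative \<eta> (at t) 1" for t
    using vector_derivative_at[OF \<eta>(2)[of t]] vector_derivative_at[OF smooth_on_vector_derivative[OF \<eta>(1)]] by simp
  have \<eta>'c: "continuous_on UNIV \<eta>'"
    using smooth_on_derivative_continuous[OF \<eta>(1)] by (simp add: \<eta>'_eq[symmetric])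
  have vc: "continuous_on W v"
    using smooth_on_derivative_continuous[OF W(3)] by (simp add: v)
  have xc: "continuous_on W x" by (rule smooth_on_continuous[OF W(3)])
  have \<eta>c: "continuous_on UNIV \<eta>" by (rule smooth_on_continuous[OF \<eta>(1)])
  define z where "z t = (x t, v t)" for t
  define d where "d t = (\<eta> t, \<eta>' t)" for t
  have zd: "continuous_on (UNIV \<times> W) (\<lambda>p. z (snd p) + fst p *\<^sub>R d (snd p))"
    unfolding z_def d_def
    by (intro continuous_intros continuous_on_compose2[OF xc] continuous_on_compose2[OF vc]
        continuous_on_compose2[OF \<eta>c] continuous_on_compose2[OF \<eta>'c]) auto
  define Q where "Q = (UNIV \<times> W) \<inter> (\<lambda>p. z (snd p) + fst p *\<^sub>R d (snd p)) -` lf.slit"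
  have oUW: "open (UNIV \<times> W :: (real \<times> real) set)" using W(1) by (simp add: open_Times)
  have oQ: "open Q" unfolding Q_def by (rule continuous_open_preimage[OF zd oUW lf.open_slit])
  have "{0} \<times> {a..T} \<subseteq> Q"
    using W(2) xC v0 by (auto simp: Q_def z_def lf.mem_slit)
  \<comment> \<open>Compactness of \<open>{a..T}\<close> yields one \<epsilon> for which all moved
    points stay in the chart and all moved velocities stay nonzero, so that \<open>L\<close> is
    differentiable there.\<close>
  from Elementary_Topology.tube_lemma[OF compact_Icc oQ this] obtain X where X: "0 \<in> X" "open X" "X \<times> {a..T} \<subseteq> Q" by blast
  then obtain \<epsilon> where \<epsilon>: "\<epsilon> > 0" "{-\<epsilon><..<\<epsilon>} \<subseteq> X"
    unfolding open_dist by (force simp: dist_real_def)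
  have slit: "z t + s *\<^sub>R d t \<in> lf.slit" if "s \<in> {-\<epsilon><..<\<epsilon>}" "t \<in> {a..T}" for s t
  proof -
    have "(s, t) \<in> Q" using X(3) \<epsilon>(2) that by blast
    then show ?thesis by (simp add: Q_def)
  qed
  have cod: "x t + s *\<^sub>R \<eta> t \<in> chart_cod c" if "s \<in> {-\<epsilon><..<\<epsilon>}" "t \<in> {a..T}" for s t
    using slit[OF that] by (simp add: z_def d_def lf.mem_slit)
  define H where "H s t = (if t \<le> T then chart_inv c (x t + s *\<^sub>R \<eta> t) else \<gamma> t)" for s t
  have H_chart: "H s t \<in> chart_dom c" "chart_map c (H s t) = x t + s *\<^sub>R \<eta> t"
    if "s \<in> {-\<epsilon><..<\<epsilon>}" "t \<in> {a..T}" for s t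
    using cod[OF that] that c by (auto simp: H_def inv_dom map_inv)
  have inv_x: "chart_inv c (x t) = \<gamma> t" if "t \<in> {a..T}" for t
    using \<gamma>x[OF that] inv_map[OF c] by metis
  have pw: "pw_smooth_curve A \<gamma> a b" using geo by (simp add: N_geodesic_def)
  have var: "variation A \<gamma> a b \<epsilon> H"
  proof (rule variation_prefix[OF pw T \<epsilon>(1)])
    show "H 0 t = \<gamma> t" if "t \<in> {a..b}" for t using that inv_x by (simp add: H_def)
    show "smooth_map_on A ({-\<epsilon><..<\<epsilon>} \<times> {a..T}) (\<lambda>(s, t). H s t)"
    proof (rule smooth_map_on_chartI[OF c oUW])
      have "smooth_on (UNIV \<times> W) (\<lambda>p :: real \<times> real. x (snd p))"
        by (rule smooth_on_compose[OF oUW W(1) _ W(3)])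
          (auto intro: smooth_on_bounded_linear oUW bounded_linear_snd)
      moreover have "smooth_on (UNIV \<times> W) (\<lambda>p :: real \<times> real. \<eta> (snd p))"
        by (rule smooth_on_compose[OF oUW open_UNIV _ \<eta>(1)])
          (auto intro: smooth_on_bounded_linear oUW bounded_linear_snd)
      ultimately show "smooth_on (UNIV \<times> W) (\<lambda>p :: real \<times> real. x (snd p) + fst p *\<^sub>R \<eta> (snd p))"
        by (intro smooth_on_add oUW smooth_on_bilinear[OF oUW bounded_bilinear_scaleR]
            smooth_on_bounded_linear[OF oUW bounded_linear_fst])
    qed (use W(2) H_chart in auto)
    show "H s t = \<gamma> t" if "s \<in> {-\<epsilon><..<\<epsilon>}" "T \<le> t" "t \<le> b" for s t
      using that \<eta>(4) inv_x[of T] T by (cases "t = T") (auto simp: H_def)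
  qed
  have "H s a \<in> N \<and> H s b = \<gamma> b" if s: "s \<in> {-\<epsilon><..<\<epsilon>}" for s
  proof
    have aT: "a \<in> {a..T}" using T by simp
    have "\<gamma> a \<in> N" using geo by (simp add: N_geodesic_def)
    then have "chart_map c (\<gamma> a) \<in> chart_map c ` (chart_dom c \<inter> N)" using \<gamma>x[OF aT] by blast
    then have "x a \<in> V" using \<gamma>x[OF aT] NV by auto
    then have "x a + s *\<^sub>R \<eta> a \<in> chart_cod c \<inter> V"
      using cod[OF s aT] V \<eta>(3) by (simp add: subspace_add subspace_scale)
    then obtain p where "p \<in> chart_dom c" "p \<in> N" "x a + s *\<^sub>R \<eta> a = chart_map c p"
      unfolding NV[symmetric] by blast
    then show "H s a \<in> N" using T inv_map[OF c] by (simp add: H_def)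
    show "H s b = \<gamma> b" using T by (simp add: H_def)
  qed
  then have deriv0: "((\<lambda>s. curve_energy A F (H s) a b) has_real_derivative 0) (at 0)"
    using geo var unfolding N_geodesic_def by blast
  define \<phi> where "\<phi> s = integral (cbox a T) (\<lambda>t. lf.L (z t + s *\<^sub>R d t))" for s
  have zd': "continuous_on ({-\<epsilon><..<\<epsilon>} \<times> {a..T}) (\<lambda>p. z (snd p) + fst p *\<^sub>R d (snd p))"
    by (rule continuous_on_subset[OF zd]) (use W(2) in auto)
  have Lc: "continuous_on lf.slit lf.L"
    by (rule continuous_on_subset[OF lf.L_cont]) (auto simp: lf.slit_def)
  have Li: "continuous_on {a..T} (\<lambda>t. lf.L (z t + s *\<^sub>R d t))" if s: "s \<in> {-\<epsilon><..<\<epsilon>}" for s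
  proof (rule continuous_on_compose2[OF Lc])
    show "continuous_on {a..T} (\<lambda>t. z t + s *\<^sub>R d t)"
      by (rule continuous_on_compose2[OF zd', of _ "\<lambda>t. (s, t)", simplified])
        (use s in \<open>auto intro!: continuous_intros\<close>)
  qed (use slit[OF s] in auto)
  have "(\<phi> has_real_derivative integral (cbox a T) (\<lambda>t. lf.DL (z t + 0 *\<^sub>R d t) (d t))) (at 0 within {-\<epsilon><..<\<epsilon>})"
    unfolding \<phi>_def
  proof (rule leibniz_rule_field_derivative[where fx = "\<lambda>s t. lf.DL (z t + s *\<^sub>R d t) (d t)"])
    show "((\<lambda>s. lf.L (z t + s *\<^sub>R d t)) has_real_derivative lf.DL (z t + s *\<^sub>R d t) (d t)) (at s within {-\<epsilon><..<\<epsilon>})"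
      if "s \<in> {-\<epsilon><..<\<epsilon>}" "t \<in> cbox a T" for s t
      using lf.L_line[OF slit] that has_field_derivative_at_within by (metis cbox_interval)
    show "(\<lambda>t. lf.L (z t + s *\<^sub>R d t)) integrable_on cbox a T" if "s \<in> {-\<epsilon><..<\<epsilon>}" for s
      using integrable_continuous_interval[OF Li[OF that]] by simp
    have "continuous_on ({-\<epsilon><..<\<epsilon>} \<times> {a..T}) (\<lambda>p. d (snd p))"
      unfolding d_def
      by (intro continuous_intros continuous_on_compose2[OF \<eta>c] continuous_on_compose2[OF \<eta>'c]) auto
    then have "continuous_on ({-\<epsilon><..<\<epsilon>} \<times> {a..T}) (\<lambda>p. lf.DL (z (snd p) + fst p *\<^sub>R d (snd p)) (d (snd p)))"
      by (intro continuous_on_compose2[OF frechet_derivative_continuous[OF lf.L_Ck1],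
            of _ "\<lambda>p. (z (snd p) + fst p *\<^sub>R d (snd p), d (snd p))", simplified] continuous_on_Pair zd')
        (use slit in auto)
    then show "continuous_on ({-\<epsilon><..<\<epsilon>} \<times> cbox a T) (\<lambda>(s, t). lf.DL (z t + s *\<^sub>R d t) (d t))"
      by (simp add: case_prod_unfold)
  qed (use \<epsilon> in auto)
  then have \<phi>': "(\<phi> has_real_derivative integral {a..T} (\<lambda>t. lf.DL (z t) (d t))) (at 0)"
    using at_within_open[of 0 "{-\<epsilon><..<\<epsilon>}"] \<epsilon>(1) by simp
  \<comment> \<open>After \<open>T\<close> the curve is unchanged and has unit speed, which
    contributes the constant \<open>(b - T) / 2\<close>.\<close>
  have E: "curve_energy A F (H s) a b = \<phi> s + (b - T) / 2" if s: "s \<in> {-\<epsilon><..<\<epsilon>}" for s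
  proof -
    have sp1: "(speed (H s) t)\<^sup>2 = 2 * lf.L (z t + s *\<^sub>R d t)" if t: "t \<in> {a<..<T}" for t
    proof -
      have "((\<lambda>t. x t + s *\<^sub>R \<eta> t) has_vector_derivative v t + s *\<^sub>R \<eta>' t) (at t)"
      proof -
        have "t \<in> W" using W(2) t by auto
        then have "(x has_vector_derivative v t) (at t)"
          using smooth_on_vector_derivative[OF W(3)] by (simp add: v)
        then show ?thesis
          using has_vector_derivative_scaleR[OF DERIV_const[of s] \<eta>(2)[of t]]
          by (intro has_vector_derivative_add) simp_all
      qed
      then have "((\<lambda>t. chart_map c (H s t)) has_vector_derivative v t + s *\<^sub>R \<eta>' t) (at t)"
        by (rule has_vector_derivative_transform_within_open[of _ _ _ "{a<..<T}"])
          (use t H_chart(2)[OF s] in auto)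
      then have "velocity A UNIV (H s) t = tv c (H s t) (v t + s *\<^sub>R \<eta>' t)"
        by (intro velocity_chart[of _ _ _ _ _ "{a<..<T}"])
          (use c t H_chart(1)[OF s] in \<open>auto intro: vector_derivative_at\<close>)
      then have "speed (H s) t = LE c (x t + s *\<^sub>R \<eta> t, v t + s *\<^sub>R \<eta>' t)"
        using LE_map[OF c H_chart(1)[OF s]] H_chart(2)[OF s] t by (simp add: speed_def)
      then show ?thesis by (simp add: lf.L_def z_def d_def)
    qed
    have sp2: "(speed (H s) t)\<^sup>2 = 1" if t: "t \<in> {T<..<b}" for t
    proof -
      have "speed (H s) t = speed \<gamma> t"
        by (rule speed_cong[of "{T<..<b}"]) (use t in \<open>auto simp: H_def\<close>)
      also have "\<dots> = 1"
      proof -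
        have "t \<in> {a<..<b}" "t \<in> {a..b}" using t T by auto
        then show ?thesis
          using us velocity_interior[of t a b \<gamma>] unfolding unit_speed_def speed_def by metis
      qed
      finally show ?thesis by simp
    qed
    have "((\<lambda>t. 2 * lf.L (z t + s *\<^sub>R d t)) has_integral 2 * \<phi> s) {a..T}"
      unfolding \<phi>_def cbox_interval
      by (intro has_integral_mult_right integrable_integral integrable_continuous_interval Li s)
    then have 1: "((\<lambda>t. (speed (H s) t)\<^sup>2) has_integral 2 * \<phi> s) {a..T}"
      by (rule has_integral_spike_finite[of "{a, T}", rotated 2]) (use sp1 in auto)
    have "((\<lambda>t. 1 :: real) has_integral (b - T)) {T..b}"
      using has_integral_const_real[of "1 :: real" T b] T by simp
    then have 2: "((\<lambda>t. (speed (H s) t)\<^sup>2) has_integral (b - T)) {T..b}"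
      by (rule has_integral_spike_finite[of "{T, b}", rotated 2]) (use sp2 in auto)
    have "((\<lambda>t. (speed (H s) t)\<^sup>2) has_integral (2 * \<phi> s + (b - T))) {a..b}"
      by (rule has_integral_combine[OF _ _ 1 2]) (use T in auto)
    then show ?thesis by (simp add: curve_energy_speed integral_unique)
  qed
  have "((\<lambda>s. \<phi> s + (b - T) / 2) has_real_derivative 0) (at 0)"
    by (rule has_field_derivative_transform_within_open[OF deriv0, of "{-\<epsilon><..<\<epsilon>}"]) (use \<epsilon> E in auto)
  moreover have "((\<lambda>s. \<phi> s + (b - T) / 2) has_real_derivative integral {a..T} (\<lambda>t. lf.DL (z t) (d t)) + 0) (at 0)"
    by (rule DERIV_add[OF \<phi>' DERIV_const])
  ultimately have "integral {a..T} (\<lambda>t. lf.DL (z t) (d t)) = 0"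
    using DERIV_unique by fastforce
  moreover have "integral {a..T} (\<lambda>t. lf.DL (z t) (d t)) =
      integral {a..T} (\<lambda>t. lf.Lx (x t, v t) \<bullet> \<eta> t + lf.Lv (x t, v t) \<bullet> \<eta>' t)"
    by (rule integral_cong) (use xC v0 in \<open>auto simp: z_def d_def lf.DL_eq lf.mem_slit\<close>)
  ultimately show ?thesis by simp
qed

text \<open>Scalar test functions times a fixed vector \<open>e\<close> reduce everything to
  real-valued identities. Those vanishing at both ends give the differential equation of the
  momentum for every \<open>e\<close>; the one that does not vanish at \<open>a\<close> is
  admissible for \<open>e \<in> V\<close> and gives the orthogonality.\<close>

lemma euler_lagrange:
  assumes c: "c \<in> A" and NV: "chart_map c ` (chart_dom c \<inter> N) = chart_cod c \<inter> V" and V: "subspace V"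
    and geo: "N_geodesic A F N \<gamma> a b" and us: "unit_speed A F \<gamma> a b" and ac: "\<gamma> a \<in> chart_dom c"
  obtains b1 x v where "a < b1" "b1 < b" "continuous_on {a..b1} x" "continuous_on {a..b1} v"
    "\<And>t. t \<in> {a..b1} \<Longrightarrow> \<gamma> t \<in> chart_dom c \<and> chart_map c (\<gamma> t) = x t"
    "\<And>t. t \<in> {a..b1} \<Longrightarrow> LE c (x t, v t) = 1"
    "\<And>t. t \<in> {a<..<b1} \<Longrightarrow> (x has_vector_derivative v t) (at t)"
    "\<And>t. t \<in> {a<..<b1} \<Longrightarrow> ((\<lambda>t. local_finsler.Lv (LE c) (x t, v t)) has_vector_derivative
        local_finsler.Lx (LE c) (x t, v t)) (at t)"
    "\<And>e. e \<in> V \<Longrightarrow> local_finsler.Lv (LE c) (x a, v a) \<bullet> e = 0"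
proof -
  interpret lf: local_finsler "chart_cod c" "LE c" by (rule LE_local_finsler[OF c])
  have pw: "pw_smooth_curve A \<gamma> a b" using geo by (simp add: N_geodesic_def)
  obtain t1 where t1: "a < t1" "smooth_map_on A {a..t1} \<gamma>"
  proof -
    obtain n t where t: "t 0 = a" "t n = b" "\<forall>i<n. t i < t (Suc i) \<and> smooth_map_on A {t i..t (Suc i)} \<gamma>"
      and ab: "a < b"
      using pw by (auto simp: pw_smooth_curve_def)
    then have "n \<noteq> 0" by (metis less_irrefl)
    then show ?thesis using t that[of "t (Suc 0)"] by auto
  qed
  obtain W x where W: "open W" "a \<in> W" "smooth_on W x"
    "\<And>t. t \<in> {a..t1} \<Longrightarrow> t \<in> W \<Longrightarrow> \<gamma> t \<in> chart_dom c \<and> chart_map c (\<gamma> t) = x t"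
    using smooth_map_on_chart[OF t1(2) _ c ac] t1(1) by (metis atLeastAtMost_iff less_eq_real_def)
  obtain e where e: "e > 0" "ball a e \<subseteq> W" using W(1,2) open_contains_ball by blast
  \<comment> \<open>The interval ends before the first break point, inside the domain of the smooth
    extension \<open>x\<close>, and strictly before \<open>b\<close>, as variations up to
    \<open>T \<le> b1\<close> require \<open>T < b\<close>.\<close>
  define b1 where "b1 = Min {a + e / 2, t1, (a + b) / 2}"
  have b1: "a < b1" "b1 < b" "b1 \<le> t1" "b1 < a + e"
    using e(1) t1(1) pw_smooth_less[OF pw] by (auto simp: b1_def min_def)
  have sub: "{a..b1} \<subseteq> W" using e(2) b1(4) by (auto simp: dist_real_def subset_iff)
  define v where "v t = frechet_derivative x (at t) 1" for t
  have xc: "continuous_on {a..b1} x" by (rule continuous_on_subset[OF smooth_on_continuous[OF W(3)] sub])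
  have vc: "continuous_on {a..b1} v" unfolding v_def
    by (rule continuous_on_subset[OF smooth_on_derivative_continuous[OF W(3)] sub])
  have \<gamma>x: "\<gamma> t \<in> chart_dom c \<and> chart_map c (\<gamma> t) = x t" if "t \<in> {a..b1}" for t
    using W(4)[of t] that sub b1(3) by auto
  have xv: "(x has_vector_derivative v t) (at t)" if "t \<in> {a..b1}" for t
    using smooth_on_vector_derivative[OF W(3)] sub that by (auto simp: v_def)
  have xC: "x t \<in> chart_cod c" if "t \<in> {a..b1}" for t using \<gamma>x[OF that] map_cod by metis
  have G1': "LE c (x t, v t) = 1" if t: "t \<in> {a<..<b1}" for t
  proof -
    have tI: "t \<in> {a..b1}" "t \<in> {a<..<b}" using t b1 by auto
    have "((\<lambda>t. chart_map c (\<gamma> t)) has_vector_derivative v t) (at t)"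
      by (rule has_vector_derivative_transform_within_open[OF xv[OF tI(1)], of "{a<..<b1}"])
        (use t \<gamma>x in auto)
    then have "velocity A UNIV \<gamma> t = tv c (\<gamma> t) (v t)"
      by (intro velocity_chart[of _ _ _ _ _ "{a<..<b1}"])
        (use c t \<gamma>x in \<open>auto intro: vector_derivative_at\<close>)
    moreover have "F (\<gamma> t) (velocity A {a..b} \<gamma> t) = 1"
      using us tI(2) by (simp add: unit_speed_def)
    ultimately show ?thesis
      using LE_map[OF c, of "\<gamma> t"] \<gamma>x[OF tI(1)] velocity_interior[OF tI(2)] by metis
  qed
  \<comment> \<open>At interior times the one-sided and two-sided velocities agree; the end points
    follow by continuity.\<close>
  have G1: "LE c (x t, v t) = 1" if t: "t \<in> {a..b1}" for t
  proof -
    have cl: "closure {a<..<b1} = {a..b1}" using b1 by simp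
    have "continuous_on (closure {a<..<b1}) (\<lambda>t. LE c (x t, v t))" unfolding cl
      by (rule continuous_on_compose2[OF lf.G_cont continuous_on_Pair[OF xc vc]]) (use xC in auto)
    from continuous_constant_on_closure[OF this G1', of t] show ?thesis using t cl by simp
  qed
  have slit: "(x t, v t) \<in> lf.slit" if "t \<in> {a..b1}" for t
    using G1[OF that] lf.G_zero[OF xC[OF that]] xC[OF that] by (auto simp: lf.mem_slit)
  define X P where "X t = lf.Lx (x t, v t)" and "P t = lf.Lv (x t, v t)" for t
  have XPc: "continuous_on {a..b1} X" "continuous_on {a..b1} P"
  proof -
    have im: "(\<lambda>t. (x t, v t)) ` {a..b1} \<subseteq> lf.slit" using slit by blast
    show "continuous_on {a..b1} X" unfolding X_def
      by (rule continuous_on_compose2[OF lf.Lx_cont continuous_on_Pair[OF xc vc] im])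
    show "continuous_on {a..b1} P" unfolding P_def
      by (rule continuous_on_compose2[OF lf.Lv_cont continuous_on_Pair[OF xc vc] im])
  qed
  have fv: "integral {a..T} (\<lambda>t. X t \<bullet> (p t *\<^sub>R e) + P t \<bullet> (p' t *\<^sub>R e)) = 0"
    if T: "T \<in> {a<..b1}" and p: "smooth_on UNIV p" "\<And>t. (p has_real_derivative p' t) (at t)" "p T = 0"
      and e: "p a *\<^sub>R e \<in> V" for T p p' e
    unfolding X_def P_def
  proof (rule first_variation[OF c NV V geo us W(1) _ W(3) _ _ _ v_def])
    show "smooth_on UNIV (\<lambda>t. p t *\<^sub>R e)"
      by (rule smooth_on_bilinear[OF open_UNIV bounded_bilinear_scaleR p(1)]) (simp add: smooth_on_const)
    show "((\<lambda>t. p t *\<^sub>R e) has_vector_derivative p' t *\<^sub>R e) (at t)" for t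
      using has_vector_derivative_scaleR[OF p(2)[of t] has_vector_derivative_const[of e]] by simp
  qed (use T sub b1 \<gamma>x G1 p(3) e in auto)
  have lin: "smooth_on UNIV (\<lambda>t :: real. T - t)" "smooth_on UNIV (\<lambda>t :: real. t - T)" for T
    using smooth_on_add[OF open_UNIV smooth_on_const[OF open_UNIV, of T]
        smooth_on_bounded_linear[OF open_UNIV bounded_linear_minus[OF bounded_linear_ident]]]
      smooth_on_add[OF open_UNIV smooth_on_bounded_linear[OF open_UNIV bounded_linear_ident]
        smooth_on_const[OF open_UNIV, of "- T"]] by simp_all
  have EL: "((\<lambda>t. P t \<bullet> e) has_real_derivative X T \<bullet> e) (at T)" if T: "T \<in> {a<..<b1}" for T e
  proof (rule du_bois_reymond[OF _ _ _ T])
    fix T assume T: "T \<in> {a<..b1}"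
    have "integral {a..T} (\<lambda>t. X t \<bullet> (((t - a) * (T - t)) *\<^sub>R e) + P t \<bullet> ((T + a - 2 * t) *\<^sub>R e)) = 0"
    proof (rule fv[OF T])
      show "smooth_on UNIV (\<lambda>t. (t - a) * (T - t))"
        by (rule smooth_on_bilinear[OF open_UNIV bounded_bilinear_mult lin(2,1)])
      show "((\<lambda>t. (t - a) * (T - t)) has_real_derivative T + a - 2 * t) (at t)" for t
        by (auto intro!: derivative_eq_intros)
    qed (use V in \<open>auto simp: subspace_0\<close>)
    then show "integral {a..T} (\<lambda>t. (t - a) * (T - t) * (X t \<bullet> e) + (T + a - 2 * t) * (P t \<bullet> e)) = 0"
      by simp
  qed (intro continuous_intros XPc)+
  have orth: "P a \<bullet> e = 0" if e: "e \<in> V" for e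
  proof (rule natural_boundary[OF b1(1)])
    fix T assume T: "T \<in> {a<..b1}"
    have "integral {a..T} (\<lambda>t. X t \<bullet> ((T - t) *\<^sub>R e) + P t \<bullet> ((- 1) *\<^sub>R e)) = 0"
    proof (rule fv[OF T lin(1)])
      show "((\<lambda>t. T - t) has_real_derivative - 1) (at t)" for t
        by (auto intro!: derivative_eq_intros)
    qed (use V e in \<open>auto intro: subspace_scale\<close>)
    then show "integral {a..T} (\<lambda>t. (T - t) * (X t \<bullet> e) - P t \<bullet> e) = 0"
      by simp
  qed (intro continuous_intros XPc)+
  show ?thesis
  proof (rule that[OF b1(1,2) xc vc \<gamma>x G1])
    show "(x has_vector_derivative v t) (at t)" if "t \<in> {a<..<b1}" for t using xv that by simp
    show "((\<lambda>t. lf.Lv (x t, v t)) has_vector_derivative lf.Lx (x t, v t)) (at t)" if "t \<in> {a<..<b1}" for t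
      using EL[OF that] unfolding has_vector_derivative_def P_def X_def has_field_derivative_def
      by (subst has_derivative_componentwise_within) (simp add: mult_commute_abs)
  qed (use orth in \<open>auto simp: P_def\<close>)
qed

end

section \<open>Lengths of curves\<close>

context finsler
begin

lemma curve_length_add:
  assumes "pw_smooth_curve A \<gamma> a c" "a \<le> b" "b \<le> c"
  shows "curve_length A F \<gamma> a c = curve_length A F \<gamma> a b + curve_length A F \<gamma> b c"
  unfolding curve_length_speed
  by (rule Henstock_Kurzweil_Integration.integral_combine[symmetric, OF assms(2,3) speed_integrable[OF assms(1)]])

lemma curve_in_chart:
  assumes c: "c \<in> A" and pw: "pw_smooth_curve A \<sigma> p q" and dom: "\<And>t. t \<in> {p..q} \<Longrightarrow> \<sigma> t \<in> chart_dom c"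
  obtains S y' where "finite S" "continuous_on {p..q} (\<lambda>t. chart_map c (\<sigma> t))"
    "\<And>t. t \<in> {p<..<q} - S \<Longrightarrow> ((\<lambda>t. chart_map c (\<sigma> t)) has_vector_derivative y' t) (at t)"
    "\<And>t. t \<in> {p<..<q} - S \<Longrightarrow> speed \<sigma> t = LE c (chart_map c (\<sigma> t), y' t)"
    "\<And>t. t \<in> {p<..<q} - S \<Longrightarrow> isCont (speed \<sigma>) t"
proof -
  obtain S where S: "finite S" "\<And>t. t \<in> {p<..<q} - S \<Longrightarrow> \<exists>W. open W \<and> t \<in> W \<and> smooth_map_on A W \<sigma>"
    using pw_smooth_regular[OF pw] by metis
  have "\<exists>y. ((\<lambda>t. chart_map c (\<sigma> t)) has_vector_derivative y) (at t) \<and>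
      speed \<sigma> t = LE c (chart_map c (\<sigma> t), y) \<and> isCont (speed \<sigma>) t" if t: "t \<in> {p<..<q} - S" for t
  proof -
    obtain W where W: "open W" "t \<in> W" "smooth_map_on A W \<sigma>" using S(2)[OF t] by metis
    have "\<sigma> t \<in> chart_dom c" using t dom by auto
    from speed_chart[OF W(3,1,2) c this] obtain W' g where "t \<in> W'"
      "\<And>s. s \<in> W' \<Longrightarrow> \<sigma> s \<in> chart_dom c \<and> chart_map c (\<sigma> s) = g s"
      "\<And>s. s \<in> W' \<Longrightarrow> ((\<lambda>s. chart_map c (\<sigma> s)) has_vector_derivative frechet_derivative g (at s) 1) (at s)"
      "\<And>s. s \<in> W' \<Longrightarrow> speed \<sigma> s = LE c (g s, frechet_derivative g (at s) 1)" by metis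
    then show ?thesis using speed_isCont[OF W(3,1,2)] by metis
  qed
  then obtain y' where "\<And>t. t \<in> {p<..<q} - S \<Longrightarrow> ((\<lambda>t. chart_map c (\<sigma> t)) has_vector_derivative y' t) (at t) \<and>
      speed \<sigma> t = LE c (chart_map c (\<sigma> t), y' t) \<and> isCont (speed \<sigma>) t" by metis
  moreover have "continuous_on {p..q} (\<lambda>t. chart_map c (\<sigma> t))"
    by (rule continuous_on_compose2[OF cont_map[OF c] pw_smooth_continuous[OF pw]]) (use dom in auto)
  ultimately show ?thesis using that[OF S(1)] by metis
qed

lemma speed_const: "speed (\<lambda>_. q) t = 0" and pw_smooth_const: "a < b \<Longrightarrow> pw_smooth_curve A (\<lambda>_. q) a b"
proof -
  obtain c where c: "c \<in> A" "q \<in> chart_dom c" by (rule chart_exists)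
  have "velocity A UNIV (\<lambda>_. q) t = tv c q 0"
    by (rule velocity_chart[of _ _ _ _ _ UNIV]) (use c in \<open>auto intro: vector_derivative_at\<close>)
  then show "speed (\<lambda>_. q) t = 0"
    using LE_map[OF c] local_finsler.G_zero[OF LE_local_finsler[OF c(1)] map_cod[OF c(2)]]
    by (simp add: speed_def)
  show "pw_smooth_curve A (\<lambda>_. q) a b" if "a < b"
    by (rule pw_smooth_piece[OF that], rule smooth_map_on_chartI[OF c(1) open_UNIV])
      (auto simp: c intro: smooth_on_const)
qed

lemma dist_from_le:
  "pw_smooth_curve A \<gamma> a b \<Longrightarrow> \<gamma> a \<in> N \<Longrightarrow> dist_from A F N (\<gamma> b) \<le> ereal (curve_length A F \<gamma> a b)"
  unfolding dist_from_def by (rule Inf_lower) blast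

text \<open>The constant curve has length 0. Equality cannot be claimed here, because curves of
  negative length may exist when \<open>F\<close> takes negative values.\<close>

lemma dist_from_nonpos: "q \<in> N \<Longrightarrow> dist_from A F N q \<le> 0"
proof -
  have "speed (\<lambda>_. q) = (\<lambda>_. 0)" by (simp add: fun_eq_iff speed_const)
  then show "q \<in> N \<Longrightarrow> dist_from A F N q \<le> 0"
    using dist_from_le[OF pw_smooth_const[of 0 1 q]] by (simp add: curve_length_speed zero_ereal_def)
qed


section \<open>Positive metrics\<close>

definition positive_at :: "'m \<Rightarrow> bool" where
  "positive_at p \<longleftrightarrow> (\<forall>c\<in>A. p \<in> chart_dom c \<longrightarrow> (\<forall>u. u \<noteq> 0 \<longrightarrow> LE c (chart_map c p, u) > 0))"

lemma positive_LE:
  assumes "positive_at (chart_inv c x)" "c \<in> A" "x \<in> chart_cod c"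
  shows "u \<noteq> 0 \<Longrightarrow> LE c (x, u) > 0" and "LE c (x, u) \<ge> 0"
proof -
  show 1: "u \<noteq> 0 \<Longrightarrow> LE c (x, u) > 0" for u
    using assms by (auto simp: positive_at_def inv_dom map_inv)
  show "LE c (x, u) \<ge> 0"
    using 1[of u] local_finsler.G_zero[OF LE_local_finsler[OF assms(2)] assms(3)]
    by (cases "u = 0") auto
qed

lemma speed_nonneg:
  assumes pos: "\<And>p. positive_at p" and "smooth_map_on A W \<gamma>" "open W" "t \<in> W"
  shows "speed \<gamma> t \<ge> 0"
proof -
  obtain c where c: "c \<in> A" "\<gamma> t \<in> chart_dom c" by (rule chart_exists)
  obtain W' g where "t \<in> W'" 
    "\<And>s. s \<in> W' \<Longrightarrow> \<gamma> s \<in> chart_dom c \<and> chart_map c (\<gamma> s) = g s"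
    "\<And>s. s \<in> W' \<Longrightarrow> speed \<gamma> s = LE c (g s, frechet_derivative g (at s) 1)"
    using speed_chart[OF assms(2-4) c] by metis
  then show ?thesis
    using positive_LE(2)[OF pos c(1)] map_cod[OF c(2)] by metis
qed

lemma curve_length_nonneg:
  assumes pos: "\<And>p. positive_at p" and pw: "pw_smooth_curve A \<gamma> a b"
  shows "curve_length A F \<gamma> a b \<ge> 0"
proof -
  obtain S where S: "finite S" "\<And>t. t \<in> {a<..<b} - S \<Longrightarrow> \<exists>W. open W \<and> t \<in> W \<and> smooth_map_on A W \<gamma>"
    using pw_smooth_regular[OF pw] by metis
  have "integral {a..b} (speed \<gamma>) = integral {a..b} (\<lambda>t. if t \<in> {a<..<b} - S then speed \<gamma> t else 0)"
    by (rule integral_spike[of "{a, b} \<union> S"]) (use S(1) in \<open>auto intro: negligible_finite\<close>)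
  also have "\<dots> \<ge> 0"
  proof (rule integral_nonneg)
    show "(\<lambda>t. if t \<in> {a<..<b} - S then speed \<gamma> t else 0) integrable_on {a..b}"
      by (rule integrable_spike[OF speed_integrable[OF pw], of "{a, b} \<union> S"])
        (use S(1) in \<open>auto intro: negligible_finite\<close>)
    show "0 \<le> (if t \<in> {a<..<b} - S then speed \<gamma> t else 0)" for t
      using S(2) speed_nonneg[OF pos] by auto
  qed
  finally show ?thesis by (simp add: curve_length_speed)
qed

text \<open>The minimum over the compact unit sphere bundle of a small closed ball is positive, and
  homogeneity extends the bound to all vectors.\<close>

lemma LE_lower_bound:
  assumes pos: "\<And>p. positive_at p" and c: "c \<in> A" and x0: "x0 \<in> chart_cod c"
  obtains r m where "r > 0" "m > 0" "cball x0 r \<subseteq> chart_cod c"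
    "\<And>x u. x \<in> cball x0 r \<Longrightarrow> LE c (x, u) \<ge> m * norm u"
proof -
  interpret lf: local_finsler "chart_cod c" "LE c" by (rule LE_local_finsler[OF c])
  obtain r where r: "r > 0" "cball x0 r \<subseteq> chart_cod c"
    using open_cod[OF c] x0 open_contains_cball by blast
  have "compact (cball x0 r \<times> sphere (0 :: 'e) 1)" by (intro compact_Times) auto
  moreover obtain e :: 'e where "e \<in> Basis" using nonempty_Basis by blast
  then have "cball x0 r \<times> sphere (0 :: 'e) 1 \<noteq> {}" using r(1) by force
  moreover have "continuous_on (cball x0 r \<times> sphere (0 :: 'e) 1) (LE c)"
    by (rule continuous_on_subset[OF lf.G_cont]) (use r in auto)
  ultimately obtain z where z: "z \<in> cball x0 r \<times> sphere (0 :: 'e) 1"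
      "\<And>y. y \<in> cball x0 r \<times> sphere (0 :: 'e) 1 \<Longrightarrow> LE c z \<le> LE c y"
    using continuous_attains_inf by metis
  have "LE c (fst z, snd z) > 0"
    using z(1) r(2) by (intro positive_LE(1)[OF pos c]) (auto simp: mem_Times_iff)
  moreover have "LE c (x, u) \<ge> LE c z * norm u" if x: "x \<in> cball x0 r" for x u
  proof (cases "u = 0")
    case True
    then show ?thesis using lf.G_zero[of x] x r(2) by auto
  next
    case False
    have "LE c (x, u) = LE c (x, norm u *\<^sub>R ((1 / norm u) *\<^sub>R u))" using False by simp
    also have "\<dots> = norm u * LE c (x, (1 / norm u) *\<^sub>R u)"
      using x r(2) False by (intro lf.G_hom) auto
    also have "\<dots> \<ge> norm u * LE c z"
      using z(2)[of "(x, (1 / norm u) *\<^sub>R u)"] x False by (intro mult_left_mono) auto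
    finally show ?thesis by (simp add: mult.commute)
  qed
  ultimately show ?thesis using that[OF r(1) _ r(2), of "LE c z"] by simp
qed

lemma length_lower_bound:
  assumes c: "c \<in> A" and pw: "pw_smooth_curve A \<sigma> p q"
    and dom: "\<And>t. t \<in> {p..q} \<Longrightarrow> \<sigma> t \<in> chart_dom c" and m: "m > 0"
    and bd: "\<And>t u. t \<in> {p..q} \<Longrightarrow> LE c (chart_map c (\<sigma> t), u) \<ge> m * norm u"
  shows "m * norm (chart_map c (\<sigma> q) - chart_map c (\<sigma> p)) \<le> curve_length A F \<sigma> p q"
proof -
  define y where "y t = chart_map c (\<sigma> t)" for t
  obtain S y' where S: "finite S" "continuous_on {p..q} y"
    "\<And>t. t \<in> {p<..<q} - S \<Longrightarrow> (y has_vector_derivative y' t) (at t)"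
    "\<And>t. t \<in> {p<..<q} - S \<Longrightarrow> speed \<sigma> t = LE c (y t, y' t)"
    using curve_in_chart[OF c pw dom] unfolding y_def by metis
  let ?on = "\<lambda>f t. if t \<in> {p<..<q} - S then f t else 0"
  have pq: "p \<le> q" using pw_smooth_less[OF pw] by simp
  have I: "(?on y' has_integral (y q - y p)) {p..q}"
    by (rule fundamental_theorem_of_calculus_interior_strong[OF S(1) pq _ S(2)]) (use S(3) in auto)
  have sp: "(?on (speed \<sigma>) has_integral curve_length A F \<sigma> p q) {p..q}"
    unfolding curve_length_speed
    by (rule has_integral_spike_finite[OF _ _ integrable_integral[OF speed_integrable[OF pw]], of "{p, q} \<union> S"])
      (use S(1) in auto)
  have "norm (integral {p..q} (?on y')) \<le> integral {p..q} (\<lambda>t. ?on (speed \<sigma>) t / m)"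
  proof (rule integral_norm_bound_integral)
    show "(\<lambda>t. ?on (speed \<sigma>) t / m) integrable_on {p..q}"
      using has_integral_divide[OF sp, of m] by blast
    fix t
    show "norm (?on y' t) \<le> ?on (speed \<sigma>) t / m"
      using bd[of t "y' t"] S(4)[of t] m by (auto simp: y_def field_simps)
  qed (use I in blast)
  also have "integral {p..q} (\<lambda>t. ?on (speed \<sigma>) t / m) = curve_length A F \<sigma> p q / m"
    using has_integral_divide[OF sp, of m] by (rule integral_unique)
  finally show ?thesis
    unfolding integral_unique[OF I] using m by (simp add: y_def field_simps)
qed

text \<open>\<open>\<tau>\<close> is the last time outside the open coordinate ball. The image of
  the closed ball is compact, hence closed in the Hausdorff space, so the curve is still in it at
  \<tau> and lies on its sphere.\<close>

lemma last_exit: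
  fixes \<sigma> :: "real \<Rightarrow> 'm"
  assumes c: "c \<in> A" and cb: "cball x0 r \<subseteq> chart_cod c" and r: "r > 0"
    and cont: "continuous_on {p..q} \<sigma>" and pq: "p < q"
    and inq: "\<sigma> q \<in> chart_inv c ` ball x0 r"
    and out: "\<exists>t\<in>{p..q}. \<sigma> t \<notin> chart_inv c ` ball x0 r"
  obtains \<tau> where "p \<le> \<tau>" "\<tau> < q" "dist x0 (chart_map c (\<sigma> \<tau>)) = r"
    "\<And>t. t \<in> {\<tau>..q} \<Longrightarrow> \<sigma> t \<in> chart_inv c ` cball x0 r"
proof -
  define B where "B = chart_inv c ` ball x0 r"
  define K where "K = chart_inv c ` cball x0 r"
  have BK: "B \<subseteq> K" by (auto simp: B_def K_def)
  have "compact K" unfolding K_def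
    by (rule compact_continuous_image[OF continuous_on_subset[OF cont_inv[OF c] cb] compact_cball])
  then have K: "closed K" by (rule compact_imp_closed)
  have B: "open B"
  proof -
    have "B = chart_dom c \<inter> chart_map c -` ball x0 r"
      using cb by (auto simp: B_def inv_dom[OF c] map_inv[OF c] subset_iff inv_map[OF c] less_imp_le
          intro!: image_eqI[of _ "chart_inv c" "chart_map c _"])
    then show ?thesis
      using continuous_open_preimage[OF cont_map[OF c] open_dom[OF c] open_ball] by simp
  qed
  define Z where "Z = {p..q} \<inter> \<sigma> -` (- B)"
  have "closed Z" unfolding Z_def
    by (rule continuous_closed_preimage[OF cont]) (use B in auto)
  then have "compact Z" unfolding Z_def by (metis Int_lower1 bounded_closed_interval bounded_subset compact_eq_bounded_closed)
  moreover have "Z \<noteq> {}" using out by (auto simp: Z_def B_def)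
  ultimately obtain \<tau> where \<tau>: "\<tau> \<in> Z" "\<And>t. t \<in> Z \<Longrightarrow> t \<le> \<tau>"
    using compact_attains_sup by metis
  have \<tau>q: "p \<le> \<tau>" "\<tau> < q" using \<tau>(1) inq by (auto simp: Z_def B_def less_le)
  have after: "\<sigma> t \<in> B" if "t \<in> {\<tau><..q}" for t
    using \<tau>(2)[of t] that \<tau>q(1) by (force simp: Z_def)
  have "\<sigma> ` closure {\<tau><..q} \<subseteq> K"
    by (rule image_closure_subset[OF continuous_on_subset[OF cont] K]) (use \<tau>q after BK in auto)
  then have inK: "\<sigma> t \<in> K" if "t \<in> {\<tau>..q}" for t using that \<tau>q by auto
  have \<tau>KB: "\<sigma> \<tau> \<in> K" "\<sigma> \<tau> \<notin> B" using inK[of \<tau>] \<tau>q \<tau>(1) by (auto simp: Z_def)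
  then obtain x where x: "x \<in> cball x0 r" "\<sigma> \<tau> = chart_inv c x"
    by (auto simp: K_def)
  have "x \<notin> ball x0 r" using \<tau>KB(2) unfolding B_def x(2) by blast
  then have "dist x0 x = r" using x(1) by simp
  moreover have "chart_map c (\<sigma> \<tau>) = x" using x cb map_inv[OF c, of x] by auto
  ultimately show ?thesis
    by (intro that[OF \<tau>q _ inK[unfolded K_def]]) simp_all
qed

text \<open>A comparison curve that stays in a small coordinate ball is handled by
  \<open>core_length\<close>. Any other one must, after its last exit, cross from the sphere of
  radius \<open>R\<close> to a point within \<open>R / 2\<close> of the centre; positivity makes
  that crossing long and the part before it of nonnegative length.\<close>

lemma minimizing_positive:
  assumes pos: "\<And>p. positive_at p"
    and c: "c \<in> A" and NV: "chart_map c ` (chart_dom c \<inter> N) = chart_cod c \<inter> V" and V: "subspace V"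
    and geo: "N_geodesic A F N \<gamma> a b" and us: "unit_speed A F \<gamma> a b" and ac: "\<gamma> a \<in> chart_dom c"
  obtains \<delta> where "\<delta> > 0" "a + \<delta> < b"
    "\<And>\<sigma> p q. pw_smooth_curve A \<sigma> p q \<Longrightarrow> \<sigma> p \<in> N \<Longrightarrow> \<sigma> q = \<gamma> (a + \<delta>) \<Longrightarrow> \<delta> \<le> curve_length A F \<sigma> p q"
proof -
  interpret lf: local_finsler "chart_cod c" "LE c" by (rule LE_local_finsler[OF c])
  obtain b1 x v where x: "a < b1" "b1 < b" "continuous_on {a..b1} x" "continuous_on {a..b1} v"
    "\<And>t. t \<in> {a..b1} \<Longrightarrow> \<gamma> t \<in> chart_dom c \<and> chart_map c (\<gamma> t) = x t"
    "\<And>t. t \<in> {a..b1} \<Longrightarrow> LE c (x t, v t) = 1"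
    "\<And>t. t \<in> {a<..<b1} \<Longrightarrow> (x has_vector_derivative v t) (at t)"
    "\<And>t. t \<in> {a<..<b1} \<Longrightarrow> ((\<lambda>t. lf.Lv (x t, v t)) has_vector_derivative lf.Lx (x t, v t)) (at t)"
    "\<And>e. e \<in> V \<Longrightarrow> lf.Lv (x a, v a) \<bullet> e = 0"
    using that by (rule euler_lagrange[OF c NV V geo us ac])
  have xC: "x t \<in> chart_cod c" if "t \<in> {a..b1}" for t using x(5)[OF that] map_cod by metis
  have xaC: "x a \<in> chart_cod c" using xC[of a] x(1) by simp
  have xaV: "x a \<in> V"
  proof -
    have "\<gamma> a \<in> N" using geo by (simp add: N_geodesic_def)
    then have "chart_map c (\<gamma> a) \<in> chart_map c ` (chart_dom c \<inter> N)" using ac by blast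
    then show ?thesis using NV x(5)[of a] x(1) by auto
  qed
  obtain \<delta>0 r where core: "\<delta>0 > 0" "r > 0" "a + \<delta>0 \<le> b1"
    "\<And>d y y' K p q S. 0 < d \<Longrightarrow> d \<le> \<delta>0 \<Longrightarrow> p < q \<Longrightarrow> continuous_on {p..q} y \<Longrightarrow> finite S \<Longrightarrow>
      \<forall>t\<in>{p<..<q} - S. (y has_vector_derivative y' t) (at t) \<and> K t = LE c (y t, y' t) \<and> isCont K t \<Longrightarrow>
      K integrable_on {p..q} \<Longrightarrow> \<forall>t. K t \<ge> 0 \<Longrightarrow> \<forall>t\<in>{p..q}. norm (y t - x a) \<le> r \<Longrightarrow>
      lf.Lv (x a, v a) \<bullet> (y p - x a) = 0 \<Longrightarrow> y q = x (a + d) \<Longrightarrow> d \<le> integral {p..q} K"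
    using that by (rule lf.core_length[OF x(1,3,4) xC x(6,7,8), rotated -1])
  obtain r0 m where r0: "r0 > 0" "m > 0" "cball (x a) r0 \<subseteq> chart_cod c"
    "\<And>y u. y \<in> cball (x a) r0 \<Longrightarrow> LE c (y, u) \<ge> m * norm u"
    using that by (rule LE_lower_bound[OF pos c xaC])
  define R where "R = min r r0"
  have R: "R > 0" "R \<le> r" "R \<le> r0" using core r0 by (auto simp: R_def)
  have cbR: "cball (x a) R \<subseteq> chart_cod c" using R(3) r0(3) by auto
  obtain d1 where d1: "d1 > 0" "\<And>t. t \<in> {a..b1} \<Longrightarrow> dist t a < d1 \<Longrightarrow> dist (x t) (x a) < R / 2"
    using x(3) x(1) R(1) unfolding continuous_on_iff by (metis atLeastAtMost_iff less_eq_real_def half_gt_zero)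
  \<comment> \<open>\<open>m * R / 2\<close> is the lower bound for the length of a curve that
    leaves the ball of radius \<open>R\<close>; \<open>d1 / 2\<close> keeps the end point
    \<open>\<gamma> (a + \<delta>)\<close> within \<open>R / 2\<close> of the centre.\<close>
  define \<delta> where "\<delta> = Min {\<delta>0, d1 / 2, m * R / 2}"
  have \<delta>: "\<delta> > 0" "\<delta> \<le> \<delta>0" "\<delta> < d1" "\<delta> \<le> m * R / 2"
    using core(1) d1(1) r0(2) R(1) by (auto simp: \<delta>_def min_def)
  have a\<delta>: "a + \<delta> \<in> {a..b1}" using \<delta> core(3) by auto
  have x\<delta>: "dist (x (a + \<delta>)) (x a) < R / 2" using \<delta> a\<delta> by (intro d1(2)) (auto simp: dist_real_def)
  show ?thesis
  proof (rule that[of \<delta>])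
    show "\<delta> > 0" by (rule \<delta>(1))
    show "a + \<delta> < b" using a\<delta> x(2) by simp
    fix \<sigma> p q assume pw: "pw_smooth_curve A \<sigma> p q" and \<sigma>p: "\<sigma> p \<in> N" and \<sigma>q: "\<sigma> q = \<gamma> (a + \<delta>)"
    have pq: "p < q" by (rule pw_smooth_less[OF pw])
    have \<sigma>q': "chart_map c (\<sigma> q) = x (a + \<delta>)" "\<sigma> q = chart_inv c (x (a + \<delta>))"
      using x(5)[OF a\<delta>] \<sigma>q inv_map[OF c] by metis+
    show "\<delta> \<le> curve_length A F \<sigma> p q"
    proof (cases "\<exists>t\<in>{p..q}. \<sigma> t \<notin> chart_inv c ` ball (x a) R")
      case False
      have in_dom: "\<sigma> t \<in> chart_dom c" "norm (chart_map c (\<sigma> t) - x a) \<le> r" if t: "t \<in> {p..q}" for t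
      proof -
        obtain y where y: "y \<in> ball (x a) R" "\<sigma> t = chart_inv c y" using False t by blast
        then have "y \<in> chart_cod c" using cbR by auto
        then show "\<sigma> t \<in> chart_dom c" "norm (chart_map c (\<sigma> t) - x a) \<le> r"
          using y R c by (auto simp: inv_dom map_inv dist_norm norm_minus_commute)
      qed
      obtain S y' where S: "finite S" "continuous_on {p..q} (\<lambda>t. chart_map c (\<sigma> t))"
        "\<And>t. t \<in> {p<..<q} - S \<Longrightarrow> ((\<lambda>t. chart_map c (\<sigma> t)) has_vector_derivative y' t) (at t)"
        "\<And>t. t \<in> {p<..<q} - S \<Longrightarrow> speed \<sigma> t = LE c (chart_map c (\<sigma> t), y' t)"
        "\<And>t. t \<in> {p<..<q} - S \<Longrightarrow> isCont (speed \<sigma>) t"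
        using that by (rule curve_in_chart[OF c pw in_dom(1), rotated -1])
      \<comment> \<open>The speed is replaced by 0 at the exceptional times, because
        \<open>core_length\<close> wants a nonnegative integrand everywhere.\<close>
      define K where "K t = (if t \<in> {p<..<q} - S then speed \<sigma> t else 0)" for t
      have oS: "open ({p<..<q} - S)" using S(1) by (intro open_Diff finite_imp_closed) auto
      have "\<delta> \<le> integral {p..q} K"
      proof (rule core(4)[OF \<delta>(1,2) pq S(2,1)])
        have "isCont K t" if t: "t \<in> {p<..<q} - S" for t
        proof -
          have "\<forall>\<^sub>F s in nhds t. K s = speed \<sigma> s"
            using eventually_nhds_in_open[OF oS t] by eventually_elim (simp add: K_def)
          then show ?thesis using S(5)[OF t] isCont_cong by blast
        qed
        then show "\<forall>t\<in>{p<..<q} - S. ((\<lambda>t. chart_map c (\<sigma> t)) has_vector_derivative y' t) (at t) \<and>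
            K t = LE c (chart_map c (\<sigma> t), y' t) \<and> isCont K t"
          using S(3,4) by (simp add: K_def)
        show "K integrable_on {p..q}"
          unfolding K_def
          by (rule integrable_spike[OF speed_integrable[OF pw], of "{p, q} \<union> S"])
            (use S(1) in \<open>auto intro: negligible_finite\<close>)
        have "K t \<ge> 0" for t
        proof (cases "t \<in> {p<..<q} - S")
          case True
          have "chart_map c (\<sigma> t) \<in> chart_cod c" using True in_dom(1)[of t] by (intro map_cod) auto
          then show ?thesis
            using True S(4) positive_LE(2)[OF pos c] by (simp add: K_def)
        qed (auto simp: K_def)
        then show "\<forall>t. K t \<ge> 0" by blast
        show "\<forall>t\<in>{p..q}. norm (chart_map c (\<sigma> t) - x a) \<le> r"
          using in_dom(2) by blast
        have "chart_map c (\<sigma> p) \<in> chart_map c ` (chart_dom c \<inter> N)"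
          using \<sigma>p in_dom(1)[of p] pq by auto
        then have "chart_map c (\<sigma> p) - x a \<in> V"
          using NV xaV V by (auto intro: subspace_diff)
        then show "lf.Lv (x a, v a) \<bullet> (chart_map c (\<sigma> p) - x a) = 0" by (rule x(9))
        show "chart_map c (\<sigma> q) = x (a + \<delta>)" by (rule \<sigma>q'(1))
      qed
      also have "integral {p..q} K = curve_length A F \<sigma> p q"
        unfolding curve_length_speed
        by (rule integral_spike[of "{p, q} \<union> S"])
          (use S(1) in \<open>auto simp: K_def intro: negligible_finite\<close>)
      finally show ?thesis .
    next
      case True
      have inq: "\<sigma> q \<in> chart_inv c ` ball (x a) R"
        unfolding \<sigma>q'(2) using x\<delta> R(1) by (intro imageI) (simp add: dist_commute)
      obtain \<tau> where \<tau>: "p \<le> \<tau>" "\<tau> < q" "dist (x a) (chart_map c (\<sigma> \<tau>)) = R"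
        "\<And>t. t \<in> {\<tau>..q} \<Longrightarrow> \<sigma> t \<in> chart_inv c ` cball (x a) R"
        using that by (rule last_exit[OF c cbR R(1) pw_smooth_continuous[OF pw] pq inq True])
      have pw': "pw_smooth_curve A \<sigma> \<tau> q" using pw_smooth_sub[OF pw \<tau>(1,2)] by simp
      have in_dom: "\<sigma> t \<in> chart_dom c" "chart_map c (\<sigma> t) \<in> cball (x a) r0" if t: "t \<in> {\<tau>..q}" for t
      proof -
        obtain y where y: "y \<in> cball (x a) R" "\<sigma> t = chart_inv c y" using \<tau>(4)[OF t] by blast
        then have "y \<in> chart_cod c" using cbR by auto
        then show "\<sigma> t \<in> chart_dom c" "chart_map c (\<sigma> t) \<in> cball (x a) r0"
          using y R c by (auto simp: inv_dom map_inv)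
      qed
      have "R \<le> dist (x a) (x (a + \<delta>)) + norm (x (a + \<delta>) - chart_map c (\<sigma> \<tau>))"
        using dist_triangle[of "x a" "chart_map c (\<sigma> \<tau>)" "x (a + \<delta>)"] \<tau>(3) by (simp add: dist_norm)
      then have "R / 2 \<le> norm (chart_map c (\<sigma> q) - chart_map c (\<sigma> \<tau>))"
        using x\<delta> by (simp add: \<sigma>q'(1) dist_commute)
      then have "m * (R / 2) \<le> m * norm (chart_map c (\<sigma> q) - chart_map c (\<sigma> \<tau>))"
        using r0(2) by (intro mult_left_mono) auto
      also have "\<dots> \<le> curve_length A F \<sigma> \<tau> q"
        by (rule length_lower_bound[OF c pw' in_dom(1) r0(2) r0(4)[OF in_dom(2)]])
      also have "\<dots> \<le> curve_length A F \<sigma> p q"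
      proof (cases "p = \<tau>")
        case False
        then have "pw_smooth_curve A \<sigma> p \<tau>" using pw_smooth_sub[OF pw, of p \<tau>] \<tau> by simp
        then show ?thesis
          using curve_length_add[OF pw, of \<tau>] \<tau> curve_length_nonneg[OF pos] by fastforce
      qed simp
      finally show ?thesis using \<delta>(4) by simp
    qed
  qed
qed

end

section \<open>The sign of a Finsler metric\<close>

lemma DIM_one_representation:
  assumes "DIM('a::euclidean_space) = 1" "norm (d :: 'a) = 1"
  shows "(u :: 'a) = (u \<bullet> d) *\<^sub>R d"
proof -
  obtain e :: 'a where e: "Basis = {e}" using assms(1) card_1_singletonE by blast
  have rep: "v = (v \<bullet> e) *\<^sub>R e" for v :: 'a
    using euclidean_representation[of v] by (simp add: e)
  have "e \<in> Basis" by (simp add: e)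
  then have ee: "e \<bullet> e = 1" by (rule inner_same_Basis)
  define t where "t = d \<bullet> e"
  have d: "d = t *\<^sub>R e" using rep[of d] by (simp add: t_def)
  have "t * t = 1"
    using assms(2) ee unfolding norm_eq_1 by (simp add: d)
  then have "(u \<bullet> e * t * t) *\<^sub>R e = (u \<bullet> e) *\<^sub>R e" by (simp add: mult.assoc)
  then show ?thesis
    using rep[of u] by (simp add: d mult_ac)
qed

context finsler
begin

definition signed :: "real \<Rightarrow> 'm \<Rightarrow> bool" where
  "signed s p \<longleftrightarrow> (\<forall>c\<in>A. p \<in> chart_dom c \<longrightarrow> (\<forall>u. u \<noteq> 0 \<longrightarrow> s * LE c (chart_map c p, u) > 0))"

lemma LE_nonzero: "c \<in> A \<Longrightarrow> x \<in> chart_cod c \<Longrightarrow> u \<noteq> 0 \<Longrightarrow> LE c (x, u) \<noteq> 0"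
  using local_finsler.G_nonzero[OF LE_local_finsler] by blast

lemma LE_zero: "c \<in> A \<Longrightarrow> x \<in> chart_cod c \<Longrightarrow> LE c (x, 0) = 0"
  using local_finsler.G_zero[OF LE_local_finsler] by blast

lemma signed_chart:
  assumes c: "c \<in> A" "p \<in> chart_dom c" and pos: "\<And>u. u \<noteq> 0 \<Longrightarrow> s * LE c (chart_map c p, u) > 0"
  shows "signed s p"
  unfolding signed_def
proof (intro ballI impI allI)
  fix c' u assume c': "c' \<in> A" "p \<in> chart_dom c'" and u: "(u :: 'e) \<noteq> 0"
  have eq: "LE c (chart_map c p, tv c' p u c) = LE c' (chart_map c' p, u)"
    by (rule LE_change[OF c'(1) c(1) c'(2) c(2)])
  then have "tv c' p u c \<noteq> 0"
    using LE_zero[OF c(1) map_cod[OF c(2)]] LE_nonzero[OF c'(1) map_cod[OF c'(2)] u] by metis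
  from pos[OF this] eq show "s * LE c' (chart_map c' p, u) > 0" by simp
qed

text \<open>\<open>LE c\<close> has no zeros off the zero section, so the intermediate value theorem
  fixes its sign on connected sets.\<close>

lemma LE_same_sign:
  assumes c: "c \<in> A" and X: "connected X" "X \<subseteq> chart_cod c \<times> (UNIV - {0})"
    and z: "z \<in> X" "s * LE c z > 0" and z': "z' \<in> X"
  shows "s * LE c z' > 0"
proof (rule ccontr)
  assume neg: "\<not> s * LE c z' > 0"
  have "continuous_on X (\<lambda>z. s * LE c z)"
    by (intro continuous_intros continuous_on_subset[OF LE_cont[OF c]]) (use X in auto)
  then have "connected ((\<lambda>z. s * LE c z) ` X)" by (rule connected_continuous_image[OF _ X(1)])
  then have "0 \<in> (\<lambda>z. s * LE c z) ` X"
    by (rule connectedD_interval[of _ "s * LE c z'" "s * LE c z"]) (use z z' neg in auto)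
  then obtain w where w: "w \<in> X" "s * LE c w = 0" by auto
  have "LE c (fst w, snd w) \<noteq> 0" using w(1) X(2) by (intro LE_nonzero[OF c]) auto
  then show False using w(2) z(2) by auto
qed

text \<open>In a coordinate ball the sign of \<open>LE c\<close> on a fixed vector \<open>u\<close>
  does not depend on the point. Hence a definite sign is a locally constant property, and the
  manifold is connected.\<close>

lemma signed_everywhere:
  assumes "signed s p"
  shows "signed s q"
proof (rule connected_induction_simple[where P = "signed s" and a = p and b = q, OF connected_M UNIV_I UNIV_I assms])
  fix a :: 'm
  obtain c where c: "c \<in> A" "a \<in> chart_dom c" by (rule chart_exists)
  obtain r where r: "r > 0" "ball (chart_map c a) r \<subseteq> chart_cod c"
    using open_cod[OF c(1)] map_cod[OF c(2)] open_contains_ball by metis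
  define T where "T = chart_dom c \<inter> chart_map c -` ball (chart_map c a) r"
  have oT: "open T" unfolding T_def
    by (rule continuous_open_preimage[OF cont_map[OF c(1)] open_dom[OF c(1)] open_ball])
  have "openin (top_of_set UNIV) T" using open_subset[OF subset_UNIV oT] .
  moreover have "a \<in> T" using c r by (simp add: T_def)
  moreover have "signed s y" if x: "x \<in> T" and y: "y \<in> T" and sx: "signed s x" for x y
  proof (rule signed_chart[OF c(1)])
    show "y \<in> chart_dom c" using y by (simp add: T_def)
    fix u :: 'e assume u: "u \<noteq> 0"
    have "s * LE c (chart_map c x, u) > 0"
      using sx c(1) x u by (simp add: signed_def T_def)
    then show "s * LE c (chart_map c y, u) > 0"
      by (rule LE_same_sign[OF c(1), of "ball (chart_map c a) r \<times> {u}", rotated 3])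
        (use x y u r in \<open>auto simp: T_def intro!: connected_Times\<close>)
  qed
  ultimately show "\<exists>T. openin (top_of_set UNIV) T \<and> a \<in> T \<and> (\<forall>x\<in>T. \<forall>y\<in>T. signed s x \<longrightarrow> signed s y)"
    by metis
qed

text \<open>In dimension one a Finsler metric in the sense of the definition may change its sign under
  reversal of the direction, as in \<open>F x u = u\<close> on the real line.\<close>

definition sign_changing :: bool where
  "sign_changing \<longleftrightarrow> DIM('e) = 1 \<and>
     (\<forall>c\<in>A. \<forall>x\<in>chart_cod c. \<forall>u. u \<noteq> 0 \<longrightarrow> LE c (x, u) * LE c (x, - u) < 0)"

text \<open>The given positive value excludes an everywhere negative metric. If both signs occur in
  the tangent spaces, then the space of nonzero vectors must be disconnected, which forces dimension
  one; there, by homogeneity, the two rays carry opposite signs.\<close>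

lemma sign_dichotomy:
  assumes c: "c \<in> A" "x \<in> chart_cod c" "LE c (x, u) > 0"
  shows "(\<forall>p. positive_at p) \<or> sign_changing"
proof (rule disjCI)
  assume ns: "\<not> sign_changing"
  have pos: "positive_at p \<longleftrightarrow> signed 1 p" for p by (simp add: positive_at_def signed_def)
  show "\<forall>p. positive_at p"
  proof (rule ccontr)
    assume "\<not> ?thesis"
    then have no1: "\<not> signed 1 p" for p using signed_everywhere pos by blast
    have "u \<noteq> 0" using c LE_zero[of c x] by auto
    then have "\<not> signed (-1) (chart_inv c x)"
      using c by (auto simp: signed_def inv_dom map_inv intro!: exI[of _ c] bexI[of _ c] exI[of _ u])
    then have no2: "\<not> signed (-1) p" for p using signed_everywhere by blast
    have both: "\<exists>w. w \<noteq> 0 \<and> s * LE c (x, w) < 0" if cx: "c \<in> A" "x \<in> chart_cod c" and s: "s = 1 \<or> s = -1" for c x s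
    proof -
      have "\<not> signed s (chart_inv c x)" using no1 no2 s by auto
      then obtain w where w: "w \<noteq> 0" "\<not> s * LE c (x, w) > 0"
        using signed_chart[OF cx(1) inv_dom[OF cx], of s] map_inv[OF cx] by auto
      then show ?thesis using LE_nonzero[OF cx w(1)] s by (intro exI[of _ w]) auto
    qed
    have D1: "DIM('e) = 1"
    proof (rule ccontr)
      assume "DIM('e) \<noteq> 1"
      then have "2 \<le> DIM('e)" using DIM_positive[where 'a = 'e] by linarith
      then have "connected (UNIV - {0 :: 'e})" by (intro connected_open_delete) auto
      then have con: "connected ({x} \<times> (UNIV - {0 :: 'e}))" by (intro connected_Times) auto
      obtain w where w: "w \<noteq> 0" "1 * LE c (x, w) < 0" using both[OF c(1,2), of 1] by auto
      have "1 * LE c (x, w) > 0"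
        by (rule LE_same_sign[OF c(1) con _ _ _]) (use c \<open>u \<noteq> 0\<close> w in auto)
      then show False using w by simp
    qed
    obtain d :: 'e where "d \<in> Basis" using nonempty_Basis by blast
    then have nd: "norm d = 1" "d \<noteq> 0" by auto
    have "LE c (x, v) * LE c (x, - v) < 0" if cx: "c \<in> A" "x \<in> chart_cod c" and v: "v \<noteq> 0" for c x v
    proof -
      interpret lf: local_finsler "chart_cod c" "LE c" by (rule LE_local_finsler[OF cx(1)])
      have sc: "LE c (x, t *\<^sub>R v) = (if t \<ge> 0 then t * LE c (x, v) else - t * LE c (x, - v))" for t
        using lf.G_hom[OF cx(2) v, of t] lf.G_hom[OF cx(2), of "- v" "- t"] v LE_zero[OF cx]
        by (cases "t > 0"; cases "t = 0") auto
      have rep: "\<exists>t. w = t *\<^sub>R v" for w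
      proof -
        have nv: "norm ((1 / norm v) *\<^sub>R v) = 1" using v by simp
        show ?thesis using DIM_one_representation[OF D1 nv, of w] by (metis scaleR_scaleR)
      qed
      obtain w1 where "1 * LE c (x, w1) < 0" using both[OF cx, of 1] by auto
      moreover obtain w2 where "-1 * LE c (x, w2) < 0" using both[OF cx, of "-1"] by auto
      moreover obtain t1 t2 where "w1 = t1 *\<^sub>R v" "w2 = t2 *\<^sub>R v" using rep by metis
      moreover have "LE c (x, v) \<noteq> 0" "LE c (x, - v) \<noteq> 0" using LE_nonzero[OF cx] v by auto
      ultimately show ?thesis
        using sc[of t1] sc[of t2]
        by (auto simp: mult_less_0_iff zero_less_mult_iff split: if_splits)
    qed
    then have sign_changing using D1 unfolding sign_changing_def by blast
    then show False using ns by simp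
  qed
qed


section \<open>Concatenation of curves\<close>

lemma pw_smooth_cong:
  "pw_smooth_curve A \<gamma> a b \<Longrightarrow> (\<And>t. t \<in> {a..b} \<Longrightarrow> \<gamma> t = \<gamma>' t) \<Longrightarrow> pw_smooth_curve A \<gamma>' a b"
proof (induction rule: pw_smooth_induct)
  case (piece a b)
  then show ?case by (intro pw_smooth_piece smooth_map_on_cong[OF piece(2)]) auto
next
  case (append a b c)
  have "a < b" by (rule pw_smooth_less[OF append.hyps(1)])
  have "pw_smooth_curve A \<gamma>' a b" by (rule append.IH) (use append.hyps(2) append.prems in auto)
  moreover have "smooth_map_on A {b..c} \<gamma>'"
    by (rule smooth_map_on_cong[OF append.hyps(3)]) (use \<open>a < b\<close> append.prems in auto)
  ultimately show ?case using pw_smooth_append append.hyps(2) by blast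
qed

lemma pw_smooth_shift:
  assumes "pw_smooth_curve A \<gamma> a b"
  shows "pw_smooth_curve A (\<lambda>t. \<gamma> (t - h)) (a + h) (b + h)"
proof -
  have sm: "smooth_map_on A {a + h..b + h} (\<lambda>t. \<gamma> (t - h))" if sm: "smooth_map_on A {a..b} \<gamma>" for a b
    unfolding smooth_map_on_def
  proof
    fix t assume t: "t \<in> {a + h..b + h}"
    then have "t - h \<in> {a..b}" by auto
    then obtain c W g where c: "c \<in> A" "open W" "t - h \<in> W" "\<gamma> ` ({a..b} \<inter> W) \<subseteq> chart_dom c"
        "smooth_on W g" "\<forall>y\<in>{a..b} \<inter> W. chart_map c (\<gamma> y) = g y"
      using sm unfolding smooth_map_on_def by metis
    have oW: "open ((\<lambda>t. t - h) -` W)" by (intro open_vimage c continuous_intros)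
    have "smooth_on ((\<lambda>t. t - h) -` W) (\<lambda>t. t + - h)"
      by (intro smooth_on_add oW smooth_on_const smooth_on_bounded_linear bounded_linear_ident)
    then have "smooth_on ((\<lambda>t. t - h) -` W) (\<lambda>t. g (t - h))"
      by (intro smooth_on_compose[OF oW c(2) _ c(5)]) auto
    then show "\<exists>c\<in>A. \<exists>W g. open W \<and> t \<in> W \<and> (\<lambda>t. \<gamma> (t - h)) ` ({a + h..b + h} \<inter> W) \<subseteq> chart_dom c \<and>
        smooth_on W g \<and> (\<forall>y\<in>{a + h..b + h} \<inter> W. chart_map c (\<gamma> (y - h)) = g y)"
      using c oW
      by (intro bexI[OF _ c(1)] exI[of _ "(\<lambda>t. t - h) -` W"] exI[of _ "\<lambda>t. g (t - h)"]) auto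
  qed
  show ?thesis using assms
  proof (induction rule: pw_smooth_induct)
    case (piece a b)
    then show ?case by (intro pw_smooth_piece sm) auto
  next
    case (append a b c)
    then show ?case using pw_smooth_append sm by simp
  qed
qed

lemma pw_smooth_trans:
  assumes "pw_smooth_curve A \<gamma> b c" "pw_smooth_curve A \<gamma> a b"
  shows "pw_smooth_curve A \<gamma> a c"
  using assms
proof (induction rule: pw_smooth_induct)
  case (piece b c)
  then show ?case by (intro pw_smooth_append[of \<gamma> a b c])
next
  case (append b c d)
  then show ?case by (intro pw_smooth_append[of \<gamma> a c d]) auto
qed

lemma speed_shift: "speed (\<lambda>t. \<gamma> (t - h)) t = speed \<gamma> (t - h)"
proof -
  have vd: "vector_derivative (\<lambda>s. f (s - h)) (at t) = vector_derivative f (at (t - h))" for f :: "real \<Rightarrow> 'e"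
  proof -
    have shift: "((\<lambda>s. f (s - h)) has_vector_derivative D) (at t)"
      if "(f has_vector_derivative D) (at (t - h))" for f :: "real \<Rightarrow> 'e" and t h D
    proof -
      have "((\<lambda>s. s - h) has_vector_derivative 1) (at t)"
        by (auto intro!: derivative_eq_intros)
      from vector_diff_chain_at[OF this that] show ?thesis by (simp add: o_def)
    qed
    have "((\<lambda>s. f (s - h)) has_vector_derivative D) (at t) \<longleftrightarrow> (f has_vector_derivative D) (at (t - h))" for D
      using shift[of f D t h] shift[of "\<lambda>s. f (s - h)" D "t - h" "- h"] by auto
    then show ?thesis by (simp add: vector_derivative_def)
  qed
  have "vector_derivative (\<lambda>s. chart_map c (\<gamma> (s - h))) (at t) =
      vector_derivative (\<lambda>s. chart_map c (\<gamma> s)) (at (t - h))" for c :: "('m, 'e) chart"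
    by (rule vd)
  then show ?thesis by (simp add: speed_def velocity_def cong: if_cong)
qed

text \<open>Besides the length, the speeds on the two parts are exported, because
  \<open>down_trans\<close> depends on their sign.\<close>

lemma concatenate:
  assumes 1: "pw_smooth_curve A \<sigma>1 a1 b1" and 2: "pw_smooth_curve A \<sigma>2 a2 b2" and eq: "\<sigma>1 b1 = \<sigma>2 a2"
  obtains \<sigma> where "pw_smooth_curve A \<sigma> a1 (b1 + (b2 - a2))" "\<sigma> a1 = \<sigma>1 a1" "\<sigma> (b1 + (b2 - a2)) = \<sigma>2 b2"
    "\<And>t. t < b1 \<Longrightarrow> speed \<sigma> t = speed \<sigma>1 t"
    "\<And>t. t > b1 \<Longrightarrow> speed \<sigma> t = speed \<sigma>2 (t - (b1 - a2))"
    "curve_length A F \<sigma> a1 (b1 + (b2 - a2)) = curve_length A F \<sigma>1 a1 b1 + curve_length A F \<sigma>2 a2 b2"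
proof -
  define h where "h = b1 - a2"
  define \<sigma> where "\<sigma> t = (if t \<le> b1 then \<sigma>1 t else \<sigma>2 (t - h))" for t
  have h: "a2 + h = b1" "b2 + h = b1 + (b2 - a2)" by (auto simp: h_def)
  have lt: "a1 < b1" "b1 < b1 + (b2 - a2)" using pw_smooth_less[OF 1] pw_smooth_less[OF 2] by auto
  have s1: "pw_smooth_curve A \<sigma> a1 b1"
    by (rule pw_smooth_cong[OF 1]) (auto simp: \<sigma>_def)
  have s2: "pw_smooth_curve A \<sigma> b1 (b1 + (b2 - a2))"
    by (rule pw_smooth_cong[OF pw_smooth_shift[OF 2, of h, unfolded h]]) (auto simp: \<sigma>_def h_def eq)
  have s: "pw_smooth_curve A \<sigma> a1 (b1 + (b2 - a2))" by (rule pw_smooth_trans[OF s2 s1])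
  have sp1: "speed \<sigma> t = speed \<sigma>1 t" if "t < b1" for t
    by (rule speed_cong[of "{..<b1}"]) (use that in \<open>auto simp: \<sigma>_def\<close>)
  have sp2: "speed \<sigma> t = speed \<sigma>2 (t - h)" if "t > b1" for t
    unfolding speed_shift[symmetric]
    by (rule speed_cong[of "{b1<..}"]) (use that in \<open>auto simp: \<sigma>_def\<close>)
  have "curve_length A F \<sigma> a1 b1 = curve_length A F \<sigma>1 a1 b1"
    unfolding curve_length_speed by (rule integral_spike[of "{b1}"]) (auto simp: sp1)
  moreover have "curve_length A F \<sigma> b1 (b1 + (b2 - a2)) = integral {b1..b1 + (b2 - a2)} (\<lambda>t. speed \<sigma>2 (t - h))"
    unfolding curve_length_speed by (rule integral_spike[of "{b1}"]) (auto simp: sp2)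
  moreover have "integral {b1..b1 + (b2 - a2)} (\<lambda>t. speed \<sigma>2 (t - h)) = curve_length A F \<sigma>2 a2 b2"
  proof -
    have "(\<lambda>t. speed \<sigma>2 (t - h)) \<circ> (+) h = speed \<sigma>2" by (auto simp: fun_eq_iff)
    then show ?thesis
      using integral_shift_Icc_real[of a2 b2 "\<lambda>t. speed \<sigma>2 (t - h)" h] unfolding h curve_length_speed by simp
  qed
  ultimately have "curve_length A F \<sigma> a1 (b1 + (b2 - a2)) = curve_length A F \<sigma>1 a1 b1 + curve_length A F \<sigma>2 a2 b2"
    using curve_length_add[OF s, of b1] lt by simp
  then show ?thesis
    using lt by (intro that[OF s _ _ sp1 sp2[unfolded h_def]]) (auto simp: \<sigma>_def h_def)
qed


section \<open>Curves of prescribed length and curves of negative speed\<close>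

definition reach :: "'m \<Rightarrow> 'm \<Rightarrow> real \<Rightarrow> bool" where
  "reach x y l \<longleftrightarrow> (\<exists>\<sigma> a b. pw_smooth_curve A \<sigma> a b \<and> \<sigma> a = x \<and> \<sigma> b = y \<and> curve_length A F \<sigma> a b = l)"

text \<open>For a sign-changing metric this says that the curve always moves against the positive
  direction. The finite set absorbs break points, where \<open>speed\<close> is unspecified.\<close>

definition descends :: "(real \<Rightarrow> 'm) \<Rightarrow> real \<Rightarrow> real \<Rightarrow> bool" where
  "descends \<sigma> a b \<longleftrightarrow> pw_smooth_curve A \<sigma> a b \<and> (\<exists>S. finite S \<and> (\<forall>t\<in>{a<..<b} - S. speed \<sigma> t < 0))"

definition down :: "'m \<Rightarrow> 'm \<Rightarrow> bool" where
  "down x y \<longleftrightarrow> (\<exists>\<sigma> a b. descends \<sigma> a b \<and> \<sigma> a = x \<and> \<sigma> b = y)"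

lemma reachI: "pw_smooth_curve A \<sigma> a b \<Longrightarrow> reach (\<sigma> a) (\<sigma> b) (curve_length A F \<sigma> a b)"
  by (auto simp: reach_def)

lemma downI: "descends \<sigma> a b \<Longrightarrow> down (\<sigma> a) (\<sigma> b)"
  by (auto simp: down_def)

lemma reach_trans:
  assumes "reach x y l" "reach y z m"
  shows "reach x z (l + m)"
proof -
  obtain \<sigma>1 a1 b1 where 1: "pw_smooth_curve A \<sigma>1 a1 b1" "\<sigma>1 a1 = x" "\<sigma>1 b1 = y" "curve_length A F \<sigma>1 a1 b1 = l"
    using assms(1) by (auto simp: reach_def)
  obtain \<sigma>2 a2 b2 where 2: "pw_smooth_curve A \<sigma>2 a2 b2" "\<sigma>2 a2 = y" "\<sigma>2 b2 = z" "curve_length A F \<sigma>2 a2 b2 = m"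
    using assms(2) by (auto simp: reach_def)
  have "\<sigma>1 b1 = \<sigma>2 a2" using 1 2 by simp
  from concatenate[OF 1(1) 2(1) this] obtain \<sigma> where "pw_smooth_curve A \<sigma> a1 (b1 + (b2 - a2))"
    "\<sigma> a1 = \<sigma>1 a1" "\<sigma> (b1 + (b2 - a2)) = \<sigma>2 b2"
    "curve_length A F \<sigma> a1 (b1 + (b2 - a2)) = curve_length A F \<sigma>1 a1 b1 + curve_length A F \<sigma>2 a2 b2"
    by metis
  then show ?thesis using reachI 1 2 by metis
qed

lemma down_trans:
  assumes "down x y" "down y z"
  shows "down x z"
proof -
  obtain \<sigma>1 a1 b1 S1 where 1: "pw_smooth_curve A \<sigma>1 a1 b1" "\<sigma>1 a1 = x" "\<sigma>1 b1 = y"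
      "finite S1" "\<forall>t\<in>{a1<..<b1} - S1. speed \<sigma>1 t < 0"
    using assms(1) by (auto simp: down_def descends_def)
  obtain \<sigma>2 a2 b2 S2 where 2: "pw_smooth_curve A \<sigma>2 a2 b2" "\<sigma>2 a2 = y" "\<sigma>2 b2 = z"
      "finite S2" "\<forall>t\<in>{a2<..<b2} - S2. speed \<sigma>2 t < 0"
    using assms(2) by (auto simp: down_def descends_def)
  have "\<sigma>1 b1 = \<sigma>2 a2" using 1 2 by simp
  from concatenate[OF 1(1) 2(1) this] obtain \<sigma> where \<sigma>: "pw_smooth_curve A \<sigma> a1 (b1 + (b2 - a2))"
    "\<sigma> a1 = \<sigma>1 a1" "\<sigma> (b1 + (b2 - a2)) = \<sigma>2 b2" "\<And>t. t < b1 \<Longrightarrow> speed \<sigma> t = speed \<sigma>1 t"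
    "\<And>t. t > b1 \<Longrightarrow> speed \<sigma> t = speed \<sigma>2 (t - (b1 - a2))"
    by metis
  define S where "S = S1 \<union> {b1} \<union> (\<lambda>t. t + (b1 - a2)) ` S2"
  have "speed \<sigma> t < 0" if t: "t \<in> {a1<..<b1 + (b2 - a2)} - S" for t
  proof (cases "t < b1")
    case True
    then have "t \<in> {a1<..<b1} - S1" using t by (auto simp: S_def)
    then show ?thesis using 1(5) \<sigma>(4)[OF True] by simp
  next
    case False
    then have "t > b1" using t by (auto simp: S_def)
    moreover have "t - (b1 - a2) \<notin> S2" using t by (force simp: S_def)
    then have "t - (b1 - a2) \<in> {a2<..<b2} - S2" using t \<open>t > b1\<close> by auto
    ultimately show ?thesis using 2(5) \<sigma>(5) by simp
  qed
  moreover have "finite S" using 1(4) 2(4) by (simp add: S_def)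
  ultimately have "descends \<sigma> a1 (b1 + (b2 - a2))" using \<sigma>(1) unfolding descends_def by blast
  from downI[OF this] show ?thesis using \<sigma> 1 2 by simp
qed

lemma descends_sub:
  assumes "descends \<sigma> a b" "a \<le> p" "p < q" "q \<le> b"
  shows "descends \<sigma> p q"
proof -
  obtain S where S: "finite S" "\<forall>t\<in>{a<..<b} - S. speed \<sigma> t < 0" using assms(1) by (auto simp: descends_def)
  have "\<forall>t\<in>{p<..<q} - S. speed \<sigma> t < 0" using S(2) assms by auto
  then show ?thesis using pw_smooth_sub[of \<sigma> a b p q] assms S(1) unfolding descends_def by blast
qed

lemma down_reach:
  assumes "down x y"
  obtains l where "l \<le> 0" "reach x y l"
proof -
  obtain \<sigma> a b S where 1: "pw_smooth_curve A \<sigma> a b" "\<sigma> a = x" "\<sigma> b = y"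
      "finite S" "\<forall>t\<in>{a<..<b} - S. speed \<sigma> t < 0"
    using assms by (auto simp: down_def descends_def)
  have "((\<lambda>t. if t \<in> {a<..<b} - S then speed \<sigma> t else 0) has_integral curve_length A F \<sigma> a b) {a..b}"
    unfolding curve_length_speed
    by (rule has_integral_spike_finite[OF _ _ integrable_integral[OF speed_integrable[OF 1(1)]], of "{a, b} \<union> S"])
      (use 1(4) in auto)
  then have "curve_length A F \<sigma> a b \<le> 0"
    by (rule has_integral_le[OF _ has_integral_0]) (use 1(5) in \<open>auto simp: less_imp_le\<close>)
  then show ?thesis using that reachI[OF 1(1)] 1 by metis
qed

text \<open>A loop of negative length at \<open>y\<close> could be run through so often that,
  together with the ways from \<open>p\<close> to \<open>y\<close> and back, it would give a loop of
  negative length at \<open>p\<close>.\<close>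

lemma loop_nonneg:
  assumes loops: "\<And>l. reach p p l \<Longrightarrow> l \<ge> 0" and "reach p y l1" "reach y p l2" "reach y y m"
  shows "m \<ge> 0"
proof (rule ccontr)
  assume "\<not> m \<ge> 0"
  then have "- m > 0" by simp
  then obtain n :: nat where n: "real n * - m > l1 + l2"
    using ex_less_of_nat_mult[of "- m" "l1 + l2"] by blast
  have "reach y p (real n * m + l2)"
  proof (induction n)
    case (Suc n)
    from reach_trans[OF assms(4) Suc] show ?case by (simp add: algebra_simps)
  qed (use assms in simp)
  from loops[OF reach_trans[OF assms(2) this]] n show False by simp
qed

end


section \<open>One-dimensional coordinate intervals\<close>

text \<open>A coordinate interval around \<open>y\<close>, with \<open>d\<close> chosen as the
  positive direction. The assumption \<open>rep\<close> expresses that the dimension is one, so that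
  \<open>co\<close> and \<open>pt\<close> turn points of the interval into real numbers and
  back.\<close>

locale oriented_interval = finsler A F
  for A :: "('m::{t2_space,second_countable_topology}, 'e::euclidean_space) chart set" and F +
  fixes c :: "('m, 'e) chart" and y :: 'm and d :: 'e and r :: real
  assumes rep: "\<And>u. u = (u \<bullet> d) *\<^sub>R d" and nd: "norm d = 1" and c: "c \<in> A" and y: "y \<in> chart_dom c"
    and r: "r > 0" and cod: "\<And>s. s \<in> {-r..r} \<Longrightarrow> chart_map c y + s *\<^sub>R d \<in> chart_cod c"
    and forward: "\<And>s. s \<in> {-r..r} \<Longrightarrow> LE c (chart_map c y + s *\<^sub>R d, d) > 0"
    and backward: "\<And>s. s \<in> {-r..r} \<Longrightarrow> LE c (chart_map c y + s *\<^sub>R d, - d) < 0"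
begin

definition pt :: "real \<Rightarrow> 'm" where "pt s = chart_inv c (chart_map c y + s *\<^sub>R d)"

definition co :: "'m \<Rightarrow> real" where "co q = (chart_map c q - chart_map c y) \<bullet> d"

text \<open>\<open>hp\<close> is the cost of a forward unit step in the coordinate,
  \<open>hm\<close> the gain of a backward one. The sign in \<open>hm\<close> makes both of them
  positive.\<close>

definition hp :: "real \<Rightarrow> real" where "hp s = LE c (chart_map c y + s *\<^sub>R d, d)"

definition hm :: "real \<Rightarrow> real" where "hm s = - LE c (chart_map c y + s *\<^sub>R d, - d)"

lemma dd: "d \<bullet> d = 1" using nd by (simp add: norm_eq_1)

lemma d_nonzero: "d \<noteq> 0" using nd by auto

lemma pt_dom: "s \<in> {-r..r} \<Longrightarrow> pt s \<in> chart_dom c"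
  and map_pt: "s \<in> {-r..r} \<Longrightarrow> chart_map c (pt s) = chart_map c y + s *\<^sub>R d"
  using cod[of s] c by (auto simp: pt_def inv_dom map_inv)

lemma co_pt: "s \<in> {-r..r} \<Longrightarrow> co (pt s) = s"
  by (simp add: co_def map_pt dd)

lemma map_co: "chart_map c q = chart_map c y + co q *\<^sub>R d"
  using rep[of "chart_map c q - chart_map c y"] by (simp add: co_def algebra_simps)

lemma pt_co: "q \<in> chart_dom c \<Longrightarrow> pt (co q) = q"
  unfolding pt_def map_co[symmetric] using inv_map[OF c] by simp

lemma pt_zero: "pt 0 = y"
  using inv_map[OF c y] by (simp add: pt_def)

lemma co_y: "co y = 0" by (simp add: co_def)

lemma co_cont: "continuous_on (chart_dom c) co"
  unfolding co_def by (intro continuous_intros cont_map[OF c])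

lemma pt_image: "I \<subseteq> {-r..r} \<Longrightarrow> pt ` I = chart_dom c \<inter> co -` I"
  using pt_dom co_pt pt_co by (auto intro!: image_eqI)

lemma open_pt: "-r \<le> s1 \<Longrightarrow> s2 \<le> r \<Longrightarrow> open (pt ` {s1<..<s2})"
  by (subst pt_image) (auto intro!: continuous_open_preimage co_cont open_dom c)

lemma pt_cont: "continuous_on {-r..r} pt"
  unfolding pt_def
  by (rule continuous_on_compose2[OF cont_inv[OF c]]) (use cod in \<open>auto intro!: continuous_intros\<close>)

lemma closed_pt: "-r \<le> s1 \<Longrightarrow> s2 \<le> r \<Longrightarrow> closed (pt ` {s1..s2})"
  by (intro compact_imp_closed compact_continuous_image continuous_on_subset[OF pt_cont]) auto

lemma hp_cont: "continuous_on {-r..r} hp" and hm_cont: "continuous_on {-r..r} hm"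
  unfolding hp_def hm_def
  by (intro continuous_intros continuous_on_compose2[OF LE_cont[OF c]]; use cod in auto)+

lemma hp_pos: "s \<in> {-r..r} \<Longrightarrow> hp s > 0" and hm_pos: "s \<in> {-r..r} \<Longrightarrow> hm s > 0"
  using forward backward by (auto simp: hp_def hm_def)

lemma LE_scale: "s \<in> {-r..r} \<Longrightarrow>
    LE c (chart_map c y + s *\<^sub>R d, w *\<^sub>R d) = (if w \<ge> 0 then hp s * w else hm s * w)"
  using local_finsler.G_hom[OF LE_local_finsler[OF c] cod[of s], of d w]
    local_finsler.G_hom[OF LE_local_finsler[OF c] cod[of s], of "- d" "- w"]
    LE_zero[OF c cod[of s]] d_nonzero
  by (cases "w > 0"; cases "w = 0") (auto simp: hp_def hm_def mult.commute)

lemma curve_coordinate: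
  assumes pw: "pw_smooth_curve A \<sigma> p q" and J: "\<And>t. t \<in> {p..q} \<Longrightarrow> \<sigma> t \<in> pt ` {-r..r}"
  obtains S s' where "finite S" "continuous_on {p..q} (\<lambda>t. co (\<sigma> t))"
    "\<And>t. t \<in> {p<..<q} - S \<Longrightarrow> ((\<lambda>t. co (\<sigma> t)) has_real_derivative s' t) (at t)"
    "\<And>t. t \<in> {p<..<q} - S \<Longrightarrow> speed \<sigma> t = (if s' t \<ge> 0 then hp (co (\<sigma> t)) * s' t else hm (co (\<sigma> t)) * s' t)"
proof -
  have dom: "\<sigma> t \<in> chart_dom c" "co (\<sigma> t) \<in> {-r..r}" if "t \<in> {p..q}" for t
    using J[OF that] pt_dom co_pt by auto
  obtain S y' where S: "finite S" "continuous_on {p..q} (\<lambda>t. chart_map c (\<sigma> t))"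
    "\<And>t. t \<in> {p<..<q} - S \<Longrightarrow> ((\<lambda>t. chart_map c (\<sigma> t)) has_vector_derivative y' t) (at t)"
    "\<And>t. t \<in> {p<..<q} - S \<Longrightarrow> speed \<sigma> t = LE c (chart_map c (\<sigma> t), y' t)"
    using curve_in_chart[OF c pw dom(1)] by metis
  show ?thesis
  proof (rule that[OF S(1), of "\<lambda>t. y' t \<bullet> d"])
    show "continuous_on {p..q} (\<lambda>t. co (\<sigma> t))"
      unfolding co_def by (intro continuous_intros S(2))
    fix t assume t: "t \<in> {p<..<q} - S"
    have "((\<lambda>t. (chart_map c (\<sigma> t) - chart_map c y) \<bullet> d) has_derivative (\<lambda>h. (h *\<^sub>R y' t) \<bullet> d)) (at t)"
      using S(3)[OF t] unfolding has_vector_derivative_def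
      by (auto intro!: derivative_eq_intros)
    then show "((\<lambda>t. co (\<sigma> t)) has_real_derivative y' t \<bullet> d) (at t)"
      by (simp add: co_def has_field_derivative_def mult_commute_abs)
    have "speed \<sigma> t = LE c (chart_map c y + co (\<sigma> t) *\<^sub>R d, (y' t \<bullet> d) *\<^sub>R d)"
      using S(4)[OF t] map_co[of "\<sigma> t"] rep[of "y' t"] by simp
    then show "speed \<sigma> t = (if y' t \<bullet> d \<ge> 0 then hp (co (\<sigma> t)) * (y' t \<bullet> d) else hm (co (\<sigma> t)) * (y' t \<bullet> d))"
      using LE_scale[OF dom(2)[of t]] t by simp
  qed
qed

lemma straight:
  assumes s: "-r \<le> s1" "s1 < s2" "s2 \<le> r"
  shows "reach (pt s1) (pt s2) (integral {s1..s2} hp)"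
    and "reach (pt s2) (pt s1) (- integral {s1..s2} hm)"
    and "down (pt s2) (pt s1)"
proof -
  have sm: "smooth_on UNIV (\<lambda>t. chart_map c y + (k * t) *\<^sub>R d)" for k :: real
  proof -
    have "bounded_linear (\<lambda>t. (k * t) *\<^sub>R d)"
      by (intro bounded_linear_scaleR_const bounded_linear_mult_right)
    then show ?thesis
      by (intro smooth_on_add smooth_on_const smooth_on_bounded_linear open_UNIV)
  qed
  \<comment> \<open>Both directions at once: \<open>k = 1\<close> is the forward segment, and
    \<open>k = -1\<close> is the backward one, run over the reflected parameter interval.\<close>
  have path: "pw_smooth_curve A (\<lambda>t. pt (k * t)) a b"
    and sp: "\<And>t. t \<in> {a<..<b} \<Longrightarrow> speed (\<lambda>t. pt (k * t)) t = LE c (chart_map c y + (k * t) *\<^sub>R d, k *\<^sub>R d)"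
    if "a < b" and k: "\<And>t. t \<in> {a..b} \<Longrightarrow> k * t \<in> {-r..r}" for a b k
  proof -
    show "pw_smooth_curve A (\<lambda>t. pt (k * t)) a b"
      by (rule pw_smooth_piece[OF \<open>a < b\<close> smooth_map_on_chartI[OF c open_UNIV subset_UNIV sm[of k]]])
        (use k pt_dom map_pt in auto)
    fix t assume t: "t \<in> {a<..<b}"
    have k': "k * t \<in> {-r..r}" using k[of t] t by simp
    have "((\<lambda>t. chart_map c y + (k * t) *\<^sub>R d) has_vector_derivative k *\<^sub>R d) (at t)"
      by (auto intro!: derivative_eq_intros)
    then have "((\<lambda>t. chart_map c (pt (k * t))) has_vector_derivative k *\<^sub>R d) (at t)"
      by (rule has_vector_derivative_transform_within_open[of _ _ _ "{a<..<b}"])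
        (use t k map_pt in auto)
    then have "velocity A UNIV (\<lambda>t. pt (k * t)) t = tv c (pt (k * t)) (k *\<^sub>R d)"
      by (intro velocity_chart[of _ _ _ _ _ "{a<..<b}"])
        (use c t k pt_dom in \<open>auto intro: vector_derivative_at\<close>)
    then show "speed (\<lambda>t. pt (k * t)) t = LE c (chart_map c y + (k * t) *\<^sub>R d, k *\<^sub>R d)"
      using LE_map[OF c pt_dom[OF k']] map_pt[OF k'] by (simp add: speed_def)
  qed
  have "curve_length A F (\<lambda>t. pt (1 * t)) s1 s2 = integral {s1..s2} hp"
    unfolding curve_length_speed
    by (rule integral_spike[of "{s1, s2}"]) (use sp[of s1 s2 1] s in \<open>auto simp: hp_def\<close>)
  then show "reach (pt s1) (pt s2) (integral {s1..s2} hp)"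
    using reachI[OF path[of s1 s2 1]] s by simp
  have sp': "speed (\<lambda>t. pt (-1 * t)) t = - hm (- t)" if "t \<in> {-s2<..<-s1}" for t
    using sp[of "-s2" "-s1" "-1" t] that s by (simp add: hm_def)
  have pw': "pw_smooth_curve A (\<lambda>t. pt (-1 * t)) (-s2) (-s1)"
    by (rule path) (use s in auto)
  have "curve_length A F (\<lambda>t. pt (-1 * t)) (-s2) (-s1) = integral {-s2..-s1} (\<lambda>t. - hm (- t))"
    unfolding curve_length_speed
    by (rule integral_spike[of "{-s1, -s2}"]) (use sp' in auto)
  also have "\<dots> = - integral {s1..s2} hm"
    using integral_reflect_real[of s2 s1 "\<lambda>t. - hm t"] by simp
  finally show "reach (pt s2) (pt s1) (- integral {s1..s2} hm)"
    using reachI[OF pw'] by simp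
  have "\<forall>t\<in>{-s2<..<-s1} - {}. speed (\<lambda>t. pt (-1 * t)) t < 0"
  proof
    fix t assume t: "t \<in> {-s2<..<-s1} - {}"
    then have "hm (- t) > 0" using s by (intro hm_pos) auto
    then show "speed (\<lambda>t. pt (-1 * t)) t < 0" using sp'[of t] t by simp
  qed
  then have "descends (\<lambda>t. pt (-1 * t)) (-s2) (-s1)"
    using pw' unfolding descends_def by blast
  from downI[OF this] show "down (pt s2) (pt s1)" by simp
qed

text \<open>A descending curve from outside of the interval enters it at the upper end.\<close>

lemma down_spreads:
  assumes p: "p \<notin> pt ` {-r..r}" and s1: "s1 \<in> {-r<..<r}" and s2: "s2 \<in> {-r<..<r}"
    and dn: "down p (pt s1)"
  shows "down p (pt s2)"
proof -
  consider "s2 < s1" | "s2 = s1" | "s1 < s2" by linarith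
  then show ?thesis
  proof cases
    case 1
    then show ?thesis using down_trans[OF dn] straight(3)[of s2 s1] s1 s2 by simp
  next
    case 2
    then show ?thesis using dn by simp
  next
    case 3
    obtain \<sigma> a b where \<sigma>: "descends \<sigma> a b" "\<sigma> a = p" "\<sigma> b = pt s1"
      using dn by (auto simp: down_def)
    have pw: "pw_smooth_curve A \<sigma> a b" using \<sigma>(1) by (simp add: descends_def)
    have ab: "a < b" by (rule pw_smooth_less[OF pw])
    have cont: "continuous_on {a..b} \<sigma>" by (rule pw_smooth_continuous[OF pw])
    define J where "J = pt ` {-r<..<r}"
    have J: "open J" unfolding J_def by (rule open_pt) auto
    define Z where "Z = {a..b} \<inter> \<sigma> -` (- J)"
    have "closed Z" unfolding Z_def
      by (rule continuous_closed_preimage[OF cont]) (use J in auto)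
    moreover have "bounded Z" by (rule bounded_subset[OF bounded_closed_interval[of a b]]) (simp add: Z_def)
    ultimately have "compact Z" by (simp add: compact_eq_bounded_closed)
    moreover have "a \<in> Z" using p \<sigma>(2) ab by (auto simp: Z_def J_def)
    ultimately obtain \<tau> where \<tau>: "\<tau> \<in> Z" "\<And>t. t \<in> Z \<Longrightarrow> t \<le> \<tau>"
      using compact_attains_sup[of Z] by blast
    have "\<sigma> b \<in> J" using s1 \<sigma>(3) by (simp add: J_def)
    then have \<tau>b: "a \<le> \<tau>" "\<tau> < b" using \<tau>(1) by (auto simp: Z_def less_le)
    have after: "\<sigma> t \<in> J" if "t \<in> {\<tau><..b}" for t
      using \<tau>(2)[of t] that \<tau>b(1) by (force simp: Z_def)
    have Jr: "pt ` {-r<..<r} \<subseteq> pt ` {-r..r}" by auto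
    \<comment> \<open>Inside the interval negative speed means a nonincreasing coordinate, because
      forward motion has positive speed.\<close>
    have mono: "co (\<sigma> b) \<le> co (\<sigma> t)" if t: "t \<in> {\<tau><..<b}" for t
    proof -
      have des: "descends \<sigma> t b" by (rule descends_sub[OF \<sigma>(1)]) (use t \<tau>b in auto)
      then obtain S1 where S1: "finite S1" "\<forall>u\<in>{t<..<b} - S1. speed \<sigma> u < 0"
        by (auto simp: descends_def)
      have pwt: "pw_smooth_curve A \<sigma> t b" using des by (simp add: descends_def)
      have Jt: "\<sigma> u \<in> pt ` {-r..r}" if "u \<in> {t..b}" for u
        using after[of u] t that Jr by (auto simp: J_def)
      obtain S s' where S: "finite S" "continuous_on {t..b} (\<lambda>u. co (\<sigma> u))"
        "\<And>u. u \<in> {t<..<b} - S \<Longrightarrow> ((\<lambda>u. co (\<sigma> u)) has_real_derivative s' u) (at u)"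
        "\<And>u. u \<in> {t<..<b} - S \<Longrightarrow> speed \<sigma> u = (if s' u \<ge> 0 then hp (co (\<sigma> u)) * s' u else hm (co (\<sigma> u)) * s' u)"
        using curve_coordinate[OF pwt Jt] by metis
      have neg: "s' u \<le> 0" if u: "u \<in> {t<..<b} - (S \<union> S1)" for u
      proof (rule ccontr)
        assume "\<not> s' u \<le> 0"
        moreover have "co (\<sigma> u) \<in> {-r..r}" using Jt[of u] u co_pt by auto
        ultimately have "speed \<sigma> u > 0" using S(4)[of u] u hp_pos by simp
        then show False using S1(2) u by force
      qed
      have "((\<lambda>u. if u \<in> {t<..<b} - (S \<union> S1) then s' u else 0) has_integral (co (\<sigma> b) - co (\<sigma> t))) {t..b}"
        by (rule fundamental_theorem_of_calculus_interior_strong[of "S \<union> S1", OF _ _ _ S(2)])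
          (use S S1 t in \<open>auto simp: has_real_derivative_iff_has_vector_derivative\<close>)
      then have "co (\<sigma> b) - co (\<sigma> t) \<le> 0"
        by (rule has_integral_le[OF _ has_integral_0]) (use neg in auto)
      then show ?thesis by simp
    qed
    have cob: "co (\<sigma> b) = s1" using \<sigma>(3) s1 co_pt by simp
    \<comment> \<open>Otherwise the curve after \<tau> would stay in the closed piece between
      \<open>s1\<close> and \<open>s2\<close>, and so would its limit at \<tau>, which by choice of
      \<tau> lies outside the open interval.\<close>
    have "\<exists>t\<in>{\<tau><..<b}. co (\<sigma> t) \<ge> s2"
    proof (rule ccontr)
      assume neg: "\<not> ?thesis"
      have in12: "\<sigma> t \<in> pt ` {s1..s2}" if t: "t \<in> {\<tau><..<b}" for t
      proof -
        have "co (\<sigma> t) \<in> {s1..s2}" using neg t mono[OF t] cob by force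
        moreover have "pt (co (\<sigma> t)) = \<sigma> t" using after[of t] t co_pt by (auto simp: J_def)
        ultimately show ?thesis by (metis imageI)
      qed
      have "\<sigma> ` closure {\<tau><..<b} \<subseteq> pt ` {s1..s2}"
        by (rule image_closure_subset[OF continuous_on_subset[OF cont]])
          (use \<tau>b in12 closed_pt s1 s2 in auto)
      then have "\<sigma> \<tau> \<in> pt ` {s1..s2}" using \<tau>b by auto
      then have "\<sigma> \<tau> \<in> J" using s1 s2 by (auto simp: J_def)
      then show False using \<tau>(1) by (simp add: Z_def)
    qed
    then obtain t where t: "t \<in> {\<tau><..<b}" "co (\<sigma> t) \<ge> s2" by blast
    have in_dom: "\<sigma> u \<in> chart_dom c" if u: "u \<in> {t..b}" for u
    proof -
      have "\<sigma> u \<in> J" using u t by (intro after) auto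
      then show ?thesis using pt_dom by (auto simp: J_def)
    qed
    have "continuous_on {t..b} \<sigma>" by (rule continuous_on_subset[OF cont]) (use t \<tau>b in auto)
    then have "continuous_on {t..b} (\<lambda>u. co (\<sigma> u))"
      by (rule continuous_on_compose2[OF co_cont]) (use in_dom in blast)
    then obtain u where u: "t \<le> u" "u \<le> b" "co (\<sigma> u) = s2"
      using IVT2'[of "\<lambda>u. co (\<sigma> u)" b s2 t] t cob 3 by auto
    have "\<sigma> u = pt s2" using pt_co[OF in_dom[of u]] u by simp
    moreover have "descends \<sigma> a u" by (rule descends_sub[OF \<sigma>(1)]) (use u t \<tau>b in auto)
    ultimately show ?thesis using downI[of \<sigma> a u] \<sigma>(2) by simp
  qed
qed

lemma hp_primitive:
  assumes "s \<in> {-r<..<r}"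
  shows "((\<lambda>s. integral {-r..s} hp) has_real_derivative hp s) (at s)"
  using integral_has_real_derivative[OF hp_cont, of s] assms by (simp add: at_within_Icc_at)

lemma hp_integral_diff:
  assumes "-r \<le> s1" "s1 \<le> s2" "s2 \<le> r"
  shows "integral {-r..s2} hp - integral {-r..s1} hp = integral {s1..s2} hp"
  using Henstock_Kurzweil_Integration.integral_combine[of "-r" s1 s2 hp] assms
    integrable_continuous_interval[OF continuous_on_subset[OF hp_cont, of "{-r..s2}"]] by simp

text \<open>A primitive of \<open>hp\<close> is a calibration. Its rate of growth along the curve is
  the speed during forward motion; during backward motion it is at most the speed, since
  \<open>hm \<le> hp\<close> is multiplied by a negative derivative.\<close>

lemma calibration:
  assumes pw: "pw_smooth_curve A \<sigma> p q" and s1: "0 \<le> s1" "s1 < r"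
    and J: "\<And>t. t \<in> {p..q} \<Longrightarrow> \<sigma> t \<in> pt ` {0..s1}" and ends: "\<sigma> p = pt 0" "\<sigma> q = pt s1"
    and h: "\<And>s. s \<in> {0..s1} \<Longrightarrow> hm s \<le> hp s"
  shows "integral {0..s1} hp \<le> curve_length A F \<sigma> p q"
proof -
  have J': "\<sigma> t \<in> pt ` {-r..r}" if "t \<in> {p..q}" for t
    using J[OF that] s1 by (auto intro: rev_image_eqI)
  have cos: "co (\<sigma> t) \<in> {0..s1}" if t: "t \<in> {p..q}" for t
    using J[OF t] s1 co_pt by auto
  obtain S s' where S: "finite S" "continuous_on {p..q} (\<lambda>t. co (\<sigma> t))"
    "\<And>t. t \<in> {p<..<q} - S \<Longrightarrow> ((\<lambda>t. co (\<sigma> t)) has_real_derivative s' t) (at t)"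
    "\<And>t. t \<in> {p<..<q} - S \<Longrightarrow> speed \<sigma> t = (if s' t \<ge> 0 then hp (co (\<sigma> t)) * s' t else hm (co (\<sigma> t)) * s' t)"
    using curve_coordinate[OF pw J'] by metis
  define f where "f s = integral {-r..s} hp" for s
  have fc: "continuous_on {-r..r} f"
    unfolding f_def by (rule indefinite_integral_continuous_1[OF integrable_continuous_interval[OF hp_cont]])
  let ?on = "\<lambda>g t. if t \<in> {p<..<q} - S then g t else (0 :: real)"
  have "p \<le> q" using pw_smooth_less[OF pw] by simp
  have 1: "(?on (\<lambda>t. hp (co (\<sigma> t)) * s' t) has_integral (f (co (\<sigma> q)) - f (co (\<sigma> p)))) {p..q}"
  proof (rule fundamental_theorem_of_calculus_interior_strong[OF S(1) \<open>p \<le> q\<close>])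
    show "continuous_on {p..q} (\<lambda>t. f (co (\<sigma> t)))"
      by (rule continuous_on_compose2[OF fc S(2)]) (use cos s1 in force)
    fix t assume t: "t \<in> {p<..<q} - S"
    have "co (\<sigma> t) \<in> {-r<..<r}" using cos[of t] t s1 by auto
    then have "(f has_real_derivative hp (co (\<sigma> t))) (at (co (\<sigma> t)))"
      unfolding f_def by (rule hp_primitive)
    from DERIV_chain2[OF this S(3)[OF t]] t
    show "((\<lambda>t. f (co (\<sigma> t))) has_vector_derivative ?on (\<lambda>t. hp (co (\<sigma> t)) * s' t) t) (at t)"
      by (simp add: has_real_derivative_iff_has_vector_derivative)
  qed
  have 2: "(?on (speed \<sigma>) has_integral curve_length A F \<sigma> p q) {p..q}"
    unfolding curve_length_speed
    by (rule has_integral_spike_finite[OF _ _ integrable_integral[OF speed_integrable[OF pw]], of "{p, q} \<union> S"])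
      (use S(1) in auto)
  have "f (co (\<sigma> q)) - f (co (\<sigma> p)) \<le> curve_length A F \<sigma> p q"
  proof (rule has_integral_le[OF 1 2])
    fix t
    show "?on (\<lambda>t. hp (co (\<sigma> t)) * s' t) t \<le> ?on (speed \<sigma>) t"
    proof (cases "t \<in> {p<..<q} - S")
      case True
      have "hm (co (\<sigma> t)) \<le> hp (co (\<sigma> t))" using cos[of t] True by (intro h) auto
      then have "hp (co (\<sigma> t)) * s' t \<le> hm (co (\<sigma> t)) * s' t" if "s' t < 0"
        using that by (intro mult_right_mono_neg) auto
      then show ?thesis using True S(4)[OF True] by auto
    qed auto
  qed
  moreover have "co (\<sigma> q) = s1" "co (\<sigma> p) = 0" using ends s1 co_pt by auto
  ultimately show ?thesis
    using hp_integral_diff[of 0 s1] s1 by (simp add: f_def)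
qed

end

lemma integral_positive:
  fixes f :: "real \<Rightarrow> real"
  assumes "a < b" "continuous_on {a..b} f" "\<And>t. t \<in> {a..b} \<Longrightarrow> f t > 0"
  shows "integral {a..b} f > 0"
proof -
  obtain u where u: "u \<in> {a..b}" "\<And>t. t \<in> {a..b} \<Longrightarrow> f u \<le> f t"
    using continuous_attains_inf[of "{a..b}" f] assms by auto
  have "((\<lambda>_. f u) has_integral f u * (b - a)) {a..b}"
    using has_integral_const_real[of "f u" a b] assms(1) by (simp add: mult.commute)
  then have "f u * (b - a) \<le> integral {a..b} f"
    by (rule has_integral_le[OF _ integrable_integral[OF integrable_continuous_interval[OF assms(2)]]])
      (use u in auto)
  moreover have "f u * (b - a) > 0" using assms(1) assms(3)[OF u(1)] by simp
  ultimately show ?thesis by linarith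
qed

section \<open>Minimization for metrics whose sign changes with the direction\<close>

context finsler
begin

lemma interval_exists:
  assumes sc: sign_changing and c: "c \<in> A" "y \<in> chart_dom c" and d: "norm d = 1" "LE c (chart_map c y, d) > 0"
    and U: "open U" "y \<in> U"
  obtains r where "oriented_interval A F c y d r"
    "\<And>s. s \<in> {-r..r} \<Longrightarrow> chart_inv c (chart_map c y + s *\<^sub>R d) \<in> U"
proof -
  define X where "X = (chart_cod c \<inter> (\<lambda>z. LE c (z, d)) -` {0<..}) \<inter> (chart_cod c \<inter> chart_inv c -` U)"
  have "continuous_on (chart_cod c) (\<lambda>z. LE c (z, d))"
    by (rule continuous_on_compose2[OF LE_cont[OF c(1)]]) (auto intro!: continuous_intros)
  then have "open X" unfolding X_def
    by (intro open_Int continuous_open_preimage cont_inv c open_cod U) auto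
  moreover have "chart_map c y \<in> X" using c d U by (simp add: X_def map_cod inv_map)
  ultimately obtain R where R: "R > 0" "ball (chart_map c y) R \<subseteq> X"
    using open_contains_ball by metis
  have inX: "chart_map c y + s *\<^sub>R d \<in> X" if "s \<in> {-(R / 2)..R / 2}" for s
    using that R d(1) by (auto intro!: subsetD[OF R(2)] simp: dist_norm)
  have D1: "DIM('e) = 1" using sc by (simp add: sign_changing_def)
  show ?thesis
  proof (rule that[of "R / 2"])
    show "oriented_interval A F c y d (R / 2)"
    proof unfold_locales
      show "u = (u \<bullet> d) *\<^sub>R d" for u by (rule DIM_one_representation[OF D1 d(1)])
      fix s assume s: "s \<in> {-(R / 2)..R / 2}"
      show cod: "chart_map c y + s *\<^sub>R d \<in> chart_cod c" using inX[OF s] by (simp add: X_def)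
      show pos: "LE c (chart_map c y + s *\<^sub>R d, d) > 0" using inX[OF s] by (simp add: X_def)
      have "d \<noteq> 0" using d by auto
      then show "LE c (chart_map c y + s *\<^sub>R d, - d) < 0"
        using sc c(1) cod pos by (fastforce simp: sign_changing_def mult_less_0_iff)
    qed (use c d R in auto)
    show "chart_inv c (chart_map c y + s *\<^sub>R d) \<in> U" if "s \<in> {-(R / 2)..R / 2}" for s
      using inX[OF that] by (simp add: X_def)
  qed
qed

text \<open>An interval around \<open>y\<close> that avoids \<open>p\<close> can be entered by a
  descending curve from \<open>p\<close> at its upper end only, and then all its interior points are
  reached; this is \<open>down_spreads\<close>. It permits a connectedness argument along curves
  that avoid \<open>p\<close>.\<close>

lemma down_locally_constant:
  assumes sc: sign_changing and yp: "y \<noteq> p"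
  obtains T where "open T" "y \<in> T" "\<And>y1 y2. y1 \<in> T \<Longrightarrow> y2 \<in> T \<Longrightarrow> down p y1 \<Longrightarrow> down p y2"
proof -
  obtain c where c: "c \<in> A" "y \<in> chart_dom c" by (rule chart_exists)
  obtain e :: 'e where e: "e \<in> Basis" using nonempty_Basis by blast
  then have "e \<noteq> 0" by auto
  then have "LE c (chart_map c y, e) * LE c (chart_map c y, - e) < 0"
    using sc c map_cod[OF c(2)] by (simp add: sign_changing_def)
  then have "LE c (chart_map c y, e) > 0 \<or> LE c (chart_map c y, - e) > 0"
    by (auto simp: mult_less_0_iff)
  then obtain d where d: "norm d = 1" "LE c (chart_map c y, d) > 0"
    using e by (metis norm_Basis norm_minus_cancel)
  obtain r where r: "oriented_interval A F c y d r"
    "\<And>s. s \<in> {-r..r} \<Longrightarrow> chart_inv c (chart_map c y + s *\<^sub>R d) \<in> - {p}"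
    using interval_exists[OF sc c d, of "- {p}"] yp by auto
  interpret I: oriented_interval A F c y d r by (rule r(1))
  have p: "p \<notin> I.pt ` {-r..r}"
  proof
    assume "p \<in> I.pt ` {-r..r}"
    then obtain s where "s \<in> {-r..r}" "p = I.pt s" by blast
    then show False using r(2)[of s] unfolding I.pt_def by blast
  qed
  show ?thesis
  proof (rule that[of "I.pt ` {-r<..<r}"])
    show "open (I.pt ` {-r<..<r})" by (rule I.open_pt) auto
    show "y \<in> I.pt ` {-r<..<r}" using I.pt_zero I.r by (auto intro!: image_eqI[of _ _ 0])
    show "down p y2" if "y1 \<in> I.pt ` {-r<..<r}" "y2 \<in> I.pt ` {-r<..<r}" "down p y1" for y1 y2
      using that I.down_spreads[OF p] by blast
  qed
qed

text \<open>Here \<open>N\<close> is a point \<open>p\<close>. As \<open>p\<close> has distance \<open>0\<close> from itself, no loop at \<open>p\<close> has negative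
  length; hence going forward costs at least as much as is gained on the way back. A curve from \<open>p\<close>
  that reaches the geodesic from the other end would give a loop along which one only descends.\<close>

lemma minimizing_sign_changing:
  assumes sc: sign_changing
    and c: "c \<in> A" and NV: "chart_map c ` (chart_dom c \<inter> N) = chart_cod c \<inter> V" and V: "subspace V"
    and geo: "N_geodesic A F N \<gamma> a b" and us: "unit_speed A F \<gamma> a b" and ac: "\<gamma> a \<in> chart_dom c"
    and N: "connected N" and dist0: "0 \<le> dist_from A F N (\<gamma> a)"
  obtains \<delta> where "\<delta> > 0" "a + \<delta> < b"
    "\<And>\<sigma> p q. pw_smooth_curve A \<sigma> p q \<Longrightarrow> \<sigma> p \<in> N \<Longrightarrow> \<sigma> q = \<gamma> (a + \<delta>) \<Longrightarrow> \<delta> \<le> curve_length A F \<sigma> p q"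
proof -
  interpret lf: local_finsler "chart_cod c" "LE c" by (rule LE_local_finsler[OF c])
  obtain b1 x v where x: "a < b1" "b1 < b" "continuous_on {a..b1} x" "continuous_on {a..b1} v"
    "\<And>t. t \<in> {a..b1} \<Longrightarrow> \<gamma> t \<in> chart_dom c \<and> chart_map c (\<gamma> t) = x t"
    "\<And>t. t \<in> {a..b1} \<Longrightarrow> LE c (x t, v t) = 1"
    "\<And>t. t \<in> {a<..<b1} \<Longrightarrow> (x has_vector_derivative v t) (at t)"
    "\<And>t. t \<in> {a<..<b1} \<Longrightarrow> ((\<lambda>t. lf.Lv (x t, v t)) has_vector_derivative lf.Lx (x t, v t)) (at t)"
    "\<And>e. e \<in> V \<Longrightarrow> lf.Lv (x a, v a) \<bullet> e = 0"
    using that by (rule euler_lagrange[OF c NV V geo us ac])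
  define p where "p = \<gamma> a"
  have pc: "p \<in> chart_dom c" using ac by (simp add: p_def)
  have xa: "chart_map c p = x a" "x a \<in> chart_cod c"
    using x(1) x(5)[of a] map_cod[OF pc] by (auto simp: p_def)
  have pN: "p \<in> N" using geo by (simp add: N_geodesic_def p_def)
  have va1: "LE c (x a, v a) = 1" using x(1,6) by simp
  then have va: "v a \<noteq> 0" using lf.G_zero[OF xa(2)] by auto
  define d where "d = (1 / norm (v a)) *\<^sub>R v a"
  have d: "norm d = 1" "LE c (chart_map c p, d) > 0"
    using va va1 lf.G_hom[OF xa(2) va, of "1 / norm (v a)"] by (simp_all add: d_def xa)
  obtain r where "oriented_interval A F c p d r"
    using interval_exists[OF sc c pc d open_UNIV] by auto
  then interpret I: oriented_interval A F c p d r .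
  \<comment> \<open>The momentum takes the value 1 on the velocity but vanishes on \<open>V\<close>.
    In dimension one this forces \<open>V\<close> to be trivial, so \<open>p\<close> is isolated in
    the connected set \<open>N\<close>.\<close>
  have N1: "N = {p}"
  proof -
    have V0: "e = 0" if e: "e \<in> V" for e
    proof (rule ccontr)
      assume "e \<noteq> 0"
      then have ed: "e \<bullet> d \<noteq> 0" using I.rep[of e] by auto
      have "v a = ((v a \<bullet> d) / (e \<bullet> d)) *\<^sub>R e"
        using I.rep[of "v a"] I.rep[of e] ed by (metis nonzero_eq_divide_eq scaleR_scaleR)
      then have "v a \<in> V" using V e by (metis subspace_scale)
      then have "lf.Lv (x a, v a) \<bullet> v a = 0" by (rule x(9))
      then show False using lf.Lv_self[OF xa(2) va1] by simp
    qed
    have "q = p" if "q \<in> chart_dom c \<inter> N" for q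
    proof -
      have "chart_map c q \<in> V" "chart_map c p \<in> V" using NV that pN pc by blast+
      then have "chart_map c q = chart_map c p" using V0 by metis
      then show ?thesis using inv_map[OF c] that pc by (metis IntD1)
    qed
    then have "chart_dom c \<inter> - {p} \<inter> N = {}" "N \<subseteq> chart_dom c \<union> - {p}" using pc by auto
    from connectedD[OF N open_dom[OF c] _ this] have "- {p} \<inter> N = {}" using pc pN by auto
    then show ?thesis using pN by auto
  qed
  have loops: "l \<ge> 0" if l: "reach p p l" for l
  proof -
    obtain \<sigma> q0 q1 where "pw_smooth_curve A \<sigma> q0 q1" "\<sigma> q0 = p" "\<sigma> q1 = p" "curve_length A F \<sigma> q0 q1 = l"
      using l by (auto simp: reach_def)
    then have "dist_from A F N p \<le> ereal l" using dist_from_le[of \<sigma> q0 q1 N] N1 by simp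
    then show ?thesis using dist0 by (metis ereal_less_eq(5) order_trans p_def zero_ereal_def)
  qed
  have legs: "reach p (I.pt s) (integral {0..s} I.hp)" "reach (I.pt s) p (- integral {0..s} I.hm)"
    if "s \<in> {0<..r}" for s
    using I.straight(1,2)[of 0 s] that I.r by (simp_all add: I.pt_zero)
  \<comment> \<open>Points ahead of \<open>p\<close> in the interval can be reached from
    \<open>p\<close> and left towards \<open>p\<close>, so \<open>loop_nonneg\<close> transfers the
    property of \<open>p\<close> to them.\<close>
  have loops': "m \<ge> 0" if "reach (I.pt s) (I.pt s) m" "s \<in> {0..r}" for s m
  proof (cases "s = 0")
    case True
    then show ?thesis using that loops I.pt_zero by simp
  next
    case False
    then have "s \<in> {0<..r}" using that by simp
    from loop_nonneg[OF loops legs[OF this] that(1)] show ?thesis .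
  qed
  \<comment> \<open>If the gain exceeded the cost at \<open>s\<close>, then by continuity going
    forward over a short piece beyond \<open>s\<close> and back would be a loop of negative length.
    The strict bound \<open>s < r\<close> leaves room for that piece.\<close>
  have h: "I.hm s \<le> I.hp s" if s: "s \<in> {0..<r}" for s
  proof (rule ccontr)
    assume neg: "\<not> I.hm s \<le> I.hp s"
    have cont: "continuous_on {-r..r} (\<lambda>u. I.hm u - I.hp u)"
      by (intro continuous_intros I.hp_cont I.hm_cont)
    have "s \<in> {-r..r}" "I.hm s - I.hp s > 0" using s neg by auto
    then obtain e where e: "e > 0" "\<And>u. u \<in> {-r..r} \<Longrightarrow> dist u s < e \<Longrightarrow>
        dist (I.hm u - I.hp u) (I.hm s - I.hp s) < I.hm s - I.hp s"
      using cont unfolding continuous_on_iff by blast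
    define s' where "s' = min (s + e / 2) r"
    have s': "s < s'" "s' \<le> r" "s' \<le> s + e / 2" using e s by (auto simp: s'_def)
    have sub: "{s..s'} \<subseteq> {-r..r}" using s s' by auto
    have "integral {s..s'} (\<lambda>u. I.hm u - I.hp u) > 0"
    proof (rule integral_positive[OF s'(1) continuous_on_subset[OF cont sub]])
      fix u assume u: "u \<in> {s..s'}"
      then have "dist u s < e" using s' e(1) by (auto simp: dist_real_def)
      then show "I.hm u - I.hp u > 0" using e(2)[of u] u sub by (auto simp: dist_real_def)
    qed
    moreover have "integral {s..s'} (\<lambda>u. I.hm u - I.hp u) = integral {s..s'} I.hm - integral {s..s'} I.hp"
      by (intro integral_diff integrable_continuous_interval continuous_on_subset[OF I.hm_cont sub]
          continuous_on_subset[OF I.hp_cont sub])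
    moreover have "reach (I.pt s) (I.pt s) (integral {s..s'} I.hp + - integral {s..s'} I.hm)"
      by (rule reach_trans[OF I.straight(1,2)]) (use s s' in auto)
    ultimately show False using loops'[of s] s by fastforce
  qed
  obtain d1 where d1: "d1 > 0" "\<And>t. t \<in> {a..b1} \<Longrightarrow> dist t a < d1 \<Longrightarrow> dist (x t) (x a) < r"
    using x(3) x(1) I.r unfolding continuous_on_iff by (metis atLeastAtMost_iff less_eq_real_def)
  define \<delta> where "\<delta> = min (d1 / 2) (b1 - a)"
  have \<delta>: "\<delta> > 0" "\<delta> < d1" "a + \<delta> \<le> b1" using d1(1) x(1) by (auto simp: \<delta>_def)
  define s where "s t = I.co (\<gamma> t)" for t
  have s_eq: "s t = (x t - x a) \<bullet> d" if "t \<in> {a..b1}" for t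
    using x(5)[OF that] by (simp add: s_def I.co_def xa)
  have s_r: "s t \<in> {-r<..<r}" if t: "t \<in> {a..a + \<delta>}" for t
  proof -
    have tb: "t \<in> {a..b1}" using t \<delta>(3) by auto
    have "\<bar>s t\<bar> \<le> norm (x t - x a) * norm d" unfolding s_eq[OF tb] by (rule Cauchy_Schwarz_ineq2)
    also have "\<dots> < r" using d1(2)[OF tb] t \<delta>(2) d(1) by (auto simp: dist_norm)
    finally show ?thesis by auto
  qed
  have \<gamma>_pt: "\<gamma> t = I.pt (s t)" if "t \<in> {a..b1}" for t
    using I.pt_co x(5)[OF that] by (simp add: s_def)
  have s_cont: "continuous_on {a..a + \<delta>} s"
  proof -
    have "continuous_on {a..a + \<delta>} (\<lambda>t. (x t - x a) \<bullet> d)"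
      by (intro continuous_intros continuous_on_subset[OF x(3)]) (use \<delta> in auto)
    then show ?thesis by (rule continuous_on_eq) (use s_eq \<delta> in auto)
  qed
  \<comment> \<open>The speed 1 of the geodesic is positive, whereas backward motion has negative
    speed; hence the geodesic moves forward.\<close>
  have s_deriv: "(s has_real_derivative v t \<bullet> d) (at t)" "v t \<bullet> d > 0" "I.hp (s t) * (v t \<bullet> d) = 1"
    if t: "t \<in> {a<..<a + \<delta>}" for t
  proof -
    have tb: "t \<in> {a<..<b1}" "t \<in> {a..b1}" "t \<in> {a..a + \<delta>}" using t \<delta>(3) by auto
    have "((\<lambda>t. (x t - x a) \<bullet> d) has_derivative (\<lambda>h. (h *\<^sub>R v t) \<bullet> d)) (at t)"
      using x(7)[OF tb(1)] unfolding has_vector_derivative_def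
      by (auto intro!: derivative_eq_intros)
    then have "((\<lambda>t. (x t - x a) \<bullet> d) has_real_derivative v t \<bullet> d) (at t)"
      by (simp add: has_field_derivative_def mult_commute_abs)
    then show "(s has_real_derivative v t \<bullet> d) (at t)"
      by (rule has_field_derivative_transform_within_open[of _ _ _ "{a<..<b1}"]) (use tb s_eq in auto)
    have sr: "s t \<in> {-r..r}" using s_r[OF tb(3)] by auto
    have "x t = chart_map c p + s t *\<^sub>R d" using I.map_co[of "\<gamma> t"] x(5)[OF tb(2)] by (simp add: s_def)
    then have "LE c (chart_map c p + s t *\<^sub>R d, (v t \<bullet> d) *\<^sub>R d) = 1"
      using x(6)[OF tb(2)] I.rep[of "v t"] by simp
    then have *: "(if v t \<bullet> d \<ge> 0 then I.hp (s t) * (v t \<bullet> d) else I.hm (s t) * (v t \<bullet> d)) = 1"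
      using I.LE_scale[OF sr] by simp
    have "v t \<bullet> d \<ge> 0"
    proof (rule ccontr)
      assume "\<not> v t \<bullet> d \<ge> 0"
      then have "I.hm (s t) * (v t \<bullet> d) < 0" using I.hm_pos[OF sr] by (simp add: mult_pos_neg)
      then show False using * \<open>\<not> v t \<bullet> d \<ge> 0\<close> by simp
    qed
    then show "I.hp (s t) * (v t \<bullet> d) = 1" using * by simp
    with \<open>v t \<bullet> d \<ge> 0\<close> show "v t \<bullet> d > 0" by (cases "v t \<bullet> d = 0") auto
  qed
  have sa: "s a = 0" using I.co_y by (simp add: s_def p_def)
  define s1 where "s1 = s (a + \<delta>)"
  have "s a < s (a + \<delta>)"
    by (rule DERIV_pos_imp_increasing_open[OF _ _ s_cont]) (use \<delta> s_deriv in auto)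
  then have s1: "0 < s1" "s1 < r" using sa s_r[of "a + \<delta>"] \<delta>(1) by (auto simp: s1_def)
  have end_pt: "\<gamma> (a + \<delta>) = I.pt s1" using \<gamma>_pt[of "a + \<delta>"] \<delta> by (simp add: s1_def)
  \<comment> \<open>In terms of the time of the geodesic the integrand is
    \<open>I.hp (s t) * (v t \<bullet> d)\<close>, which is 1 by unit speed.\<close>
  have hp_len: "integral {0..s1} I.hp = \<delta>"
  proof -
    define f where "f s = integral {-r..s} I.hp" for s
    have fc: "continuous_on {-r..r} f"
      unfolding f_def by (rule indefinite_integral_continuous_1[OF integrable_continuous_interval[OF I.hp_cont]])
    have "((\<lambda>_. 1) has_integral (f (s (a + \<delta>)) - f (s a))) {a..a + \<delta>}"
    proof (rule fundamental_theorem_of_calculus_interior_strong[of "{}"])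
      show "continuous_on {a..a + \<delta>} (\<lambda>t. f (s t))"
        by (rule continuous_on_compose2[OF fc s_cont]) (use s_r in force)
      fix t assume t: "t \<in> {a<..<a + \<delta>} - {}"
      then have "(f has_real_derivative I.hp (s t)) (at (s t))"
        unfolding f_def by (intro I.hp_primitive s_r) auto
      from DERIV_chain2[OF this s_deriv(1)] t s_deriv(3)[of t]
      show "((\<lambda>t. f (s t)) has_vector_derivative 1) (at t)"
        by (simp add: has_real_derivative_iff_has_vector_derivative)
    qed (use \<delta> in auto)
    moreover have "((\<lambda>_. 1) has_integral \<delta>) {a..a + \<delta>}"
      using has_integral_const_real[of "1 :: real" a "a + \<delta>"] \<delta>(1) by simp
    ultimately have "f (s (a + \<delta>)) - f (s a) = \<delta>" by (rule has_integral_unique)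
    then have "f s1 - f 0 = \<delta>" by (simp add: s1_def sa)
    then show ?thesis using I.hp_integral_diff[of 0 s1] s1 by (simp add: f_def)
  qed
  \<comment> \<open>From \<open>I.pt s1\<close> one can descend further along the interval to
    \<open>p\<close>, at strictly negative length. Together this would be a loop of negative length
    at \<open>p\<close>.\<close>
  have not_down: "\<not> down p (I.pt s1)"
  proof
    assume "down p (I.pt s1)"
    then obtain l where l: "l \<le> 0" "reach p (I.pt s1) l" by (rule down_reach)
    have "reach p p (l + - integral {0..s1} I.hm)"
      by (rule reach_trans[OF l(2) legs(2)]) (use s1 in auto)
    moreover have "integral {0..s1} I.hm > 0"
      by (rule integral_positive[OF s1(1) continuous_on_subset[OF I.hm_cont]])
        (use s1 I.hm_pos in auto)
    ultimately show False using loops l(1) by fastforce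
  qed
  show ?thesis
  proof (rule that[of \<delta>])
    show "\<delta> > 0" "a + \<delta> < b" using \<delta> x(2) by auto
    fix \<sigma> q0 q1 assume pw: "pw_smooth_curve A \<sigma> q0 q1" and start: "\<sigma> q0 \<in> N" and fin: "\<sigma> q1 = \<gamma> (a + \<delta>)"
    have q01: "q0 < q1" by (rule pw_smooth_less[OF pw])
    have cont: "continuous_on {q0..q1} \<sigma>" by (rule pw_smooth_continuous[OF pw])
    have \<sigma>0: "\<sigma> q0 = p" using start N1 by simp
    have \<sigma>1: "\<sigma> q1 = I.pt s1" using fin end_pt by simp
    have p_ne: "p \<noteq> I.pt s1" using I.co_pt[of s1] s1 I.co_y by auto
    \<comment> \<open>The curve is cut at its last visit to \<open>p\<close> and then at its first
      visit to the end point. The outer parts are loops and have nonnegative length, so only the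
      middle part matters, which in between meets neither point.\<close>
    obtain t0 where t0: "t0 \<in> {q0..q1}" "\<sigma> t0 = p" "\<And>t. t \<in> {q0..q1} \<Longrightarrow> \<sigma> t = p \<Longrightarrow> t \<le> t0"
    proof -
      have "closed {t \<in> {q0..q1}. \<sigma> t = p}" by (rule continuous_closed_preimage_constant[OF cont]) simp
      moreover have "bounded {t \<in> {q0..q1}. \<sigma> t = p}"
        by (rule bounded_subset[OF bounded_closed_interval[of q0 q1]]) auto
      ultimately have "compact {t \<in> {q0..q1}. \<sigma> t = p}" by (simp add: compact_eq_bounded_closed)
      moreover have "q0 \<in> {t \<in> {q0..q1}. \<sigma> t = p}" using q01 \<sigma>0 by simp
      ultimately show ?thesis using compact_attains_sup[of "{t \<in> {q0..q1}. \<sigma> t = p}"] that by blast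
    qed
    have t0q1: "t0 < q1" using t0 \<sigma>1 p_ne by (metis atLeastAtMost_iff less_le)
    obtain t1 where t1: "t1 \<in> {t0..q1}" "\<sigma> t1 = I.pt s1" "\<And>t. t \<in> {t0..q1} \<Longrightarrow> \<sigma> t = I.pt s1 \<Longrightarrow> t1 \<le> t"
    proof -
      have "closed {t \<in> {t0..q1}. \<sigma> t = I.pt s1}"
        by (rule continuous_closed_preimage_constant[OF continuous_on_subset[OF cont]]) (use t0 in auto)
      moreover have "bounded {t \<in> {t0..q1}. \<sigma> t = I.pt s1}"
        by (rule bounded_subset[OF bounded_closed_interval[of t0 q1]]) auto
      ultimately have "compact {t \<in> {t0..q1}. \<sigma> t = I.pt s1}" by (simp add: compact_eq_bounded_closed)
      moreover have "q1 \<in> {t \<in> {t0..q1}. \<sigma> t = I.pt s1}" using t0q1 \<sigma>1 by simp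
      ultimately show ?thesis using compact_attains_inf[of "{t \<in> {t0..q1}. \<sigma> t = I.pt s1}"] that by blast
    qed
    have t01: "t0 < t1" using t0 t1 p_ne by (metis atLeastAtMost_iff less_le)
    have pw01: "pw_smooth_curve A \<sigma> t0 t1" using pw_smooth_sub[OF pw, of t0 t1] t0 t1 t01 by simp
    have part1: "curve_length A F \<sigma> q0 t0 \<ge> 0"
    proof (cases "q0 = t0")
      case False
      then have "pw_smooth_curve A \<sigma> q0 t0" using pw_smooth_sub[OF pw, of q0 t0] t0(1) by simp
      from reachI[OF this] show ?thesis using loops \<sigma>0 t0(2) by simp
    qed (simp add: curve_length_speed)
    have part3: "curve_length A F \<sigma> t1 q1 \<ge> 0"
    proof (cases "t1 = q1")
      case False
      then have "pw_smooth_curve A \<sigma> t1 q1" using pw_smooth_sub[OF pw, of t1 q1] t0(1) t1(1) by simp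
      from reachI[OF this] show ?thesis using loops'[of s1] s1 \<sigma>1 t1(2) by simp
    qed (simp add: curve_length_speed)
    have len: "curve_length A F \<sigma> q0 q1 = curve_length A F \<sigma> q0 t0 + curve_length A F \<sigma> t0 t1 + curve_length A F \<sigma> t1 q1"
    proof -
      have "pw_smooth_curve A \<sigma> t0 q1" using pw_smooth_sub[OF pw, of t0 q1] t0(1) t0q1 by simp
      then show ?thesis
        using curve_length_add[OF pw, of t0] curve_length_add[of \<sigma> t0 q1 t1] t0(1) t1(1) by simp
    qed
    have mid: "\<sigma> t \<noteq> p" "\<sigma> t \<noteq> I.pt s1" if "t \<in> {t0<..<t1}" for t
      using t0(3)[of t] t1(3)[of t] that t0(1) t1(1) by force+
    have cont01: "continuous_on {t0..t1} \<sigma>" by (rule pw_smooth_continuous[OF pw01])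
    \<comment> \<open>Being connected and avoiding both end points, the middle part lies either
      entirely inside the interval from \<open>p\<close> to \<open>I.pt s1\<close> or entirely
      outside of it.\<close>
    have con: "connected (\<sigma> ` {t0<..<t1})"
      by (rule connected_continuous_image[OF continuous_on_subset[OF cont01]]) auto
    have op: "open (I.pt ` {0<..<s1})" "open (- I.pt ` {0..s1})"
      using I.open_pt[of 0 s1] I.closed_pt[of 0 s1] s1 by auto
    have disj: "I.pt ` {0<..<s1} \<inter> - I.pt ` {0..s1} \<inter> \<sigma> ` {t0<..<t1} = {}" by force
    have cover: "\<sigma> ` {t0<..<t1} \<subseteq> I.pt ` {0<..<s1} \<union> - I.pt ` {0..s1}"
    proof
      fix y assume "y \<in> \<sigma> ` {t0<..<t1}"
      then obtain t where t: "t \<in> {t0<..<t1}" "y = \<sigma> t" by blast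
      have "u \<in> {0<..<s1}" if "u \<in> {0..s1}" "y = I.pt u" for u
        using mid[OF t(1)] that t(2) I.pt_zero by (cases "u = 0"; cases "u = s1") auto
      then show "y \<in> I.pt ` {0<..<s1} \<union> - I.pt ` {0..s1}" by blast
    qed
    have "\<delta> \<le> curve_length A F \<sigma> t0 t1"
      using connectedD[OF con op disj cover]
    proof
      assume out: "- I.pt ` {0..s1} \<inter> \<sigma> ` {t0<..<t1} = {}"
      have "\<sigma> t \<in> I.pt ` {0..s1}" if t: "t \<in> {t0..t1}" for t
      proof (cases "t = t0 \<or> t = t1")
        case True
        then have "\<sigma> t = I.pt 0 \<or> \<sigma> t = I.pt s1" using t0(2) t1(2) I.pt_zero by auto
        then show ?thesis using s1 by (metis atLeastAtMost_iff imageI less_imp_le order_refl)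
      next
        case False
        then show ?thesis using out t by fastforce
      qed
      then have "integral {0..s1} I.hp \<le> curve_length A F \<sigma> t0 t1"
        by (intro I.calibration[OF pw01]) (use s1 t0(2) t1(2) I.pt_zero h in auto)
      then show ?thesis by (simp add: hp_len)
    next
      assume out: "I.pt ` {0<..<s1} \<inter> \<sigma> ` {t0<..<t1} = {}"
      \<comment> \<open>In the outer case the curve must leave \<open>p\<close> to negative
        coordinates, that is, to points that are reached from \<open>p\<close> by
        descending.\<close>
      have J: "open (I.pt ` {-r<..<s1})" using s1 by (intro I.open_pt) auto
      have "\<exists>t\<in>{t0<..<t1}. \<sigma> t \<in> I.pt ` {-r<..<s1}"
      proof (rule ccontr)
        assume no: "\<not> ?thesis"
        have "\<sigma> ` closure {t0<..<t1} \<subseteq> - I.pt ` {-r<..<s1}"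
          by (rule image_closure_subset[OF continuous_on_subset[OF cont01]])
            (use t01 no J in auto)
        moreover have "t0 \<in> closure {t0<..<t1}" using t01 by simp
        ultimately have "\<sigma> t0 \<notin> I.pt ` {-r<..<s1}" by blast
        moreover have "I.pt 0 \<in> I.pt ` {-r<..<s1}" using s1 I.r by auto
        ultimately show False using t0(2) I.pt_zero by simp
      qed
      then obtain t u where t: "t \<in> {t0<..<t1}" "\<sigma> t = I.pt u" "u \<in> {-r<..<s1}" by blast
      have "u < 0"
      proof (rule ccontr)
        assume "\<not> u < 0"
        then have "u = 0 \<or> u \<in> {0<..<s1}" using t(3) by auto
        moreover have "u \<noteq> 0" using mid(1)[OF t(1)] t(2) I.pt_zero by auto
        ultimately have "\<sigma> t \<in> I.pt ` {0<..<s1}" using t(2) by blast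
        then show False using out t(1) by blast
      qed
      then have start: "down p (\<sigma> t)" using I.straight(3)[of u 0] t I.r by (simp add: I.pt_zero)
      have "down p (\<sigma> t1)"
      proof (rule connected_induction_simple[where P = "down p" and S = "\<sigma> ` {t0<..t1}" and a = "\<sigma> t"])
        show "connected (\<sigma> ` {t0<..t1})"
          by (rule connected_continuous_image[OF continuous_on_subset[OF cont01]]) auto
        fix y assume "y \<in> \<sigma> ` {t0<..t1}"
        then have "y \<noteq> p" using mid(1) t1(2) p_ne by (force simp: le_less)
        then obtain T where T: "open T" "y \<in> T" "\<And>y1 y2. y1 \<in> T \<Longrightarrow> y2 \<in> T \<Longrightarrow> down p y1 \<Longrightarrow> down p y2"
          by (rule down_locally_constant[OF sc]) blast
        have "openin (top_of_set (\<sigma> ` {t0<..t1})) (\<sigma> ` {t0<..t1} \<inter> T)"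
          using T(1) by (rule openin_open_Int)
        then show "\<exists>T. openin (top_of_set (\<sigma> ` {t0<..t1})) T \<and> y \<in> T \<and>
            (\<forall>x\<in>T. \<forall>y\<in>T. down p x \<longrightarrow> down p y)"
          using T \<open>y \<in> \<sigma> ` {t0<..t1}\<close> by (intro exI[of _ "\<sigma> ` {t0<..t1} \<inter> T"]) blast
      next
        show "\<sigma> t \<in> \<sigma> ` {t0<..t1}" "\<sigma> t1 \<in> \<sigma> ` {t0<..t1}" using t(1) t01 by auto
        show "down p (\<sigma> t)" by (rule start)
      qed
      then show ?thesis using not_down t1(2) by simp
    qed
    then show "\<delta> \<le> curve_length A F \<sigma> q0 q1" using len part1 part3 by linarith
  qed
qed

end

theorem theorem1:
  fixes A :: "('m::{t2_space,second_countable_topology}, 'e::euclidean_space) chart set"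
    and F :: "'m \<Rightarrow> ('m, 'e) tvec \<Rightarrow> real"
    and N :: "'m set"
  assumes "finsler_manifold A F"
    and "closed_submanifold A N"
  shows "N \<inter> cut_locus A F N = {}"
proof (rule ccontr)
  assume "N \<inter> cut_locus A F N \<noteq> {}"
  interpret finsler A F by unfold_locales (rule assms(1))
  from \<open>N \<inter> cut_locus A F N \<noteq> {}\<close> obtain q v \<gamma> a b where q: "q \<in> N"
    and seg: "N_segment A F N v \<gamma> a b" "\<gamma> b = q"
    and max: "\<And>\<gamma>' b'. b < b' \<Longrightarrow> (\<forall>t\<in>{a..b}. \<gamma>' t = \<gamma> t) \<Longrightarrow> \<not> N_segment A F N v \<gamma>' a b'"
    unfolding cut_locus_def by blast
  have dist: "dist_from A F N q = ereal (b - a)" using seg by (simp add: N_segment_def)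
  obtain e \<gamma>' where e: "a \<le> b" "a < e" "b \<le> e" "N_geodesic A F N \<gamma>' a e" "unit_speed A F \<gamma>' a e"
      "velocity A {a..e} \<gamma>' a = v" "\<forall>t\<in>{a..b}. \<gamma> t = \<gamma>' t"
    using seg(1) unfolding N_segment_def unit_N_geodesic_def by blast
  have ab: "a = b" using dist_from_nonpos[OF q] dist e(1) by (simp add: zero_ereal_def)
  have \<gamma>a: "\<gamma>' a = q" using e(7) seg(2) ab by simp
  obtain c V where c: "c \<in> A" "q \<in> chart_dom c" "subspace V" "chart_map c ` (chart_dom c \<inter> N) = chart_cod c \<inter> V"
    using assms(2) q unfolding closed_submanifold_def by blast
  have conN: "connected N" using assms(2) by (simp add: closed_submanifold_def)
  \<comment> \<open>The degenerate segment itself asserts that \<open>q\<close> has distance 0 from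
    \<open>N\<close>; this is what excludes loops of negative length when the sign changes.\<close>
  have dist0: "0 \<le> dist_from A F N (\<gamma>' a)" unfolding \<gamma>a dist using ab by simp
  have dom: "\<gamma>' a \<in> chart_dom c" using c(2) \<gamma>a by simp
  \<comment> \<open>The unit velocity of the geodesic supplies the positive value that
    \<open>sign_dichotomy\<close> asks for.\<close>
  have "(\<forall>p. positive_at p) \<or> sign_changing"
  proof (rule euler_lagrange[OF c(1,4,3) e(4,5) dom], goal_cases)
    case (1 b1 x w)
    have "x a = chart_map c (\<gamma>' a)" "LE c (x a, w a) > 0" using 1(1) 1(5,6)[of a] by auto
    then show ?case using sign_dichotomy[OF c(1)] map_cod[OF dom] by metis
  qed
  then obtain \<delta> where \<delta>: "\<delta> > 0" "a + \<delta> < e"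
    "\<And>\<sigma> p q. pw_smooth_curve A \<sigma> p q \<Longrightarrow> \<sigma> p \<in> N \<Longrightarrow> \<sigma> q = \<gamma>' (a + \<delta>) \<Longrightarrow> \<delta> \<le> curve_length A F \<sigma> p q"
  proof
    assume pos: "\<forall>p. positive_at p"
    show ?thesis
      using that by (rule minimizing_positive[OF pos[rule_format] c(1,4,3) e(4,5) dom])
  next
    assume sc: sign_changing
    show ?thesis
      using that by (rule minimizing_sign_changing[OF sc c(1,4,3) e(4,5) dom conN dist0])
  qed
  have pw: "pw_smooth_curve A \<gamma>' a (a + \<delta>)"
    by (rule pw_smooth_sub[of _ a e]) (use e(4) \<delta> in \<open>auto simp: N_geodesic_def\<close>)
  have len: "curve_length A F \<gamma>' a (a + \<delta>) = \<delta>"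
  proof -
    have sp: "speed \<gamma>' t = 1" if t: "t \<in> {a<..<a + \<delta>}" for t
    proof -
      have "t \<in> {a<..<e}" "t \<in> {a..e}" using t \<delta>(2) by auto
      then show ?thesis
        using e(5) velocity_interior[of t a e \<gamma>'] unfolding unit_speed_def speed_def by metis
    qed
    have "integral {a..a + \<delta>} (speed \<gamma>') = integral {a..a + \<delta>} (\<lambda>_. 1)"
      by (rule integral_spike[of "{a, a + \<delta>}"]) (use sp in auto)
    then show ?thesis using \<delta>(1) by (simp add: curve_length_speed)
  qed
  have "dist_from A F N (\<gamma>' (a + \<delta>)) = ereal \<delta>"
  proof (rule antisym)
    show "dist_from A F N (\<gamma>' (a + \<delta>)) \<le> ereal \<delta>"
      using dist_from_le[OF pw, of N] len \<gamma>a q by simp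
    show "ereal \<delta> \<le> dist_from A F N (\<gamma>' (a + \<delta>))"
      unfolding dist_from_def using \<delta>(3) by (intro Inf_greatest) auto
  qed
  \<comment> \<open>The curve \<open>\<gamma>'\<close> on \<open>{a..e}\<close> that witnesses the
    degenerate segment also witnesses the longer one, so the initial velocity is the same
    \<open>v\<close>.\<close>
  then have "N_segment A F N v \<gamma>' a (a + \<delta>)"
    unfolding N_segment_def unit_N_geodesic_def using e \<delta> len
    by (auto intro!: exI[of _ e] exI[of _ \<gamma>'])
  moreover have "b < a + \<delta>" "\<forall>t\<in>{a..b}. \<gamma>' t = \<gamma> t" using ab \<delta>(1) e(7) by auto
  ultimately show False using max by blast
qed

end
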